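(* Assume (H3), (H0)–(H2), that $D(x)$ is irreducible for every $x\in\mathbb T^N$, and that $\mathcal A\ne\emptyset$. Then for every continuous $1$-periodic $u_0:\mathbb T^N\to\mathbb R^m$ there exists a continuous viscosity solution $u_\infty$ of the stationary system (S) such that the viscosity solution $u$ of the evolutive system (E) with initial datum $u_0$ satisfies $$\lim_{t\to\infty}\sup_{x\in\mathbb T^N}|u(x,t)-u_\infty(x)|=0.$$ Moreover $(u_\infty)_i=(u_\infty)_j$ on $\mathcal A$ for all $i,j$.
   Context: $\mathbb T^N=\mathbb R^N/\mathbb Z^N$; $D(x)=(d_{ij}(x))_{1\le i,j\le m}$. (H3): each $d_{ij}$ continuous, $d_{ii}\ge0$, $d_{ij}\le0$ ($i\ne j$), $\sum_jd_{ij}\ge0$. Irreducible: for every proper subset $\mathcal I\subsetneq\{1,\dots,m\}$ there exist $i\in\mathcal I$, $j\notin\mathcal I$ with $d_{ij}(x)\ne0$. $H_i(x,p)=F_i(x,p)-f_i(x)$ with (H0) $f_i,F_i$ continuous, $1$-periodic in $x$; (H1) $F_i(x,\cdot)$ convex, coercive ($\inf_xF_i(x,p)\to\infty$ as $|p|\to\infty$), $F_i(x,p)\ge F_i(x,0)=0$; (H2) $f_i\ge0$. Sets: $\mathcal F=\{x:\sum_if_i(x)=0\}$, $\mathcal D_i=\{x:\sum_jd_{ij}(x)=0\}$, $\mathcal A=\mathcal F\cap\bigcap_i\mathcal D_i$. Stationary system (S): $H_i(x,Du_i)+\sum_jd_{ij}(x)u_j=0$ in $\mathbb T^N$. Evolutive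 system (E): $\partial_tu_i+H_i(x,Du_i)+\sum_jd_{ij}(x)u_j=0$ in $\mathbb T^N\times(0,\infty)$, $u_i(x,0)=u_{0,i}(x)$; it has a unique continuous viscosity solution for continuous periodic $u_0$. Viscosity solutions of systems are understood componentwise. *)

theory Defs
  imports "HOL-Analysis.Analysis"
begin

text \<open>Functions on the torus T^N are represented as 1-periodic functions on real^'n.\<close>
definition periodic1 :: "(real^'n \<Rightarrow> 'b) \<Rightarrow> bool" where
  "periodic1 g \<longleftrightarrow> (\<forall>x i. g (x + axis i 1) = g x)"

definition C1_grad :: "('a::euclidean_space \<Rightarrow> real) \<Rightarrow> ('a \<Rightarrow> 'a) \<Rightarrow> bool" where
  "C1_grad phi Dphi \<longleftrightarrow>
     (\<forall>z. (phi has_derivative (\<lambda>h. Dphi z \<bullet> h)) (at z)) \<and> continuous_on UNIV Dphi"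

definition loc_max :: "('a::metric_space \<Rightarrow> real) \<Rightarrow> 'a \<Rightarrow> bool" where
  "loc_max g z0 \<longleftrightarrow> (\<exists>e>0. \<forall>z. dist z z0 < e \<longrightarrow> g z \<le> g z0)"

definition loc_min :: "('a::metric_space \<Rightarrow> real) \<Rightarrow> 'a \<Rightarrow> bool" where
  "loc_min g z0 \<longleftrightarrow> (\<exists>e>0. \<forall>z. dist z z0 < e \<longrightarrow> g z0 \<le> g z)"

definition irreducible_mat :: "('m::finite \<Rightarrow> 'm \<Rightarrow> real) \<Rightarrow> bool" where
  "irreducible_mat D \<longleftrightarrow>
     (\<forall>I. I \<noteq> {} \<and> I \<noteq> UNIV \<longrightarrow> (\<exists>i\<in>I. \<exists>j. j \<notin> I \<and> D i j \<noteq> 0))"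

definition stat_visc_sol ::
  "('m::finite \<Rightarrow> real^'n \<Rightarrow> real^'n \<Rightarrow> real) \<Rightarrow> ('m \<Rightarrow> real^'n \<Rightarrow> real)
   \<Rightarrow> (real^'n \<Rightarrow> 'm \<Rightarrow> 'm \<Rightarrow> real) \<Rightarrow> ('m \<Rightarrow> real^'n \<Rightarrow> real) \<Rightarrow> bool" where
  "stat_visc_sol F f d u \<longleftrightarrow>
     (\<forall>i. continuous_on UNIV (u i) \<and> periodic1 (u i)) \<and>
     (\<forall>i phi Dphi x0. C1_grad phi Dphi \<longrightarrow> loc_max (\<lambda>y. u i y - phi y) x0 \<longrightarrow>
        F i x0 (Dphi x0) - f i x0 + (\<Sum>j\<in>UNIV. d x0 i j * u j x0) \<le> 0) \<and>
     (\<forall>i phi Dphi x0. C1_grad phi Dphi \<longrightarrow> loc_min (\<lambda>y. u i y - phi y) x0 \<longrightarrow>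
        F i x0 (Dphi x0) - f i x0 + (\<Sum>j\<in>UNIV. d x0 i j * u j x0) \<ge> 0)"

text \<open>Continuous viscosity solution of the evolutive system (E) with initial datum u0;
  u i x t is the i-th component at (x,t). Test functions live on real^'n \<times> real,
  whose gradient is the pair (D_x phi, partial_t phi).\<close>
definition evol_visc_sol ::
  "('m::finite \<Rightarrow> real^'n \<Rightarrow> real^'n \<Rightarrow> real) \<Rightarrow> ('m \<Rightarrow> real^'n \<Rightarrow> real)
   \<Rightarrow> (real^'n \<Rightarrow> 'm \<Rightarrow> 'm \<Rightarrow> real) \<Rightarrow> ('m \<Rightarrow> real^'n \<Rightarrow> real)
   \<Rightarrow> ('m \<Rightarrow> real^'n \<Rightarrow> real \<Rightarrow> real) \<Rightarrow> bool" where
  "evol_visc_sol F f d u0 u \<longleftrightarrow>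
     (\<forall>i. continuous_on (UNIV \<times> {0..}) (\<lambda>(x,t). u i x t)) \<and>
     (\<forall>i t. periodic1 (\<lambda>x. u i x t)) \<and>
     (\<forall>i x. u i x 0 = u0 i x) \<and>
     (\<forall>i phi Dphi x0 t0. t0 > 0 \<longrightarrow> C1_grad phi Dphi \<longrightarrow>
        loc_max (\<lambda>(y,s). u i y s - phi (y,s)) (x0,t0) \<longrightarrow>
        snd (Dphi (x0,t0)) + F i x0 (fst (Dphi (x0,t0))) - f i x0
          + (\<Sum>j\<in>UNIV. d x0 i j * u j x0 t0) \<le> 0) \<and>
     (\<forall>i phi Dphi x0 t0. t0 > 0 \<longrightarrow> C1_grad phi Dphi \<longrightarrow>
        loc_min (\<lambda>(y,s). u i y s - phi (y,s)) (x0,t0) \<longrightarrow>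
        snd (Dphi (x0,t0)) + F i x0 (fst (Dphi (x0,t0))) - f i x0
          + (\<Sum>j\<in>UNIV. d x0 i j * u j x0 t0) \<ge> 0)"

end

(* Coercivity bounds the spatial gradients of test functions as soon as their time derivatives are
   bounded, which gives a comparison principle for (E), hence L^infinity contraction, and moduli of
   continuity in t and in x that are uniform in t. The half limits limsup u and liminf u as
   t -> infinity are therefore continuous, and by stability they are a sub- and a supersolution of
   (S). On A the functions t |-> u_i(x,t) satisfy y' + D(x) y <= 0 with zero row sums; their maximum
   is nonincreasing, and irreducibility propagates any defect below it to all components, so all of
   them converge to the same limit. Comparison for (S) with boundary data on A (scale the subsolution
   by mu < 1, using convexity and F(x,0) = 0; irreducibility forces the maximum points into A) then
   makes the two half limits equal. Perron's method provides a stationary solution, which bounds u. *)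
theory Submission
  imports Defs
begin

section \<open>Test functions and stability of maxima\<close>

text \<open>No structure condition controls \<open>F i x p - F i y p\<close> for large p, and
  solutions of (E) are merely continuous, so doubling of variables needs an a priori bound on the
  gradients of the test functions. \<open>doubling_at_max\<close> obtains it, and both comparison
  principles for the PDEs go through that lemma, stationary functions being read as functions of (x,
  t) that are constant in t. The row sums of the coupling may vanish identically, so the zero order
  terms give no strict monotonicity: for (E) strictness comes from an exponential in time, for (S)
  from the gain (1 - mu) f of the scaled subsolution together with the data on A. On A the
  differential inequality in t comes from F \<ge> 0 and f = 0 at a fixed point x, so no gradient
  bound enters it. Supersolutions are reduced to subsolutions by u -> -u, which turns F(x, p) into
  -F(x, -p). This destroys convexity and coercivity, so the lemmas transferred in this way ask at
  most for continuity of F.\<close>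

lemma C1_grad_add:
  assumes "C1_grad f Df" "C1_grad g Dg"
  shows "C1_grad (\<lambda>z. f z + g z) (\<lambda>z. Df z + Dg z)"
  using assms unfolding C1_grad_def
  by (auto simp: inner_add_left intro!: continuous_intros derivative_eq_intros)

lemma C1_grad_uminus:
  assumes "C1_grad f Df"
  shows "C1_grad (\<lambda>z. - f z) (\<lambda>z. - Df z)"
  using assms unfolding C1_grad_def
  by (auto simp: inner_minus_left fun_eq_iff intro!: continuous_on_minus derivative_eq_intros)

lemma C1_grad_cmult:
  assumes "C1_grad f Df"
  shows "C1_grad (\<lambda>z. c * f z) (\<lambda>z. c *\<^sub>R Df z)"
  using assms unfolding C1_grad_def
  by (auto intro!: continuous_intros derivative_eq_intros)

lemma C1_grad_const: "C1_grad (\<lambda>z. c) (\<lambda>z. 0)"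
  unfolding C1_grad_def by (auto intro!: continuous_intros derivative_eq_intros)

lemma C1_grad_sq_dist: "C1_grad (\<lambda>z. (norm (z - z0))\<^sup>2) (\<lambda>z. 2 *\<^sub>R (z - z0))"
  unfolding C1_grad_def power2_norm_eq_inner
  by (auto simp: inner_commute intro!: continuous_intros derivative_eq_intros)

lemma C1_grad_continuous: "C1_grad phi Dphi \<Longrightarrow> continuous_on UNIV phi"
  unfolding C1_grad_def
  by (metis continuous_at_imp_continuous_on has_derivative_continuous)

text \<open>Chain rule for an affine map \<open>g\<close>, whose derivative \<open>L\<close> is the
  same at every point. \<open>M\<close> is the adjoint of \<open>L\<close> and carries gradients
  back. Projections, slices and translations are the instances.\<close>

lemma C1_grad_compose_affine:
  fixes phi :: "'a::euclidean_space \<Rightarrow> real" and g :: "'b::euclidean_space \<Rightarrow> 'a"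
  assumes "C1_grad phi D" and g: "\<And>z. (g has_derivative L) (at z)"
    and adj: "\<And>h v. v \<bullet> L h = M v \<bullet> h" and M: "continuous_on UNIV M"
  shows "C1_grad (\<lambda>z. phi (g z)) (\<lambda>z. M (D (g z)))"
proof -
  have phi: "(phi has_derivative (\<lambda>h. D z \<bullet> h)) (at z)" and D: "continuous_on UNIV D" for z
    using assms(1) unfolding C1_grad_def by auto
  have gc: "continuous_on UNIV g"
    using g by (metis continuous_at_imp_continuous_on has_derivative_continuous)
  have "continuous_on UNIV (\<lambda>z. D (g z))"
    using continuous_on_compose2[OF D gc] by simp
  then have "continuous_on UNIV (\<lambda>z. M (D (g z)))"
    using continuous_on_compose2[OF M] by fastforce
  moreover have "((\<lambda>z. phi (g z)) has_derivative (\<lambda>h. M (D (g z)) \<bullet> h)) (at z)" for z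
    using has_derivative_compose[OF g phi, of z] by (simp add: adj)
  ultimately show ?thesis unfolding C1_grad_def by blast
qed

lemma C1_grad_fst:
  assumes "C1_grad phi D"
  shows "C1_grad (\<lambda>z. phi (fst z)) (\<lambda>z::'a::euclidean_space \<times> 'b::euclidean_space. (D (fst z), 0))"
  by (rule C1_grad_compose_affine[OF assms, where L = fst and M = "\<lambda>v. (v, 0)"])
     (auto simp: inner_prod_def intro!: derivative_eq_intros continuous_on_Pair continuous_on_id continuous_on_const)

lemma C1_grad_snd:
  assumes "C1_grad phi D"
  shows "C1_grad (\<lambda>z. phi (snd z)) (\<lambda>z::'a::euclidean_space \<times> 'b::euclidean_space. (0, D (snd z)))"
  by (rule C1_grad_compose_affine[OF assms, where L = snd and M = "\<lambda>v. (0, v)"])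
     (auto simp: inner_prod_def intro!: derivative_eq_intros continuous_on_Pair continuous_on_id continuous_on_const)

lemma C1_grad_slice_fst:
  fixes phi :: "'a::euclidean_space \<times> 'b::euclidean_space \<Rightarrow> real"
  assumes "C1_grad phi D"
  shows "C1_grad (\<lambda>x. phi (x, b)) (\<lambda>x. fst (D (x, b)))"
  by (rule C1_grad_compose_affine[OF assms, where L = "\<lambda>h. (h, 0)" and M = fst])
     (auto simp: inner_prod_def intro!: derivative_eq_intros continuous_on_fst continuous_on_id)

lemma C1_grad_slice_snd:
  fixes phi :: "'a::euclidean_space \<times> 'b::euclidean_space \<Rightarrow> real"
  assumes "C1_grad phi D"
  shows "C1_grad (\<lambda>y. phi (a, y)) (\<lambda>y. snd (D (a, y)))"
  by (rule C1_grad_compose_affine[OF assms, where L = "\<lambda>h. (0, h)" and M = snd])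
     (auto simp: inner_prod_def intro!: derivative_eq_intros continuous_on_snd continuous_on_id)

lemma C1_grad_translate:
  assumes "C1_grad phi D"
  shows "C1_grad (\<lambda>z. phi (z + c)) (\<lambda>z. D (z + c))"
  by (rule C1_grad_compose_affine[OF assms, where L = "\<lambda>h. h" and M = "\<lambda>v. v"])
     (auto intro!: derivative_eq_intros continuous_on_id)

lemma C1_grad_real:
  assumes "\<And>t. (q has_real_derivative q' t) (at t)" "continuous_on UNIV q'"
  shows "C1_grad q q'"
  using assms unfolding C1_grad_def by (auto simp: has_field_derivative_def)

section \<open>Contact points of test functions\<close>

lemma C1_grad_unique_at_max:
  assumes "C1_grad phi D" "C1_grad psi E" "loc_max (\<lambda>z. phi z - psi z) z0"
  shows "D z0 = E z0"
proof -
  obtain e where e: "e > 0" "\<And>z. dist z z0 < e \<Longrightarrow> phi z - psi z \<le> phi z0 - psi z0"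
    using assms(3) unfolding loc_max_def by blast
  have "((\<lambda>z. phi z - psi z) has_derivative (\<lambda>h. D z0 \<bullet> h - E z0 \<bullet> h)) (at z0)"
    using assms(1,2) unfolding C1_grad_def by (auto intro!: derivative_intros)
  from differential_zero_maxmin[OF _ _ this, of "ball z0 e"] e
  have "(\<lambda>h. D z0 \<bullet> h - E z0 \<bullet> h) = (\<lambda>h. 0)"
    by (auto simp: dist_commute)
  then have "(D z0 - E z0) \<bullet> (D z0 - E z0) = 0"
    by (metis inner_diff_left)
  then show ?thesis by simp
qed

lemma loc_min_iff_loc_max: "loc_min g z \<longleftrightarrow> loc_max (\<lambda>z. - g z) z"
  unfolding loc_min_def loc_max_def by simp

lemma loc_max_mono:
  assumes "loc_max g z0" "\<And>z. h z \<le> g z + c" "h z0 = g z0 + c"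
  shows "loc_max h z0"
proof -
  obtain e where e: "e > 0" "\<And>z. dist z z0 < e \<Longrightarrow> g z \<le> g z0"
    using assms(1) unfolding loc_max_def by blast
  have "h z \<le> h z0" if "dist z z0 < e" for z
    using assms(2)[of z] assms(3) e(2)[OF that] by linarith
  then show ?thesis using e(1) unfolding loc_max_def by blast
qed

text \<open>The \<open>a n\<close> need only lie asymptotically below \<open>A\<close>, locally
  uniformly, and reach it at \<open>z0\<close> itself; \<open>A\<close> may be discontinuous. The
  added |z - z0|^2 makes the maximum of A - phi strict, so by compactness the maximisers over a
  small closed ball cannot stay away from \<open>z0\<close>.\<close>

lemma stability_of_maxima:
  fixes a :: "nat \<Rightarrow> 'a::euclidean_space \<Rightarrow> real"
  assumes r: "r > 0" and cont: "\<And>n. continuous_on (cball z0 r) (a n)"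
    and up: "\<And>z e. z \<in> cball z0 r \<Longrightarrow> e > 0 \<Longrightarrow>
       \<exists>rho>0. \<forall>\<^sub>F n in sequentially. \<forall>y\<in>ball z rho \<inter> cball z0 r. a n y \<le> A z + e"
    and lim: "(\<lambda>n. a n z0) \<longlonglongrightarrow> A z0"
    and max: "loc_max (\<lambda>z. A z - phi z) z0" and phi: "continuous_on UNIV phi"
  obtains zs where "zs \<longlonglongrightarrow> z0" "(\<lambda>n. a n (zs n)) \<longlonglongrightarrow> A z0"
    "\<forall>\<^sub>F n in sequentially. loc_max (\<lambda>z. a n z - (phi z + (norm (z - z0))\<^sup>2)) (zs n)"
proof -
  obtain e0 where e0: "e0 > 0" "\<And>z. dist z z0 < e0 \<Longrightarrow> A z - phi z \<le> A z0 - phi z0"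
    using max unfolding loc_max_def by blast
  define r' where "r' = min r (e0/2)"
  define K where "K = cball z0 r'"
  have r': "r' > 0" "r' \<le> r" "r' < e0" using r e0(1) by (auto simp: r'_def)
  have Kr: "K \<subseteq> cball z0 r" using r' by (auto simp: K_def)
  define psi where "psi = (\<lambda>z. phi z + (norm (z - z0))\<^sup>2)"
  have psi_cont: "continuous_on UNIV psi" unfolding psi_def by (intro continuous_intros phi)
  define b where "b = (\<lambda>n z. a n z - psi z)"
  have bcont: "continuous_on K (b n)" for n
    unfolding b_def
    by (intro continuous_intros continuous_on_subset[OF cont Kr] continuous_on_subset[OF psi_cont]) auto
  have "\<exists>z\<in>K. \<forall>y\<in>K. b n y \<le> b n z" for n
    by (rule continuous_attains_sup[OF _ _ bcont]) (use r' in \<open>auto simp: K_def\<close>)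
  then obtain zs where zs: "\<And>n. zs n \<in> K" "\<And>n y. y \<in> K \<Longrightarrow> b n y \<le> b n (zs n)" by metis
  have z0K: "z0 \<in> K" using r' by (auto simp: K_def)
  have loc: "\<exists>rho>0. \<forall>\<^sub>F n in sequentially. \<forall>y\<in>ball z rho \<inter> K. b n y < b n z0"
    if z: "z \<in> K" "z \<noteq> z0" for z
  proof -
    \<comment> \<open>A quarter of the gap that the quadratic term creates at z, since three errors
      of size \<open>e\<close> follow: in \<open>a n y\<close>, in \<open>psi y\<close> and in
      \<open>a n z0\<close>.\<close>
    define e where "e = (norm (z - z0))\<^sup>2 / 4"
    have e: "e > 0" using z by (simp add: e_def)
    obtain rho1 where rho1: "rho1 > 0"
      "\<forall>\<^sub>F n in sequentially. \<forall>y\<in>ball z rho1 \<inter> cball z0 r. a n y \<le> A z + e"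
      using up[of z e] z Kr e by blast
    have "\<forall>\<^sub>F y in at z. dist (psi y) (psi z) < e"
      using psi_cont e unfolding continuous_on_def tendsto_iff by auto
    then obtain rho2 where rho2: "rho2 > 0" "\<And>y. dist y z < rho2 \<Longrightarrow> dist (psi y) (psi z) < e"
      using e unfolding eventually_at by (metis UNIV_I dist_self)
    have Az: "A z - psi z \<le> A z0 - psi z0 - 4 * e"
      using e0(2)[of z] z(1) r' by (auto simp: K_def psi_def e_def dist_commute)
    have "\<forall>\<^sub>F n in sequentially. dist (a n z0) (A z0) < e" using lim e unfolding tendsto_iff by auto
    with rho1(2) have "\<forall>\<^sub>F n in sequentially. \<forall>y\<in>ball z (min rho1 rho2) \<inter> K. b n y < b n z0"
    proof eventually_elim
      case (elim n)
      show ?case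
      proof
        fix y assume y: "y \<in> ball z (min rho1 rho2) \<inter> K"
        have "a n y \<le> A z + e" using elim(1) y Kr by auto
        moreover have "dist (psi y) (psi z) < e" using y by (intro rho2(2)) (auto simp: dist_commute)
        ultimately show "b n y < b n z0" using Az elim(2) unfolding b_def dist_real_def by argo
      qed
    qed
    moreover have "min rho1 rho2 > 0" using rho1(1) rho2(1) by simp
    ultimately show ?thesis by blast
  qed
  have conv: "zs \<longlonglongrightarrow> z0"
  proof (rule tendstoI)
    fix e :: real assume e: "e > 0"
    define K' where "K' = K - ball z0 e"
    have comp: "compact K'" unfolding K'_def K_def by (intro compact_diff) auto
    have "\<forall>z\<in>K'. \<exists>rho>0. \<forall>\<^sub>F n in sequentially. \<forall>y\<in>ball z rho \<inter> K. b n y < b n z0"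
      using e by (intro ballI loc) (auto simp: K'_def)
    then obtain rho where rho: "\<And>z. z \<in> K' \<Longrightarrow> rho z > 0"
      "\<And>z. z \<in> K' \<Longrightarrow> \<forall>\<^sub>F n in sequentially. \<forall>y\<in>ball z (rho z) \<inter> K. b n y < b n z0"
      unfolding bchoice_iff by blast
    obtain C where C: "C \<subseteq> K'" "finite C" "K' \<subseteq> (\<Union>z\<in>C. ball z (rho z))"
      using compactE_image[OF comp, of K' "\<lambda>z. ball z (rho z)"] rho(1) by force
    have "\<forall>\<^sub>F n in sequentially. \<forall>z\<in>C. \<forall>y\<in>ball z (rho z) \<inter> K. b n y < b n z0"
      using C rho(2) by (intro eventually_ball_finite) auto
    then show "\<forall>\<^sub>F n in sequentially. dist (zs n) z0 < e"
    proof eventually_elim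
      case (elim n)
      show ?case
      proof (rule ccontr)
        assume "\<not> dist (zs n) z0 < e"
        then have "zs n \<in> K'" using zs(1) by (auto simp: K'_def dist_commute)
        then obtain z where "z \<in> C" "zs n \<in> ball z (rho z)" using C(3) by auto
        then have "b n (zs n) < b n z0" using elim zs(1) by auto
        then show False using zs(2)[OF z0K, of n] by linarith
      qed
    qed
  qed
  have psilim: "(\<lambda>n. psi (zs n)) \<longlonglongrightarrow> psi z0"
    using continuous_on_tendsto_compose[OF psi_cont conv] by auto
  \<comment> \<open>The upper bound is \<open>up\<close> at \<open>z0\<close>; the lower bound
    compares the maximiser with \<open>z0\<close>.\<close>
  have val: "(\<lambda>n. a n (zs n)) \<longlonglongrightarrow> A z0"
  proof (rule tendstoI)
    fix e :: real assume e: "e > 0"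
    obtain rho where rho: "rho > 0" "\<forall>\<^sub>F n in sequentially. \<forall>y\<in>ball z0 rho \<inter> cball z0 r. a n y \<le> A z0 + e/2"
      using up[of z0 "e/2"] e r by auto
    have e4: "e/4 > 0" using e by simp
    have "\<forall>\<^sub>F n in sequentially. dist (zs n) z0 < rho" using conv rho(1) unfolding tendsto_iff by auto
    moreover have "\<forall>\<^sub>F n in sequentially. dist (psi (zs n)) (psi z0) < e/4" using tendstoD[OF psilim e4] .
    moreover have "\<forall>\<^sub>F n in sequentially. dist (a n z0) (A z0) < e/4" using tendstoD[OF lim e4] .
    ultimately show "\<forall>\<^sub>F n in sequentially. dist (a n (zs n)) (A z0) < e" using rho(2)
    proof eventually_elim
      case (elim n)
      have "a n (zs n) \<le> A z0 + e/2" using elim(1,4) zs(1)[of n] Kr by (auto simp: dist_commute)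
      moreover have "b n z0 \<le> b n (zs n)" using zs(2)[OF z0K] .
      ultimately show ?case using elim(2,3) e unfolding b_def dist_real_def by argo
    qed
  qed
  have "\<forall>\<^sub>F n in sequentially. dist (zs n) z0 < r'" using conv r'(1) unfolding tendsto_iff by auto
  then have "\<forall>\<^sub>F n in sequentially. loc_max (\<lambda>z. a n z - (phi z + (norm (z - z0))\<^sup>2)) (zs n)"
  proof eventually_elim
    case (elim n)
    show ?case unfolding loc_max_def
    proof (intro exI[of _ "r' - dist (zs n) z0"] conjI allI impI)
      show "r' - dist (zs n) z0 > 0" using elim by simp
      fix z assume "dist z (zs n) < r' - dist (zs n) z0"
      then have "dist z z0 \<le> r'" using dist_triangle[of z z0 "zs n"] by linarith
      then have "z \<in> K" by (auto simp: K_def dist_commute)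
      from zs(2)[OF this, of n] show "a n z - (phi z + (norm (z - z0))\<^sup>2)
         \<le> a n (zs n) - (phi (zs n) + (norm (zs n - z0))\<^sup>2)" unfolding b_def psi_def .
    qed
  qed
  with conv val show ?thesis using that by blast
qed

text \<open>A maximum constrained to the zero set of \<open>p\<close> is approximated by free maxima
  with the penalty n p. With p = |x - y|^2 this doubles variables; with p = |x - x0|^2 it freezes a
  point of space.\<close>

lemma penalised_maxima:
  fixes c :: "'a::euclidean_space \<Rightarrow> real"
  assumes r: "r > 0" and cc: "continuous_on (cball z0 r) c"
    and pc: "continuous_on UNIV p" and p0: "\<And>z. p z \<ge> 0" "p z0 = 0" and phi: "continuous_on UNIV phi"
    and e0: "e0 > 0" and max: "\<And>z. dist z z0 < e0 \<Longrightarrow> p z = 0 \<Longrightarrow> c z - phi z \<le> c z0 - phi z0"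
  obtains zs where "zs \<longlonglongrightarrow> z0"
    "\<forall>\<^sub>F n in sequentially. loc_max (\<lambda>z. c z - real n * p z - (phi z + (norm (z - z0))\<^sup>2)) (zs n)"
proof -
  \<comment> \<open>Off the zero set of \<open>p\<close> the penalised functions tend to minus
    infinity, so any real value is an admissible upper limit. This one makes A - phi there equal to
    its value at \<open>z0\<close>, which keeps \<open>z0\<close> a local maximum.\<close>
  define A where "A = (\<lambda>z. if p z = 0 then c z else c z0 - phi z0 + phi z)"
  have up: "\<exists>rho>0. \<forall>\<^sub>F n in sequentially. \<forall>y\<in>ball z rho \<inter> cball z0 r. c y - real n * p y \<le> A z + e"
    if z: "z \<in> cball z0 r" and e: "e > 0" for z e
  proof -
    obtain rho where rho: "rho > 0" "\<And>y. y \<in> cball z0 r \<Longrightarrow> dist y z < rho \<Longrightarrow> dist (c y) (c z) < e"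
      using cc z e unfolding continuous_on_iff by metis
    show ?thesis
    proof (cases "p z = 0")
      case True
      have "c y - real n * p y \<le> A z + e" if y: "y \<in> ball z rho \<inter> cball z0 r" for n y
      proof -
        have "dist (c y) (c z) < e" using rho(2)[of y] y by (auto simp: dist_commute)
        moreover have "real n * p y \<ge> 0" using p0(1) by simp
        moreover have "A z = c z" using True by (simp add: A_def)
        ultimately show ?thesis unfolding dist_real_def by linarith
      qed
      then show ?thesis using rho(1) by (intro exI[of _ rho]) auto
    next
      case False
      then have pz: "p z > 0" using p0(1)[of z] by simp
      obtain rho' where rho': "rho' > 0" "\<And>y. dist y z < rho' \<Longrightarrow> dist (p y) (p z) < p z / 2"
        using pc pz unfolding continuous_on_iff by (metis UNIV_I half_gt_zero)
      obtain N :: nat where N: "real N > (c z - A z) / (p z / 2)" using reals_Archimedean2 by blast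
      have "\<forall>y\<in>ball z (min rho rho') \<inter> cball z0 r. c y - real n * p y \<le> A z + e" if "n \<ge> N" for n
      proof
        fix y assume y: "y \<in> ball z (min rho rho') \<inter> cball z0 r"
        have "dist (c y) (c z) < e" using rho(2)[of y] y by (auto simp: dist_commute)
        moreover have "dist (p y) (p z) < p z / 2" using y by (intro rho'(2)) (auto simp: dist_commute)
        then have "p y \<ge> p z / 2" unfolding dist_real_def by linarith
        then have "real n * p y \<ge> real N * (p z / 2)" using that pz by (intro mult_mono) auto
        moreover have "real N * (p z / 2) > c z - A z" using N pz by (simp add: pos_divide_less_eq)
        ultimately show "c y - real n * p y \<le> A z + e" unfolding dist_real_def by linarith
      qed
      then have "\<forall>\<^sub>F n in sequentially. \<forall>y\<in>ball z (min rho rho') \<inter> cball z0 r. c y - real n * p y \<le> A z + e"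
        unfolding eventually_sequentially by blast
      moreover have "min rho rho' > 0" using rho rho' by simp
      ultimately show ?thesis by blast
    qed
  qed
  have cont: "continuous_on (cball z0 r) (\<lambda>z. c z - real n * p z)" for n
    by (intro continuous_intros cc continuous_on_subset[OF pc]) auto
  have lim: "(\<lambda>n. c z0 - real n * p z0) \<longlonglongrightarrow> A z0" by (simp add: A_def p0)
  have mx: "loc_max (\<lambda>z. A z - phi z) z0"
    unfolding loc_max_def
  proof (intro exI[of _ e0] conjI allI impI)
    fix z assume "dist z z0 < e0"
    then show "A z - phi z \<le> A z0 - phi z0" using max[of z] by (simp add: A_def p0)
  qed (rule e0)
  show ?thesis
    by (rule stability_of_maxima[where a = "\<lambda>n z. c z - real n * p z", OF r cont up lim mx phi])
       (use that in auto)
qed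

section \<open>Scalar sub- and supersolutions\<close>

text \<open>A scalar equation with right-hand side \<open>g\<close>. For the system,
  \<open>g\<close> contains f and the whole coupling, including the diagonal term in the unknown
  itself, so that each component can be treated alone.\<close>

definition evsub :: "('a::euclidean_space \<Rightarrow> 'a \<Rightarrow> real) \<Rightarrow> ('a \<times> real \<Rightarrow> real) \<Rightarrow> ('a \<times> real \<Rightarrow> real) \<Rightarrow> bool" where
  "evsub F g a \<longleftrightarrow> (\<forall>phi D z. snd z > 0 \<longrightarrow> C1_grad phi D \<longrightarrow> loc_max (\<lambda>z. a z - phi z) z \<longrightarrow>
     snd (D z) + F (fst z) (fst (D z)) \<le> g z)"

definition evsup :: "('a::euclidean_space \<Rightarrow> 'a \<Rightarrow> real) \<Rightarrow> ('a \<times> real \<Rightarrow> real) \<Rightarrow> ('a \<times> real \<Rightarrow> real) \<Rightarrow> bool" where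
  "evsup F g a \<longleftrightarrow> (\<forall>phi D z. snd z > 0 \<longrightarrow> C1_grad phi D \<longrightarrow> loc_min (\<lambda>z. a z - phi z) z \<longrightarrow>
     snd (D z) + F (fst z) (fst (D z)) \<ge> g z)"

lemma evsubD:
  assumes "evsub F g a" "t > 0" "C1_grad phi D" "loc_max (\<lambda>z. a z - phi z) (x, t)"
  shows "snd (D (x, t)) + F x (fst (D (x, t))) \<le> g (x, t)"
  using assms unfolding evsub_def by fastforce

lemma evsupD:
  assumes "evsup F g a" "t > 0" "C1_grad phi D" "loc_min (\<lambda>z. a z - phi z) (x, t)"
  shows "snd (D (x, t)) + F x (fst (D (x, t))) \<ge> g (x, t)"
  using assms unfolding evsup_def by fastforce

lemma C1_grad_split:
  fixes al :: "'a::euclidean_space \<Rightarrow> real"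
  assumes "C1_grad al al'" "\<And>t. (be has_real_derivative be' t) (at t)" "continuous_on UNIV be'"
  shows "C1_grad (\<lambda>z. al (fst z) + be (snd z)) (\<lambda>z. (al' (fst z), be' (snd z)))"
  using C1_grad_add[OF C1_grad_fst[OF assms(1)] C1_grad_snd[OF C1_grad_real[OF assms(2,3)]]] by simp

lemma dist_Pair_same [simp]:
  "dist (x, b) (y, b) = dist x y" "dist (b, x) (b, y) = dist x y"
  by (auto simp: dist_Pair_Pair)

lemma loc_max_slice:
  assumes "loc_max G (a, b)"
  shows "loc_max (\<lambda>x. G (x, b)) a" "loc_max (\<lambda>y. G (a, y)) b"
  using assms unfolding loc_max_def by (metis dist_Pair_same)+

text \<open>The momenta \<open>P n\<close> need not converge: being bounded, they stay with the base
  points in one compact set, on which F is uniformly continuous. This replaces a structure condition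
  on F for large p.\<close>

lemma diff_tendsto_zero_of_bounded:
  fixes F :: "'a::euclidean_space \<Rightarrow> 'a \<Rightarrow> real"
  assumes Fc: "continuous_on UNIV (\<lambda>(x, p). F x p)"
    and xs: "xs \<longlonglongrightarrow> x0" and ys: "ys \<longlonglongrightarrow> x0" and del: "del \<longlonglongrightarrow> 0"
    and P: "\<forall>\<^sub>F n in sequentially. norm (P n) \<le> R"
  shows "(\<lambda>n. F (ys n) (P n + del n) - F (xs n) (P n)) \<longlonglongrightarrow> 0"
proof (rule tendstoI)
  fix e :: real assume e: "e > 0"
  let ?K = "cball x0 1 \<times> cball 0 (R + 1)"
  have "uniformly_continuous_on ?K (\<lambda>(x, p). F x p)"
    by (intro compact_uniformly_continuous continuous_on_subset[OF Fc] compact_Times) auto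
  then obtain r where r: "r > 0" "\<And>z z'. z \<in> ?K \<Longrightarrow> z' \<in> ?K \<Longrightarrow> dist z' z < r \<Longrightarrow>
      dist ((\<lambda>(x, p). F x p) z') ((\<lambda>(x, p). F x p) z) < e"
    using e unfolding uniformly_continuous_on_def by metis
  define r' where "r' = min (r/4) 1"
  have r': "r' > 0" "r' \<le> r/4" "r' \<le> 1" using r(1) by (auto simp: r'_def)
  from tendstoD[OF xs r'(1)] tendstoD[OF ys r'(1)] tendstoD[OF del r'(1)] P
  show "\<forall>\<^sub>F n in sequentially. dist (F (ys n) (P n + del n) - F (xs n) (P n)) 0 < e"
  proof eventually_elim
    case (elim n)
    have "norm (P n + del n) \<le> R + 1" using elim r' norm_triangle_ineq[of "P n" "del n"] by simp
    then have 1: "(ys n, P n + del n) \<in> ?K" "(xs n, P n) \<in> ?K" using elim r' by (auto simp: dist_commute)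
    have "dist (ys n, P n + del n) (xs n, P n) \<le> dist (ys n) (xs n) + dist (P n + del n) (P n)"
      unfolding dist_Pair_Pair by (rule sqrt_sum_squares_le_sum) auto
    also have "dist (ys n) (xs n) \<le> dist (ys n) x0 + dist (xs n) x0" by (rule dist_triangle2)
    also have "dist (P n + del n) (P n) = dist (del n) 0" by (simp add: dist_norm)
    finally have "dist (ys n, P n + del n) (xs n, P n) < r" using elim(1,2,3) r' r(1) by linarith
    from r(2)[OF 1(2,1) this] show ?case by (simp add: dist_norm)
  qed
qed

lemma sq_deriv: "((\<lambda>t. k * (t - s)\<^sup>2) has_real_derivative (2 * k * (t - s))) (at t)"
  by (auto intro!: derivative_eq_intros)

text \<open>The variables x are doubled with a penalty n |x - y|^2 while the penalty on t - s stays
  fixed: this bounds the time derivative of the test functions, so that coercivity bounds their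
  spatial gradients.\<close>
lemma doubling_at_max:
  fixes F :: "'a::euclidean_space \<Rightarrow> 'a \<Rightarrow> real"
  assumes Fc: "continuous_on UNIV (\<lambda>(x, p). F x p)"
    and Fco: "\<forall>M. \<exists>R. \<forall>x p. norm p \<ge> R \<longrightarrow> F x p \<ge> M"
    and ac: "continuous_on (UNIV \<times> {0<..}) a" and bc: "continuous_on (UNIV \<times> {0<..}) b"
    and gc: "continuous_on (UNIV \<times> {0<..}) g" and hc: "continuous_on (UNIV \<times> {0<..}) h"
    and sub: "evsub F g a" and sup: "evsup F h b"
    and q: "\<And>t. (q has_real_derivative q' t) (at t)" and qc: "continuous_on UNIV q'"
    and pos: "t0 > 0" "s0 > 0"
    and max: "loc_max (\<lambda>(x, t, s). a (x, t) - b (x, s) - kap * (t - s)\<^sup>2 - q t - q s) (x0, t0, s0)"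
  shows "q' t0 + q' s0 \<le> g (x0, t0) - h (x0, s0)"
proof -
  define z0 where "z0 = ((x0, t0), (x0, s0))"
  define r where "r = min t0 s0 / 2"
  have r: "r > 0" using pos by (simp add: r_def)
  have cb: "snd (fst z) > 0 \<and> snd (snd z) > 0" if "z \<in> cball z0 r" for z
  proof -
    have "dist (fst z) (x0, t0) \<le> r" "dist (snd z) (x0, s0) \<le> r"
      using that dist_fst_le[of z z0] dist_snd_le[of z z0] by (auto simp: z0_def dist_commute)
    then have "dist (snd (fst z)) t0 \<le> r" "dist (snd (snd z)) s0 \<le> r"
      using dist_snd_le[of "fst z" "(x0, t0)"] dist_snd_le[of "snd z" "(x0, s0)"] by auto
    moreover have "r \<le> t0 / 2" "r \<le> s0 / 2" by (auto simp: r_def)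
    ultimately show ?thesis using pos unfolding dist_real_def by linarith
  qed
  define c where "c = (\<lambda>z::('a \<times> real) \<times> ('a \<times> real). a (fst z) - b (snd z))"
  have cc: "continuous_on (cball z0 r) c"
    unfolding c_def using cb
    by (intro continuous_on_diff continuous_on_compose2[OF ac] continuous_on_compose2[OF bc]
        continuous_on_fst continuous_on_snd continuous_on_id) (force simp: mem_Times_iff)+
  define pen where "pen = (\<lambda>z::('a \<times> real) \<times> ('a \<times> real). (norm (fst (fst z) - fst (snd z)))\<^sup>2)"
  define phi where "phi = (\<lambda>z::('a \<times> real) \<times> ('a \<times> real). kap * (snd (fst z) - snd (snd z))\<^sup>2 + q (snd (fst z)) + q (snd (snd z)))"
  have q_cont: "continuous_on UNIV q"
    using q by (meson DERIV_continuous continuous_at_imp_continuous_on)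
  have phic: "continuous_on UNIV phi"
    unfolding phi_def
    by (intro continuous_on_add continuous_on_compose2[OF q_cont] continuous_intros) auto
  have penc: "continuous_on UNIV pen" unfolding pen_def by (intro continuous_intros)
  obtain e where e: "e > 0" "\<And>x t s. dist (x, t, s) (x0, t0, s0) < e \<Longrightarrow>
      a (x, t) - b (x, s) - kap * (t - s)\<^sup>2 - q t - q s
       \<le> a (x0, t0) - b (x0, s0) - kap * (t0 - s0)\<^sup>2 - q t0 - q s0"
    using max unfolding loc_max_def by (auto split: prod.splits)
  have mx: "c z - phi z \<le> c z0 - phi z0" if z: "dist z z0 < e/3" "pen z = 0" for z
  proof -
    \<comment> \<open>Zero penalty means equal space variables, so the maximum in (x, t, s) applies.
      The radius e/3 serves three coordinates.\<close>
    obtain x t s where zz: "z = ((x, t), (x, s))" using z(2) by (metis eq_iff_diff_eq_0 norm_eq_zero pen_def prod.collapse zero_eq_power2)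
    have "dist (x, t) (x0, t0) < e/3" "dist (x, s) (x0, s0) < e/3"
      using z(1) dist_fst_le[of z z0] dist_snd_le[of z z0] unfolding zz z0_def by auto
    then have "dist x x0 < e/3" "dist t t0 < e/3" "dist s s0 < e/3"
      using dist_fst_le[of "(x,t)" "(x0,t0)"] dist_snd_le[of "(x,t)" "(x0,t0)"] dist_snd_le[of "(x,s)" "(x0,s0)"] by auto
    moreover have "dist (x, t, s) (x0, t0, s0) \<le> dist x x0 + (dist t t0 + dist s s0)"
      unfolding dist_Pair_Pair
      by (rule order_trans[OF sqrt_sum_squares_le_sum])
         (auto intro: sqrt_sum_squares_le_sum)
    ultimately have "dist (x, t, s) (x0, t0, s0) < e" by linarith
    from e(2)[OF this] show ?thesis unfolding zz z0_def c_def phi_def fst_conv snd_conv by linarith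
  qed
  have e3: "e/3 > 0" using e by simp
  have pen0: "pen z \<ge> 0" "pen z0 = 0" for z by (simp_all add: pen_def z0_def)
  obtain zs where zs: "zs \<longlonglongrightarrow> z0" and
    ev: "\<forall>\<^sub>F n in sequentially. loc_max (\<lambda>z. c z - real n * pen z - (phi z + (norm (z - z0))\<^sup>2)) (zs n)"
    using penalised_maxima[OF r cc penc pen0 phic e3 mx] by blast
  define x where "x = (\<lambda>n. fst (fst (zs n)))"
  define t where "t = (\<lambda>n. snd (fst (zs n)))"
  define y where "y = (\<lambda>n. fst (snd (zs n)))"
  define s where "s = (\<lambda>n. snd (snd (zs n)))"
  have zsn: "zs n = ((x n, t n), (y n, s n))" for n by (simp add: x_def t_def y_def s_def)
  have xl: "x \<longlonglongrightarrow> x0" and tl: "t \<longlonglongrightarrow> t0" and yl: "y \<longlonglongrightarrow> x0" and sl: "s \<longlonglongrightarrow> s0"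
    unfolding x_def t_def y_def s_def
    using tendsto_fst[OF tendsto_fst[OF zs]] tendsto_snd[OF tendsto_fst[OF zs]]
      tendsto_fst[OF tendsto_snd[OF zs]] tendsto_snd[OF tendsto_snd[OF zs]] by (simp_all add: z0_def)
  \<comment> \<open>\<open>P n\<close> is the spatial gradient of the test function at (x n, t n),
    and \<open>P n + del n\<close> is the one at (y n, s n). They differ only by the two quadratic
    localising terms, so \<open>del\<close> tends to 0.\<close>
  define P where "P = (\<lambda>n. real n *\<^sub>R (2 *\<^sub>R (x n - y n)) + 2 *\<^sub>R (x n - x0))"
  define del where "del = (\<lambda>n. - (2 *\<^sub>R (x n - x0)) - 2 *\<^sub>R (y n - x0))"
  have ev1: "\<forall>\<^sub>F n in sequentially. t n > 0" using order_tendstoD(1)[OF tl pos(1)] .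
  have ev2: "\<forall>\<^sub>F n in sequentially. s n > 0" using order_tendstoD(1)[OF sl pos(2)] .
  from ev ev1 have subn: "\<forall>\<^sub>F n in sequentially. 2 * kap * (t n - s n) + q' (t n) + 2 * (t n - t0) + F (x n) (P n) \<le> g (x n, t n)"
  proof eventually_elim
    case (elim n)
    let ?f = "\<lambda>z. (real n * (norm (fst z - y n))\<^sup>2 + (kap * (snd z - s n)\<^sup>2 + q (snd z))) + (norm (z - (x0, t0)))\<^sup>2"
    let ?D = "\<lambda>z. (real n *\<^sub>R (2 *\<^sub>R (fst z - y n)), 2 * kap * (snd z - s n) + q' (snd z)) + 2 *\<^sub>R (z - (x0, t0))"
    have C: "C1_grad ?f ?D"
      by (intro C1_grad_add[OF C1_grad_split] C1_grad_sq_dist C1_grad_cmult DERIV_add sq_deriv q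
          continuous_intros qc)
    have "loc_max (\<lambda>X. c (X, (y n, s n)) - real n * pen (X, (y n, s n)) - (phi (X, (y n, s n)) + (norm ((X, (y n, s n)) - z0))\<^sup>2)) (x n, t n)"
      using loc_max_slice(1)[OF elim(1)[unfolded zsn]] .
    then have "loc_max (\<lambda>X. a X - ?f X) (x n, t n)"
      by (rule loc_max_mono[where c = "b (y n, s n) + q (s n) + (norm ((y n, s n) - (x0, s0)))\<^sup>2"])
         (auto simp: pen_def c_def phi_def z0_def norm_Pair split: prod.splits)
    from evsubD[OF sub elim(2) C this] show ?case
      unfolding P_def fst_add snd_add fst_scaleR snd_scaleR fst_diff snd_diff fst_conv snd_conv real_scaleR_def
      by linarith
  qed
  from ev ev2 have supn: "\<forall>\<^sub>F n in sequentially. 2 * kap * (t n - s n) - q' (s n) - 2 * (s n - s0) + F (y n) (P n + del n) \<ge> h (y n, s n)"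
  proof eventually_elim
    case (elim n)
    let ?f = "\<lambda>z. (real n * (norm (fst z - x n))\<^sup>2 + (kap * (snd z - t n)\<^sup>2 + q (snd z))) + (norm (z - (x0, s0)))\<^sup>2"
    let ?D = "\<lambda>z. (real n *\<^sub>R (2 *\<^sub>R (fst z - x n)), 2 * kap * (snd z - t n) + q' (snd z)) + 2 *\<^sub>R (z - (x0, s0))"
    have C: "C1_grad (\<lambda>z. - ?f z) (\<lambda>z. - ?D z)"
      by (intro C1_grad_uminus C1_grad_add[OF C1_grad_split] C1_grad_sq_dist C1_grad_cmult DERIV_add sq_deriv q
          continuous_intros qc)
    have "loc_max (\<lambda>Y. c ((x n, t n), Y) - real n * pen ((x n, t n), Y) - (phi ((x n, t n), Y) + (norm (((x n, t n), Y) - z0))\<^sup>2)) (y n, s n)"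
      using loc_max_slice(2)[OF elim(1)[unfolded zsn]] .
    then have "loc_max (\<lambda>Y. - (b Y - - ?f Y)) (y n, s n)"
      by (rule loc_max_mono[where c = "- a (x n, t n) + q (t n) + (norm ((x n, t n) - (x0, t0)))\<^sup>2"])
         (auto simp: pen_def c_def phi_def z0_def norm_Pair norm_minus_commute power2_commute split: prod.splits)
    then have "loc_min (\<lambda>Y. b Y - - ?f Y) (y n, s n)" by (simp add: loc_min_iff_loc_max)
    have "- (real n *\<^sub>R (2 *\<^sub>R (y n - x n)) + 2 *\<^sub>R (y n - x0)) = P n + del n"
      by (simp add: P_def del_def algebra_simps)
    with evsupD[OF sup elim(2) C \<open>loc_min _ _\<close>] show ?case
      unfolding fst_add snd_add fst_scaleR snd_scaleR fst_diff snd_diff fst_conv snd_conv real_scaleR_def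
        fst_uminus snd_uminus
      by (simp add: algebra_simps)
  qed
  have glim: "(\<lambda>n. g (x n, t n)) \<longlonglongrightarrow> g (x0, t0)"
    by (rule continuous_on_tendsto_compose[OF gc tendsto_Pair[OF xl tl]])
       (use pos ev1 in \<open>auto elim!: eventually_mono\<close>)
  have hlim: "(\<lambda>n. h (y n, s n)) \<longlonglongrightarrow> h (x0, s0)"
    by (rule continuous_on_tendsto_compose[OF hc tendsto_Pair[OF yl sl]])
       (use pos ev2 in \<open>auto elim!: eventually_mono\<close>)
  have qt: "(\<lambda>n. q' (t n)) \<longlonglongrightarrow> q' t0" and qs: "(\<lambda>n. q' (s n)) \<longlonglongrightarrow> q' s0"
    using continuous_on_tendsto_compose[OF qc tl] continuous_on_tendsto_compose[OF qc sl] by auto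
  \<comment> \<open>With \<open>kap\<close> fixed the time derivatives converge. The subsolution
    inequality then bounds \<open>F (x n) (P n)\<close> from above, and coercivity bounds
    \<open>P n\<close>.\<close>
  have blim: "(\<lambda>n. g (x n, t n) - (2 * kap * (t n - s n) + q' (t n) + 2 * (t n - t0)))
      \<longlonglongrightarrow> g (x0, t0) - (2 * kap * (t0 - s0) + q' t0 + 2 * (t0 - t0))"
    by (intro tendsto_intros glim tl sl qt)
  define B where "B = g (x0, t0) - (2 * kap * (t0 - s0) + q' t0 + 2 * (t0 - t0)) + 1"
  obtain R where R: "\<And>x p. norm p \<ge> R \<Longrightarrow> F x p \<ge> B" using Fco by blast
  have "\<forall>\<^sub>F n in sequentially. g (x n, t n) - (2 * kap * (t n - s n) + q' (t n) + 2 * (t n - t0)) < B"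
    by (rule order_tendstoD(2)[OF blim]) (simp add: B_def)
  with subn have Pb: "\<forall>\<^sub>F n in sequentially. norm (P n) \<le> R"
  proof eventually_elim
    case (elim n)
    then have "F (x n) (P n) < B" by linarith
    then show ?case using R[of "P n" "x n"] by force
  qed
  have dl: "del \<longlonglongrightarrow> 0"
    unfolding del_def using xl yl by (auto intro!: tendsto_eq_intros)
  have dF: "(\<lambda>n. F (y n) (P n + del n) - F (x n) (P n)) \<longlonglongrightarrow> 0"
    by (rule diff_tendsto_zero_of_bounded[OF Fc xl yl dl Pb])
  \<comment> \<open>Subtracting the two inequalities cancels the common time derivative 2 kap (t -
    s).\<close>
  have l1: "(\<lambda>n. q' (t n) + q' (s n) + 2 * (t n - t0) + 2 * (s n - s0) - (F (y n) (P n + del n) - F (x n) (P n)))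
     \<longlonglongrightarrow> q' t0 + q' s0 + 2 * (t0 - t0) + 2 * (s0 - s0) - 0"
    by (intro tendsto_intros qt qs tl sl dF)
  have l2: "(\<lambda>n. g (x n, t n) - h (y n, s n)) \<longlonglongrightarrow> g (x0, t0) - h (x0, s0)"
    by (intro tendsto_intros glim hlim)
  have "\<forall>\<^sub>F n in sequentially. q' (t n) + q' (s n) + 2 * (t n - t0) + 2 * (s n - s0) - (F (y n) (P n + del n) - F (x n) (P n))
     \<le> g (x n, t n) - h (y n, s n)"
    using subn supn by eventually_elim linarith
  from tendsto_le[OF _ l2 l1 this] show ?thesis by simp
qed

section \<open>Periodic functions\<close>

lemma periodic1_int_axis:
  assumes "periodic1 g"
  shows "g (x + axis i (of_int m)) = g x"
proof -
  have nat: "g (x + axis i (of_nat n)) = g x" for n :: nat and x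
  proof (induction n)
    case 0
    have "x + axis i (of_nat 0) = x" by (simp add: vec_eq_iff axis_def)
    then show ?case by (simp only:)
  next
    case (Suc n)
    have "x + axis i (of_nat (Suc n)) = (x + axis i (of_nat n)) + axis i 1"
      by (simp add: vec_eq_iff axis_def)
    then show ?case using Suc assms unfolding periodic1_def by (simp only:)
  qed
  show ?thesis
  proof (cases "m \<ge> 0")
    case True
    then show ?thesis using nat[of x "nat m"] by simp
  next
    case False
    have "(x + axis i (of_int m)) + axis i (of_nat (nat (- m))) = x"
      using False by (simp add: vec_eq_iff axis_def)
    then show ?thesis using nat[of "x + axis i (of_int m)" "nat (- m)"] by (simp only:)
  qed
qed

lemma periodic1_int_vector:
  assumes g: "periodic1 g" and k: "\<And>i. k $ i \<in> \<int>"
  shows "g (x + k) = g x"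
proof -
  have "g (x + (\<Sum>i\<in>S. axis i (k $ i))) = g x" if "finite S" for S
    using that
  proof (induction S rule: finite_induct)
    case (insert i S)
    obtain m where m: "k $ i = of_int m" using k Ints_cases by blast
    have "x + (\<Sum>i\<in>insert i S. axis i (k $ i)) = (x + (\<Sum>i\<in>S. axis i (k $ i))) + axis i (of_int m)"
      using insert m by (simp add: algebra_simps)
    then show ?case using insert.IH by (simp only: periodic1_int_axis[OF g])
  qed simp
  moreover have "(\<Sum>i\<in>UNIV. axis i (k $ i)) = k"
    by (simp add: vec_eq_iff axis_def)
  ultimately show ?thesis by (metis finite)
qed

lemma int_translate_into_cube:
  fixes x :: "real^'n"
  obtains k where "\<And>i. k $ i \<in> \<int>" "x + k \<in> cbox 0 1"
proof
  show "(\<chi> i. - of_int \<lfloor>x $ i\<rfloor>) $ i \<in> (\<int> :: real set)" for i :: 'n by simp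
  show "x + (\<chi> i. - of_int \<lfloor>x $ i\<rfloor>) \<in> cbox 0 1"
    by (simp add: mem_box_cart) (smt (verit) of_int_floor_le real_of_int_floor_add_one_ge)
qed

lemma periodic1_bounded:
  fixes g :: "real^'n \<Rightarrow> real"
  assumes "continuous_on UNIV g" "periodic1 g"
  obtains B where "B > 0" "\<And>x. \<bar>g x\<bar> \<le> B"
proof -
  have "bounded (g ` cbox 0 1)"
    by (intro compact_imp_bounded compact_continuous_image continuous_on_subset[OF assms(1)]) auto
  then obtain B where B: "B > 0" "\<And>x. x \<in> cbox 0 1 \<Longrightarrow> \<bar>g x\<bar> \<le> B"
    unfolding bounded_pos by auto
  have "\<bar>g x\<bar> \<le> B" for x
  proof -
    obtain k where k: "\<And>i. k $ i \<in> \<int>" "x + k \<in> cbox 0 1" using int_translate_into_cube[of x] by metis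
    then show ?thesis using B(2)[OF k(2)] periodic1_int_vector[OF assms(2) k(1)] by simp
  qed
  with B(1) show ?thesis using that by blast
qed

lemma uniform_bound:
  fixes B :: "'m::finite \<Rightarrow> real"
  obtains C where "C > 0" "\<And>i. B i \<le> C"
proof
  show "max 1 (Max (range B)) > 0" by simp
  show "B i \<le> max 1 (Max (range B))" for i by (meson Max_ge finite finite_imageI le_max_iff_disj rangeI)
qed

lemma periodic1_family_bounded:
  fixes g :: "'m::finite \<Rightarrow> real^'n \<Rightarrow> real"
  assumes "\<And>i. continuous_on UNIV (g i)" "\<And>i. periodic1 (g i)"
  shows "\<exists>B>0. \<forall>i x. \<bar>g i x\<bar> \<le> B"
proof -
  have "\<forall>i. \<exists>B. \<forall>x. \<bar>g i x\<bar> \<le> B" using periodic1_bounded[OF assms] by metis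
  then obtain B where B: "\<And>i x. \<bar>g i x\<bar> \<le> B i" by metis
  obtain C where C: "C > 0" "\<And>i. B i \<le> C" using uniform_bound by blast
  have "\<bar>g i x\<bar> \<le> C" for i x using order_trans[OF B C(2)] .
  then show ?thesis using C(1) by blast
qed

lemma finite_argmax:
  fixes v :: "'m::finite \<Rightarrow> real"
  obtains i where "\<And>j. v j \<le> v i"
proof -
  have "Max (range v) \<in> range v" by (intro Max_in) auto
  then obtain i where "v i = Max (range v)" by (metis imageE)
  then have "v j \<le> v i" for j by simp
  then show ?thesis using that by blast
qed

lemma uniform_modulus:
  fixes U :: "'m::finite \<Rightarrow> 'a::metric_space \<Rightarrow> real"
  assumes "\<And>i. continuous_on K (U i)" "compact K" "e > 0"
  shows "\<exists>r>0. \<forall>i. \<forall>z\<in>K. \<forall>z'\<in>K. dist z' z < r \<longrightarrow> \<bar>U i z' - U i z\<bar> < e"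
proof -
  have "\<forall>i. \<exists>r>0. \<forall>z\<in>K. \<forall>z'\<in>K. dist z' z < r \<longrightarrow> \<bar>U i z' - U i z\<bar> < e"
  proof
    fix i
    have "uniformly_continuous_on K (U i)" by (rule compact_uniformly_continuous[OF assms(1,2)])
    then show "\<exists>r>0. \<forall>z\<in>K. \<forall>z'\<in>K. dist z' z < r \<longrightarrow> \<bar>U i z' - U i z\<bar> < e"
      using assms(3) unfolding uniformly_continuous_on_def dist_real_def by blast
  qed
  then obtain r where r: "\<And>i. r i > 0"
    "\<And>i z z'. z \<in> K \<Longrightarrow> z' \<in> K \<Longrightarrow> dist z' z < r i \<Longrightarrow> \<bar>U i z' - U i z\<bar> < e" by metis
  obtain i0 where i0: "\<And>j. - r j \<le> - r i0" using finite_argmax[of "\<lambda>i. - r i"] by blast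
  show ?thesis
  proof (intro exI[of _ "r i0"] conjI allI ballI impI)
    show "r i0 > 0" using r(1) .
    fix i z z' assume "z \<in> K" "z' \<in> K" "dist z' z < r i0"
    then show "\<bar>U i z' - U i z\<bar> < e" using r(2)[of z z' i] i0[of i] by auto
  qed
qed

section \<open>Comparison for the evolutive system\<close>

locale weakly_coupled =
  fixes F :: "'m::finite \<Rightarrow> real^'n \<Rightarrow> real^'n \<Rightarrow> real"
    and f :: "'m \<Rightarrow> real^'n \<Rightarrow> real"
    and d :: "real^'n \<Rightarrow> 'm \<Rightarrow> 'm \<Rightarrow> real"
  assumes F_cont: "\<And>i. continuous_on UNIV (\<lambda>(x,p). F i x p)"
    and f_cont: "\<And>i. continuous_on UNIV (f i)"
    and F_per: "\<And>i p. periodic1 (\<lambda>x. F i x p)"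
    and f_per: "\<And>i. periodic1 (f i)"
    and F_convex: "\<And>i x. convex_on UNIV (F i x)"
    and F_coercive: "\<And>i. \<forall>M. \<exists>R. \<forall>x p. norm p \<ge> R \<longrightarrow> F i x p \<ge> M"
    and F_zero: "\<And>i x. F i x 0 = 0"
    and F_min: "\<And>i x p. F i x p \<ge> F i x 0"
    and f_nonneg: "\<And>i x. f i x \<ge> 0"
    and d_cont: "\<And>i j. continuous_on UNIV (\<lambda>x. d x i j)"
    and d_per: "\<And>i j. periodic1 (\<lambda>x. d x i j)"
    and d_diag: "\<And>i x. d x i i \<ge> 0"
    and d_off: "\<And>i j x. i \<noteq> j \<Longrightarrow> d x i j \<le> 0"
    and d_rowsum: "\<And>i x. (\<Sum>j\<in>UNIV. d x i j) \<ge> 0"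
    and d_irred: "\<And>x. irreducible_mat (d x)"
begin

text \<open>Maximum principle for the matrix: the off-diagonal entries are nonpositive, so replacing
  each \<open>v j\<close> by the larger \<open>v i\<close> lowers the sum, and what remains is the
  row sum times \<open>v i\<close>.\<close>

lemma coupling_nonneg_at_max:
  assumes "\<And>j. v j \<le> v i" "v i \<ge> 0"
  shows "(\<Sum>j\<in>UNIV. d x i j * v j) \<ge> 0"
proof -
  have "(\<Sum>j\<in>UNIV. d x i j * v j) \<ge> (\<Sum>j\<in>UNIV. d x i j * v i)"
  proof (rule sum_mono)
    fix j
    show "d x i j * v i \<le> d x i j * v j"
    proof (cases "j = i")
      case False
      then show ?thesis using d_off[of i j x] assms(1)[of j] by (simp add: mult_left_mono_neg)
    qed simp
  qed
  moreover have "(\<Sum>j\<in>UNIV. d x i j * v i) \<ge> 0"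
    using d_rowsum assms(2) by (simp add: sum_distrib_right[symmetric])
  ultimately show ?thesis by linarith
qed

definition rhs :: "('m \<Rightarrow> (real^'n) \<times> real \<Rightarrow> real) \<Rightarrow> 'm \<Rightarrow> (real^'n) \<times> real \<Rightarrow> real" where
  "rhs U i z = f i (fst z) - (\<Sum>j\<in>UNIV. d (fst z) i j * U j z)"

lemma rhs_cont:
  assumes "\<And>i. continuous_on S (U i)"
  shows "continuous_on S (rhs U i)"
proof -
  have 1: "continuous_on S (\<lambda>z. f i (fst z))" "continuous_on S (\<lambda>z. d (fst z) i j)" for j
    by (rule continuous_on_compose2[OF f_cont[of i] continuous_on_fst[OF continuous_on_id]] 
             continuous_on_compose2[OF d_cont[of i j] continuous_on_fst[OF continuous_on_id]], simp)+
  show ?thesis unfolding rhs_def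
    by (intro continuous_on_diff continuous_on_sum continuous_on_mult 1 assms)
qed

text \<open>The maximum of \<open>U i (x, t) - W i (x, s) - kap (t - s)^2 - q t - q s\<close> is
  taken over the index as well as over x, t and s. The growth of \<open>q\<close> excludes the
  terminal time, a large but fixed \<open>kap\<close> excludes the initial one, and at an interior
  maximum q' > 0 contradicts \<open>doubling_at_max\<close>.\<close>

lemma evol_comparison:
  assumes Uc: "\<And>i. continuous_on (UNIV \<times> {0..}) (U i)" and Wc: "\<And>i. continuous_on (UNIV \<times> {0..}) (W i)"
    and Uper: "\<And>i t. periodic1 (\<lambda>x. U i (x, t))" and Wper: "\<And>i t. periodic1 (\<lambda>x. W i (x, t))"
    and sub: "\<And>i. evsub (F i) (rhs U i) (U i)" and sup: "\<And>i. evsup (F i) (rhs W i) (W i)"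
    and init: "\<And>i x. U i (x, 0) \<le> W i (x, 0)" and "t \<ge> 0"
  shows "U i (x, t) \<le> W i (x, t)"
proof (rule ccontr)
  define t1 where "t1 = t"
  define x1 where "x1 = x"
  define i1 where "i1 = i"
  \<comment> \<open>A third of the excess. As q t1 = \<delta>/2, the diagonal point (x1, t1, t1) has
    value 2 \<delta>, and only \<delta> can be spent on time increments near t = 0.\<close>
  define \<delta> where "\<delta> = (U i1 (x1, t1) - W i1 (x1, t1)) / 3"
  assume "\<not> ?thesis"
  then have \<delta>: "\<delta> > 0" by (simp add: \<delta>_def t1_def x1_def i1_def)
  have t1: "t1 \<ge> 0" using \<open>t \<ge> 0\<close> by (simp add: t1_def)
  define T where "T = t1 + 1"
  define Q where "Q = cbox (0::real^'n) 1 \<times> {0..T}"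
  have Q: "compact Q" "Q \<subseteq> UNIV \<times> {0..}" unfolding Q_def by (auto intro: compact_Times)
  have UQ: "continuous_on Q (U i)" "continuous_on Q (W i)" for i
    using continuous_on_subset[OF Uc Q(2)] continuous_on_subset[OF Wc Q(2)] by auto
  have "\<exists>B. \<forall>z\<in>Q. \<bar>U i z\<bar> \<le> B" "\<exists>B. \<forall>z\<in>Q. \<bar>W i z\<bar> \<le> B" for i
    using compact_imp_bounded[OF compact_continuous_image[OF UQ(1) Q(1)]]
      compact_imp_bounded[OF compact_continuous_image[OF UQ(2) Q(1)]] unfolding bounded_iff by auto
  then obtain B1 B2 where B12: "\<And>i z. z \<in> Q \<Longrightarrow> \<bar>U i z\<bar> \<le> B1 i" "\<And>i z. z \<in> Q \<Longrightarrow> \<bar>W i z\<bar> \<le> B2 i" by metis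
  obtain C1 where C1: "C1 > 0" "\<And>i. B1 i \<le> C1" using uniform_bound by blast
  obtain C2 where C2: "C2 > 0" "\<And>i. B2 i \<le> C2" using uniform_bound by blast
  define B where "B = max C1 C2"
  have B0: "B > 0" using C1 by (simp add: B_def)
  have B: "\<bar>U i z\<bar> \<le> B" "\<bar>W i z\<bar> \<le> B" if "z \<in> Q" for i z
    using B12(1)[OF that, of i] B12(2)[OF that, of i] C1(2)[of i] C2(2)[of i] unfolding B_def by linarith+
  obtain r1 where r1: "r1 > 0" "\<And>i z z'. z \<in> Q \<Longrightarrow> z' \<in> Q \<Longrightarrow> dist z' z < r1 \<Longrightarrow> \<bar>U i z' - U i z\<bar> < \<delta>"
    using uniform_modulus[where U = U, OF UQ(1) Q(1) \<delta>] by auto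
  obtain r2 where r2: "r2 > 0" "\<And>i z z'. z \<in> Q \<Longrightarrow> z' \<in> Q \<Longrightarrow> dist z' z < r2 \<Longrightarrow> \<bar>W i z' - W i z\<bar> < \<delta>"
    using uniform_modulus[where U = W, OF UQ(2) Q(1) \<delta>] by auto
  define r where "r = min r1 r2"
  have r: "r > 0" using r1 r2 by (simp add: r_def)
  \<comment> \<open>Time increments shorter than \<open>r\<close> are below \<delta> by uniform
    continuity; for longer ones the penalty exceeds the oscillation 2 B.\<close>
  define kap where "kap = 2 * B / r\<^sup>2"
  have kap: "kap \<ge> 0" "kap * s\<^sup>2 \<ge> 2 * B" if "s \<ge> r" for s
  proof -
    show "kap \<ge> 0" using B0 by (simp add: kap_def)
    have "s\<^sup>2 \<ge> r\<^sup>2" using that r by (intro power_mono) auto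
    then have "kap * s\<^sup>2 \<ge> kap * r\<^sup>2" using B0 by (intro mult_left_mono) (auto simp: kap_def)
    then show "kap * s\<^sup>2 \<ge> 2 * B" using r by (simp add: kap_def)
  qed
  have kap0: "kap \<ge> 0" using kap[of r] by simp
  \<comment> \<open>Makes q (t1 + 1) > 2 B already by exp c \<ge> 1 + c, so that no maximum sits at
    time \<open>T\<close>.\<close>
  define c where "c = 4 * B / \<delta> + 1"
  have c0: "c > 0" using B0 \<delta> unfolding c_def by (intro add_pos_pos divide_pos_pos) auto
  define q where "q = (\<lambda>t. \<delta>/2 * exp (c * (t - t1)))"
  define q' where "q' = (\<lambda>t. \<delta>/2 * (exp (c * (t - t1)) * c))"
  have qd: "(q has_real_derivative q' t) (at t)" for t
    unfolding q_def q'_def by (auto intro!: derivative_eq_intros)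
  have qc: "continuous_on UNIV q'" unfolding q'_def by (intro continuous_intros)
  have qpos: "q t > 0" "q' t > 0" for t using \<delta> c0 by (auto simp: q_def q'_def)
  have qT: "q T > 2 * B"
  proof -
    have "\<delta>/2 * (1 + c) \<le> q T" using \<delta> exp_ge_add_one_self[of c] unfolding q_def T_def by (intro mult_left_mono) auto
    moreover have "\<delta>/2 * (1 + c) = 2 * B + \<delta>" using \<delta> by (simp add: c_def field_simps)
    ultimately show ?thesis using \<delta> by linarith
  qed
  define Phi where "Phi = (\<lambda>i (x, t, s). U i (x, t) - W i (x, s) - kap * (t - s)\<^sup>2 - q t - q s)"
  define K where "K = cbox (0::real^'n) 1 \<times> {0..T} \<times> {0..T}"
  have qcont: "continuous_on UNIV q" using qd by (meson DERIV_continuous continuous_at_imp_continuous_on)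
  have Phic: "continuous_on K (Phi i)" for i
    unfolding Phi_def case_prod_unfold
    by (intro continuous_on_diff continuous_on_compose2[OF UQ(1)[of i]] continuous_on_compose2[OF UQ(2)[of i]]
        continuous_on_compose2[OF qcont] continuous_intros) (auto simp: K_def Q_def)
  have "(0, 0, 0) \<in> K" using t1 by (simp add: K_def T_def mem_box_cart)
  moreover have "compact K" unfolding K_def by (intro compact_Times) auto
  ultimately have "\<exists>z\<in>K. \<forall>y\<in>K. Phi i y \<le> Phi i z" for i
    by (intro continuous_attains_sup[OF _ _ Phic]) auto
  then obtain Z where Z: "\<And>i. Z i \<in> K" "\<And>i y. y \<in> K \<Longrightarrow> Phi i y \<le> Phi i (Z i)" by metis
  obtain i0 where i0: "\<And>j. Phi j (Z j) \<le> Phi i0 (Z i0)" using finite_argmax[of "\<lambda>i. Phi i (Z i)"] by blast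
  obtain x0 t0 s0 where z0: "Z i0 = (x0, t0, s0)" by (metis prod.collapse)
  have in0: "x0 \<in> cbox 0 1" "0 \<le> t0" "t0 \<le> T" "0 \<le> s0" "s0 \<le> T" using Z(1)[of i0] unfolding z0 K_def by auto
  have mx: "Phi j (x, t, s) \<le> Phi i0 (x0, t0, s0)" if "0 \<le> t" "t \<le> T" "0 \<le> s" "s \<le> T" for j x t s
  proof -
    obtain k where k: "\<And>i. k $ i \<in> \<int>" "x + k \<in> cbox 0 1" using int_translate_into_cube[of x] by metis
    have "Phi j (x, t, s) = Phi j (x + k, t, s)"
      using periodic1_int_vector[OF Uper[of j t] k(1), of x] periodic1_int_vector[OF Wper[of j s] k(1), of x]
      by (simp add: Phi_def)
    also have "\<dots> \<le> Phi j (Z j)" using that k(2) by (intro Z(2)) (auto simp: K_def)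
    also have "\<dots> \<le> Phi i0 (x0, t0, s0)" using i0[of j] by (simp add: z0)
    finally show ?thesis .
  qed
  have val: "Phi i0 (x0, t0, s0) \<ge> 2 * \<delta>"
  proof -
    have "Phi i1 (x1, t1, t1) = 2 * \<delta>" by (simp add: Phi_def q_def \<delta>_def field_simps)
    then show ?thesis using mx[of t1 t1 i1 x1] t1 by (simp add: T_def)
  qed
  have inQ: "(x0, t0) \<in> Q" "(x0, s0) \<in> Q" "(x0, 0) \<in> Q" using in0 by (auto simp: Q_def)
  have ge: "U i0 (x0, t0) - W i0 (x0, s0) - kap * (t0 - s0)\<^sup>2 \<ge> 2 * \<delta> + q t0 + q s0"
    using val unfolding Phi_def by simp
  have k0: "kap * (t0 - s0)\<^sup>2 \<ge> 0" using kap0 by simp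
  have "t0 \<noteq> T"
    using ge B(1)[OF inQ(1), of i0] B(2)[OF inQ(2), of i0] qT \<delta> k0 qpos(1)[of s0] by (auto simp del: zero_le_power2)
  moreover have "s0 \<noteq> T"
    using ge B(1)[OF inQ(1), of i0] B(2)[OF inQ(2), of i0] qT \<delta> k0 qpos(1)[of t0] by (auto simp del: zero_le_power2)
  \<comment> \<open>At t0 = 0 the ordering of the initial data leaves only a penalised time
    increment of W, which is at most \<delta>; the case s0 = 0 does the same with U.\<close>
  moreover have "t0 \<noteq> 0"
  proof
    assume t: "t0 = 0"
    have "W i0 (x0, 0) - W i0 (x0, s0) - kap * s0\<^sup>2 \<le> \<delta>"
    proof (cases "s0 < r")
      case True
      then have "\<bar>W i0 (x0, s0) - W i0 (x0, 0)\<bar> < \<delta>" using in0 by (intro r2(2) inQ) (auto simp: r_def dist_real_def)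
      moreover have "kap * s0\<^sup>2 \<ge> 0" using kap0 by simp
      ultimately show ?thesis by linarith
    next
      case False
      then show ?thesis using kap(2)[of s0] B(2)[OF inQ(2), of i0] B(2)[OF inQ(3), of i0] \<delta> by linarith
    qed
    then show False using ge init[of i0 x0] qpos(1)[of t0] qpos(1)[of s0] \<delta> unfolding t by simp
  qed
  moreover have "s0 \<noteq> 0"
  proof
    assume s: "s0 = 0"
    have "U i0 (x0, t0) - U i0 (x0, 0) - kap * t0\<^sup>2 \<le> \<delta>"
    proof (cases "t0 < r")
      case True
      then have "\<bar>U i0 (x0, t0) - U i0 (x0, 0)\<bar> < \<delta>" using in0 by (intro r1(2) inQ) (auto simp: r_def dist_real_def)
      moreover have "kap * t0\<^sup>2 \<ge> 0" using kap0 by simp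
      ultimately show ?thesis by linarith
    next
      case False
      then show ?thesis using kap(2)[of t0] B(1)[OF inQ(1), of i0] B(1)[OF inQ(3), of i0] \<delta> by linarith
    qed
    then show False using ge init[of i0 x0] qpos(1)[of t0] qpos(1)[of s0] \<delta> unfolding s by simp
  qed
  ultimately have int: "0 < t0" "t0 < T" "0 < s0" "s0 < T" using in0 by auto
  have lm: "loc_max (\<lambda>(x, t, s). U i0 (x, t) - W i0 (x, s) - kap * (t - s)\<^sup>2 - q t - q s) (x0, t0, s0)"
    unfolding loc_max_def
  proof (intro exI[of _ "min (min t0 s0) (min (T - t0) (T - s0))"] conjI allI impI)
    show "min (min t0 s0) (min (T - t0) (T - s0)) > 0" using int by simp
    fix z :: "(real^'n) \<times> real \<times> real" assume z: "dist z (x0, t0, s0) < min (min t0 s0) (min (T - t0) (T - s0))"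
    obtain x t s where zz: "z = (x, t, s)" by (metis prod.collapse)
    have "dist (t, s) (t0, s0) \<le> dist z (x0, t0, s0)" using dist_snd_le[of z "(x0, t0, s0)"] by (simp add: zz)
    then have "dist t t0 \<le> dist z (x0, t0, s0)" "dist s s0 \<le> dist z (x0, t0, s0)"
      using dist_fst_le[of "(t, s)" "(t0, s0)"] dist_snd_le[of "(t, s)" "(t0, s0)"] by auto
    then have "Phi i0 (x, t, s) \<le> Phi i0 (x0, t0, s0)" using z by (intro mx) (auto simp: dist_real_def)
    then show "(case z of (x, t, s) \<Rightarrow> U i0 (x, t) - W i0 (x, s) - kap * (t - s)\<^sup>2 - q t - q s)
        \<le> (case (x0, t0, s0) of (x, t, s) \<Rightarrow> U i0 (x, t) - W i0 (x, s) - kap * (t - s)\<^sup>2 - q t - q s)"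
      unfolding zz Phi_def by simp
  qed
  have sb: "UNIV \<times> {0<..} \<subseteq> (UNIV :: (real^'n) set) \<times> {0::real..}" by auto
  have cU: "continuous_on (UNIV \<times> {0<..}) (U i)" "continuous_on (UNIV \<times> {0<..}) (W i)" for i
    using continuous_on_subset[OF Uc sb] continuous_on_subset[OF Wc sb] by auto
  have "q' t0 + q' s0 \<le> rhs U i0 (x0, t0) - rhs W i0 (x0, s0)"
    by (rule doubling_at_max[OF F_cont F_coercive cU rhs_cont[OF cU(1)] rhs_cont[OF cU(2)] sub sup qd qc int(1,3) lm])
  also have "\<dots> = - (\<Sum>j\<in>UNIV. d x0 i0 j * (U j (x0, t0) - W j (x0, s0)))"
    unfolding rhs_def by (simp add: right_diff_distrib sum_subtractf)
  also have "\<dots> \<le> 0"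
  proof -
    have "U j (x0, t0) - W j (x0, s0) \<le> U i0 (x0, t0) - W i0 (x0, s0)" for j
      using mx[of t0 s0 j x0] int unfolding Phi_def by simp
    moreover have "U i0 (x0, t0) - W i0 (x0, s0) \<ge> 0" using ge k0 qpos(1)[of t0] qpos(1)[of s0] \<delta> by linarith
    ultimately show ?thesis using coupling_nonneg_at_max[of "\<lambda>j. U j (x0, t0) - W j (x0, s0)" i0 x0] by simp
  qed
  finally show False using qpos(2)[of t0] qpos(2)[of s0] by linarith
qed

end

section \<open>Comparison for the stationary system\<close>

definition stsub :: "('a::euclidean_space \<Rightarrow> 'a \<Rightarrow> real) \<Rightarrow> ('a \<Rightarrow> real) \<Rightarrow> ('a \<Rightarrow> real) \<Rightarrow> bool" where
  "stsub F g a \<longleftrightarrow> (\<forall>phi D x. C1_grad phi D \<longrightarrow> loc_max (\<lambda>z. a z - phi z) x \<longrightarrow> F x (D x) \<le> g x)"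

definition stsup :: "('a::euclidean_space \<Rightarrow> 'a \<Rightarrow> real) \<Rightarrow> ('a \<Rightarrow> real) \<Rightarrow> ('a \<Rightarrow> real) \<Rightarrow> bool" where
  "stsup F g a \<longleftrightarrow> (\<forall>phi D x. C1_grad phi D \<longrightarrow> loc_min (\<lambda>z. a z - phi z) x \<longrightarrow> F x (D x) \<ge> g x)"

lemma stsubD:
  assumes "stsub F g a" "C1_grad phi D" "loc_max (\<lambda>z. a z - phi z) x"
  shows "F x (D x) \<le> g x"
  using assms unfolding stsub_def by blast

lemma stsupD:
  assumes "stsup F g a" "C1_grad phi D" "loc_min (\<lambda>z. a z - phi z) x"
  shows "F x (D x) \<ge> g x"
  using assms unfolding stsup_def by blast

text \<open>The reflection u -> -u, under which minima become maxima and gradients change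
  sign.\<close>

lemma stsup_iff_stsub:
  "stsup F g a \<longleftrightarrow> stsub (\<lambda>x p. - F x (- p)) (\<lambda>x. - g x) (\<lambda>x. - a x)"
proof
  assume s: "stsup F g a"
  show "stsub (\<lambda>x p. - F x (- p)) (\<lambda>x. - g x) (\<lambda>x. - a x)"
    unfolding stsub_def
  proof (intro allI impI)
    fix phi D x assume C: "C1_grad phi D" and m: "loc_max (\<lambda>z. - a z - phi z) x"
    have "loc_min (\<lambda>z. a z - - phi z) x" using m by (simp add: loc_min_iff_loc_max)
    from stsupD[OF s C1_grad_uminus[OF C] this] show "- F x (- D x) \<le> - g x" by simp
  qed
next
  assume s: "stsub (\<lambda>x p. - F x (- p)) (\<lambda>x. - g x) (\<lambda>x. - a x)"
  show "stsup F g a"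
    unfolding stsup_def
  proof (intro allI impI)
    fix phi D x assume C: "C1_grad phi D" and m: "loc_min (\<lambda>z. a z - phi z) x"
    have "loc_max (\<lambda>z. - a z - - phi z) x" using m by (simp add: loc_min_iff_loc_max)
    from stsubD[OF s C1_grad_uminus[OF C] this] show "g x \<le> F x (D x)" by simp
  qed
qed

lemma evsup_iff_evsub:
  "evsup F g a \<longleftrightarrow> evsub (\<lambda>x p. - F x (- p)) (\<lambda>x. - g x) (\<lambda>x. - a x)"
proof
  assume s: "evsup F g a"
  show "evsub (\<lambda>x p. - F x (- p)) (\<lambda>x. - g x) (\<lambda>x. - a x)"
    unfolding evsub_def
  proof (intro allI impI)
    fix phi D and z :: "'a \<times> real" assume t: "snd z > 0" and C: "C1_grad phi D" and m: "loc_max (\<lambda>z. - a z - phi z) z"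
    obtain x t' where z: "z = (x, t')" by (metis prod.collapse)
    have "loc_min (\<lambda>z. a z - - phi z) (x, t')" using m by (simp add: loc_min_iff_loc_max z)
    from evsupD[OF s _ C1_grad_uminus[OF C] this] t show "snd (D z) + - F (fst z) (- fst (D z)) \<le> - g z" by (simp add: z)
  qed
next
  assume s: "evsub (\<lambda>x p. - F x (- p)) (\<lambda>x. - g x) (\<lambda>x. - a x)"
  show "evsup F g a"
    unfolding evsup_def
  proof (intro allI impI)
    fix phi D and z :: "'a \<times> real" assume t: "snd z > 0" and C: "C1_grad phi D" and m: "loc_min (\<lambda>z. a z - phi z) z"
    obtain x t' where z: "z = (x, t')" by (metis prod.collapse)
    have "loc_max (\<lambda>z. - a z - - phi z) (x, t')" using m by (simp add: loc_min_iff_loc_max z)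
    from evsubD[OF s _ C1_grad_uminus[OF C] this] t show "g z \<le> snd (D z) + F (fst z) (fst (D z))" by (simp add: z)
  qed
qed

text \<open>In the t-slice through a contact point the touched function is constant, so the test
  function has zero time derivative there. This makes \<open>doubling_at_max\<close> available for
  stationary functions.\<close>

lemma evsub_of_stsub:
  assumes s: "stsub F g a"
  shows "evsub F (\<lambda>z. g (fst z)) (\<lambda>z. a (fst z))"
  unfolding evsub_def
proof (intro allI impI)
  fix phi D and z :: "'a \<times> real" assume C: "C1_grad phi D" and m: "loc_max (\<lambda>z. a (fst z) - phi z) z"
  obtain x t where z: "z = (x, t)" by (metis prod.collapse)
  have m1: "loc_max (\<lambda>y. a y - phi (y, t)) x" and m2: "loc_max (\<lambda>s. a x - phi (x, s)) t"
    using loc_max_slice[OF m[unfolded z]] by simp_all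
  have "loc_max (\<lambda>s. 0 - phi (x, s)) t"
    by (rule loc_max_mono[OF m2, where c = "- a x"]) auto
  from C1_grad_unique_at_max[OF C1_grad_const C1_grad_slice_snd[OF C] this]
  have "snd (D (x, t)) = 0" by simp
  moreover have "F x (fst (D (x, t))) \<le> g x" by (rule stsubD[OF s C1_grad_slice_fst[OF C] m1])
  ultimately show "snd (D z) + F (fst z) (fst (D z)) \<le> g (fst z)" by (simp add: z)
qed

lemma evsup_of_stsup:
  assumes s: "stsup F g a"
  shows "evsup F (\<lambda>z. g (fst z)) (\<lambda>z. a (fst z))"
  using evsub_of_stsub[OF s[unfolded stsup_iff_stsub]] unfolding evsup_iff_evsub by simp

section \<open>Scaling and Lipschitz bound for stationary subsolutions\<close>

lemma C1_grad_div_cmult: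
  "C1_grad phi D \<Longrightarrow> C1_grad (\<lambda>z. phi z / c) (\<lambda>z. D z /\<^sub>R c)"
  using C1_grad_cmult[of phi D "inverse c"] by (simp add: divide_inverse mult.commute)

text \<open>Convexity and F(x, 0) = 0 give F(x, mu p) \<le> mu F(x, p). Since f is also multiplied
  by mu, comparison with an unscaled supersolution gains (1 - mu) f.\<close>

lemma stsub_scale:
  assumes s: "stsub F g a" and cvx: "\<And>x. convex_on UNIV (F x)" and F0: "\<And>x. F x 0 = 0"
    and mu: "0 < mu" "mu < 1"
  shows "stsub F (\<lambda>x. mu * g x) (\<lambda>x. mu * a x)"
  unfolding stsub_def
proof (intro allI impI)
  fix phi D x assume C: "C1_grad phi D" and m: "loc_max (\<lambda>z. mu * a z - phi z) x"
  obtain e where e: "e > 0" "\<And>z. dist z x < e \<Longrightarrow> mu * a z - phi z \<le> mu * a x - phi x"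
    using m unfolding loc_max_def by blast
  have "loc_max (\<lambda>z. a z - phi z / mu) x"
    unfolding loc_max_def
  proof (intro exI[of _ e] conjI allI impI)
    fix z assume "dist z x < e"
    from e(2)[OF this] have "(mu * a z - phi z) / mu \<le> (mu * a x - phi x) / mu"
      using mu by (intro divide_right_mono) auto
    then show "a z - phi z / mu \<le> a x - phi x / mu" using mu by (simp add: diff_divide_distrib)
  qed (use e in auto)
  from stsubD[OF s C1_grad_div_cmult[OF C] this] have 1: "F x (D x /\<^sub>R mu) \<le> g x" .
  have "F x ((1 - mu) *\<^sub>R 0 + mu *\<^sub>R (D x /\<^sub>R mu)) \<le> (1 - mu) * F x 0 + mu * F x (D x /\<^sub>R mu)"
    using mu by (intro convex_onD[OF cvx]) auto
  also have "\<dots> \<le> mu * g x" using 1 mu F0 by (simp add: mult_left_mono)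
  finally show "F x (D x) \<le> mu * g x" using mu by simp
qed

text \<open>The maximum of a(y) - R |y - x| must sit at y = x: at any other point the cone would act
  as a test function of slope R, which coercivity forbids.\<close>

lemma stsub_lipschitz:
  fixes a :: "'a::euclidean_space \<Rightarrow> real"
  assumes s: "stsub F g a" and ac: "continuous_on UNIV a" and ab: "\<And>x. \<bar>a x\<bar> \<le> M"
    and R: "R > 0" and big: "\<And>x p. norm p \<ge> R \<Longrightarrow> F x p > g x"
  shows "a y - a x \<le> R * dist y x"
proof -
  define psi where "psi = (\<lambda>y. a y - R * dist y x)"
  \<comment> \<open>Beyond this radius the cone exceeds the oscillation 2 M of \<open>a\<close>, so
    the maximum over K is global.\<close>
  define K where "K = cball x (2 * M / R)"
  have M: "M \<ge> 0" using ab[of x] by linarith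
  have psic: "continuous_on K psi" unfolding psi_def
    by (intro continuous_intros continuous_on_subset[OF ac]) auto
  have "x \<in> K" using M R by (simp add: K_def)
  moreover have "compact K" unfolding K_def by simp
  ultimately obtain y0 where y0: "y0 \<in> K" "\<And>y. y \<in> K \<Longrightarrow> psi y \<le> psi y0"
    using continuous_attains_sup[OF _ _ psic] by blast
  have y0': "psi y \<le> psi y0" for y
  proof (cases "y \<in> K")
    case False
    then have "dist y x > 2 * M / R" by (simp add: K_def dist_commute)
    then have "R * dist y x > 2 * M" using R by (simp add: divide_less_eq mult.commute)
    then have "psi y \<le> psi x" using ab[of x] ab[of y] unfolding psi_def by simp
    also have "\<dots> \<le> psi y0" using y0(2) \<open>x \<in> K\<close> .
    finally show ?thesis .
  qed (rule y0(2))
  have "y0 = x"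
  proof (rule ccontr)
    assume ne: "y0 \<noteq> x"
    define r where "r = norm (y0 - x)"
    have r: "r > 0" using ne by (simp add: r_def)
    \<comment> \<open>The cone is not differentiable at x, while test functions are C1 everywhere.
      This paraboloid plus R r / 2 lies above the cone and touches it, with slope R, on the sphere
      through \<open>y0\<close>.\<close>
    let ?phi = "\<lambda>y. R / (2 * r) * (norm (y - x))\<^sup>2"
    have C: "C1_grad ?phi (\<lambda>y. (R / (2 * r)) *\<^sub>R (2 *\<^sub>R (y - x)))"
      by (intro C1_grad_cmult C1_grad_sq_dist)
    have "a y - ?phi y \<le> a y0 - ?phi y0" for y
    proof -
      have "0 \<le> R / (2 * r) * (norm (y - x) - r)\<^sup>2" using R r by simp
      also have "\<dots> = ?phi y - R * norm (y - x) + R * r / 2"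
        using r by (simp add: power2_eq_square field_simps)
      finally have "a y - ?phi y \<le> psi y + R * r / 2" by (simp add: psi_def dist_norm)
      also have "\<dots> \<le> psi y0 + R * r / 2" using y0'[of y] by simp
      also have "\<dots> = a y0 - ?phi y0"
        using r by (simp add: psi_def dist_norm r_def[symmetric] power2_eq_square field_simps)
      finally show ?thesis .
    qed
    then have "loc_max (\<lambda>y. a y - ?phi y) y0" unfolding loc_max_def by (intro exI[of _ 1]) auto
    from stsubD[OF s C this] have "F y0 ((R / (2 * r)) *\<^sub>R (2 *\<^sub>R (y0 - x))) \<le> g y0" .
    moreover have "norm ((R / (2 * r)) *\<^sub>R (2 *\<^sub>R (y0 - x))) = R"
      using R r by (simp add: r_def[symmetric])
    ultimately show False using big[of "(R / (2 * r)) *\<^sub>R (2 *\<^sub>R (y0 - x))" y0] by simp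
  qed
  then show ?thesis using y0'[of y] by (simp add: psi_def)
qed

lemma tendsto_of_joint_continuity:
  fixes F :: "'a::euclidean_space \<Rightarrow> 'a \<Rightarrow> real"
  assumes "continuous_on UNIV (\<lambda>(x, p). F x p)" "xs \<longlonglongrightarrow> x" "ps \<longlonglongrightarrow> p"
  shows "(\<lambda>n. F (xs n) (ps n)) \<longlonglongrightarrow> F x p"
  using continuous_on_tendsto_compose[OF assms(1) tendsto_Pair[OF assms(2,3)]] by simp

context weakly_coupled
begin

definition strhs :: "('m \<Rightarrow> real^'n \<Rightarrow> real) \<Rightarrow> 'm \<Rightarrow> real^'n \<Rightarrow> real" where
  "strhs u i x = f i x - (\<Sum>j\<in>UNIV. d x i j * u j x)"

definition A :: "(real^'n) set" where
  "A = {x. (\<Sum>i\<in>UNIV. f i x) = 0 \<and> (\<forall>i. (\<Sum>j\<in>UNIV. d x i j) = 0)}"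

lemma strhs_cont:
  assumes "\<And>i. continuous_on UNIV (u i)"
  shows "continuous_on UNIV (strhs u i)"
  unfolding strhs_def by (intro continuous_intros f_cont d_cont assms)

lemma rhs_of_strhs: "rhs (\<lambda>j z. u j (fst z)) i z = strhs u i (fst z)"
  by (simp add: rhs_def strhs_def)

lemma in_A_iff: "x \<in> A \<longleftrightarrow> (\<forall>i. f i x = 0) \<and> (\<forall>i. (\<Sum>j\<in>UNIV. d x i j) = 0)"
  unfolding A_def using f_nonneg by (auto simp: sum_nonneg_eq_0_iff)

lemma closed_A: "closed A"
proof -
  have "A = (\<Inter>i. {x. f i x = 0}) \<inter> (\<Inter>i. {x. (\<Sum>j\<in>UNIV. d x i j) = 0})"
    using in_A_iff by auto
  moreover have "closed {x. f i x = 0}" "closed {x. (\<Sum>j\<in>UNIV. d x i j) = 0}" for i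
    by (intro closed_Collect_eq continuous_intros f_cont d_cont)+
  ultimately show ?thesis by (auto intro!: closed_Int closed_INT)
qed

lemma A_translate:
  assumes "\<And>i. k $ i \<in> \<int>" "x \<in> A"
  shows "x + k \<in> A"
  using assms(2) periodic1_int_vector[OF f_per assms(1)] periodic1_int_vector[OF d_per assms(1)]
  unfolding in_A_iff by simp

text \<open>At a maximum point of mu u - w every component attaining the maximum passes it on to its
  neighbours in the graph of the coupling. By irreducibility all components attain it, which is why
  an ordering of a single component suffices at each point of A.\<close>

lemma stat_comparison:
  assumes uc: "\<And>i. continuous_on UNIV (u i)" and wc: "\<And>i. continuous_on UNIV (w i)"
    and uper: "\<And>i. periodic1 (u i)" and wper: "\<And>i. periodic1 (w i)"
    and sub: "\<And>i. stsub (F i) (strhs u i) (u i)" and sup: "\<And>i. stsup (F i) (strhs w i) (w i)"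
    and bd: "\<And>x. x \<in> A \<Longrightarrow> \<exists>i. u i x \<le> w i x"
  shows "u i x \<le> w i x"
proof -
  obtain C where C: "C > 0" "\<And>i x. \<bar>u i x\<bar> \<le> C" using periodic1_family_bounded[where g = u, OF uc uper] by auto
  \<comment> \<open>On A the ordered component satisfies mu u - w = (u - w) - mu' u \<le> mu' C with
    mu' = 1 - mu. The same bound is shown everywhere, and mu -> 1 finishes the proof.\<close>
  have key: "mu * u i x - w i x \<le> (1 - mu) * C" if mu: "0 < mu" "mu < 1" for mu i x
  proof (rule ccontr)
    assume neg: "\<not> mu * u i x - w i x \<le> (1 - mu) * C"
    let ?K = "cbox (0::real^'n) 1"
    have "(0::real^'n) \<in> ?K" by (simp add: mem_box_cart)
    moreover have "continuous_on ?K (\<lambda>x. mu * u i x - w i x)" for i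
      by (intro continuous_intros continuous_on_subset[OF uc] continuous_on_subset[OF wc]) auto
    ultimately have "\<exists>z\<in>?K. \<forall>y\<in>?K. mu * u i y - w i y \<le> mu * u i z - w i z" for i
      by (intro continuous_attains_sup) auto
    then obtain Z where Z: "\<And>i y. y \<in> ?K \<Longrightarrow> mu * u i y - w i y \<le> mu * u i (Z i) - w i (Z i)" by metis
    obtain i0 where i0: "\<And>j. mu * u j (Z j) - w j (Z j) \<le> mu * u i0 (Z i0) - w i0 (Z i0)"
      using finite_argmax[of "\<lambda>j. mu * u j (Z j) - w j (Z j)"] by blast
    define x0 where "x0 = Z i0"
    define m where "m = mu * u i0 x0 - w i0 x0"
    have mx: "mu * u j y - w j y \<le> m" for j y
    proof -
      obtain k where k: "\<And>i. k $ i \<in> \<int>" "y + k \<in> ?K" using int_translate_into_cube[of y] by metis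
      have "mu * u j y - w j y = mu * u j (y + k) - w j (y + k)"
        using periodic1_int_vector[OF uper k(1)] periodic1_int_vector[OF wper k(1)] by simp
      also have "\<dots> \<le> m" using Z[OF k(2), of j] i0[of j] by (simp add: m_def x0_def)
      finally show ?thesis .
    qed
    \<comment> \<open>As C > 0, the maximum is positive, so its product with a nonnegative row sum
      has a sign.\<close>
    have m: "m > (1 - mu) * C" using neg mx[of i x] by linarith
    then have m0: "m > 0" using mu C by (smt (verit) mult_pos_pos)
    define v where "v = (\<lambda>j. mu * u j x0 - w j x0)"
    define I where "I = {j. v j = m}"
    have I0: "i0 \<in> I" by (simp add: I_def v_def m_def)
    \<comment> \<open>Doubling gives coupling \<le> -(1 - mu) f. Written with \<open>m\<close>, this
      is a sum of nonnegative terms that is at most 0, so f, the row sum and every d (m - v) vanish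
      separately.\<close>
    have inI: "f j x0 = 0 \<and> (\<Sum>k\<in>UNIV. d x0 j k) = 0 \<and> (\<forall>k. d x0 j k \<noteq> 0 \<longrightarrow> k \<in> I)" if j: "j \<in> I" for j
    proof -
      let ?U = "\<lambda>z::(real^'n) \<times> real. mu * u j (fst z)" and ?W = "\<lambda>z::(real^'n) \<times> real. w j (fst z)"
      have fc: "continuous_on S (\<lambda>z::(real^'n) \<times> real. g (fst z))" if "continuous_on UNIV g" for g :: "real^'n \<Rightarrow> real" and S
        by (rule continuous_on_compose2[OF that continuous_on_fst[OF continuous_on_id]]) simp
      have sU: "evsub (F j) (\<lambda>z. mu * strhs u j (fst z)) ?U"
        using evsub_of_stsub[OF stsub_scale[OF sub F_convex F_zero mu]] .
      have sW: "evsup (F j) (\<lambda>z. strhs w j (fst z)) ?W"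
        using evsup_of_stsup[OF sup] .
      have qd: "((\<lambda>t. (t - 1)\<^sup>2) has_real_derivative 2 * (t - 1)) (at t)" for t :: real
        by (auto intro!: derivative_eq_intros)
      \<comment> \<open>Time is a dummy variable here: kap = 0 and q t = (t - 1)^2, whose derivative
        vanishes at t = 1.\<close>
      have lm: "loc_max (\<lambda>(x, t, s). ?U (x, t) - ?W (x, s) - 0 * (t - s)\<^sup>2 - (t - 1)\<^sup>2 - (s - 1)\<^sup>2) (x0, 1, 1)"
        unfolding loc_max_def
      proof (intro exI[of _ 1] conjI allI impI)
        fix z :: "(real^'n) \<times> real \<times> real"
        obtain x t s where zz: "z = (x, t, s)" by (metis prod.collapse)
        have "mu * u j x - w j x \<le> mu * u j x0 - w j x0" using mx[of j x] j by (simp add: I_def v_def)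
        moreover have "(t - 1)\<^sup>2 \<ge> 0" "(s - 1)\<^sup>2 \<ge> 0" by simp_all
        ultimately have "mu * u j x - w j x - (t - 1)\<^sup>2 - (s - 1)\<^sup>2 \<le> mu * u j x0 - w j x0" by linarith
        then show "(case z of (x, t, s) \<Rightarrow> ?U (x, t) - ?W (x, s) - 0 * (t - s)\<^sup>2 - (t - 1)\<^sup>2 - (s - 1)\<^sup>2)
          \<le> (case (x0, 1, 1) of (x, t, s) \<Rightarrow> ?U (x, t) - ?W (x, s) - 0 * (t - s)\<^sup>2 - (t - 1)\<^sup>2 - (s - 1)\<^sup>2)"
          unfolding zz by simp
      qed simp
      have "2 * (1 - 1) + 2 * (1 - 1) \<le> mu * strhs u j (fst (x0, 1::real)) - strhs w j (fst (x0, 1::real))"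
        by (rule doubling_at_max[OF F_cont F_coercive _ _ _ _ sU sW qd _ _ _ lm])
           (auto intro!: fc uc wc strhs_cont continuous_on_mult continuous_on_const continuous_intros)
      then have "(\<Sum>k\<in>UNIV. d x0 j k * v k) \<le> - (1 - mu) * f j x0"
        by (simp add: strhs_def v_def algebra_simps sum_distrib_left sum_subtractf)
      moreover have "(\<Sum>k\<in>UNIV. d x0 j k * v k) = m * (\<Sum>k\<in>UNIV. d x0 j k) + (\<Sum>k\<in>UNIV. - d x0 j k * (m - v k))"
        by (simp add: sum_distrib_left sum.distrib[symmetric] algebra_simps)
      moreover have nn: "- d x0 j k * (m - v k) \<ge> 0" for k
      proof (cases "k = j")
        case True then show ?thesis using j by (simp add: I_def)
      next
        case False
        then have "- d x0 j k \<ge> 0" using d_off[of j k x0] by simp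
        moreover have "m - v k \<ge> 0" using mx[of k x0] by (simp add: v_def)
        ultimately show ?thesis by (rule mult_nonneg_nonneg)
      qed
      moreover have "(\<Sum>k\<in>UNIV. - d x0 j k * (m - v k)) \<ge> 0" by (intro sum_nonneg nn)
      moreover have "m * (\<Sum>k\<in>UNIV. d x0 j k) \<ge> 0" using m0 d_rowsum by simp
      moreover have "(1 - mu) * f j x0 \<ge> 0" using mu f_nonneg by simp
      ultimately have z: "(1 - mu) * f j x0 = 0" "m * (\<Sum>k\<in>UNIV. d x0 j k) = 0"
        "(\<Sum>k\<in>UNIV. - d x0 j k * (m - v k)) = 0" by linarith+
      have "- d x0 j k * (m - v k) = 0" for k
        using z(3) nn by (simp add: sum_nonneg_eq_0_iff)
      then show ?thesis using z(1,2) mu m0 by (auto simp: I_def)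
    qed
    have "I = UNIV"
    proof (rule ccontr)
      assume "I \<noteq> UNIV"
      then obtain j k where "j \<in> I" "k \<notin> I" "d x0 j k \<noteq> 0"
        using d_irred[of x0] I0 unfolding irreducible_mat_def by blast
      then show False using inI by blast
    qed
    then have "x0 \<in> A" using inI unfolding in_A_iff by blast
    then obtain j where "u j x0 \<le> w j x0" using bd by blast
    moreover have "v j = m" using \<open>I = UNIV\<close> by (auto simp: I_def)
    ultimately have "m \<le> (1 - mu) * - u j x0" by (simp add: v_def algebra_simps)
    also have "\<dots> \<le> (1 - mu) * C" using C(2)[of j x0] mu by (intro mult_left_mono) auto
    finally show False using m by linarith
  qed
  show ?thesis
  proof (rule ccontr)
    assume neg: "\<not> ?thesis"
    define e where "e = u i x - w i x"
    have e: "e > 0" using neg by (simp add: e_def)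
    \<comment> \<open>The value of 1 - mu. The two errors are at most \<open>del * C\<close> each,
      together at most e / 2; the bound 1/2 keeps mu positive.\<close>
    define del where "del = min (1/2) (e / (4 * C))"
    have del: "del > 0" "del \<le> 1/2" "del \<le> e / (4 * C)" using e C by (auto simp: del_def)
    have "(1 - del) * u i x - w i x \<le> del * C" using key[of "1 - del" i x] del by simp
    moreover have "del * u i x \<le> del * C" using C(2)[of i x] del by (intro mult_left_mono) auto
    ultimately have "e \<le> 2 * (del * C)" by (simp add: e_def algebra_simps)
    also have "del * C \<le> e / 4" using mult_right_mono[OF del(3), of C] C by (simp add: field_simps)
    finally show False using e by simp
  qed
qed

end

section \<open>Existence of a stationary solution by Perron's method\<close>

lemma lipschitz_imp_continuous:
  fixes a :: "'a::metric_space \<Rightarrow> real"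
  assumes "R > 0" and lip: "\<And>x y. a y - a x \<le> R * dist y x"
  shows "continuous_on UNIV a"
  unfolding continuous_on_iff
proof (intro ballI allI impI)
  fix x and e :: real assume e: "e > 0"
  have "dist (a y) (a x) < e" if "dist y x < e / R" for y
  proof -
    have "\<bar>a y - a x\<bar> \<le> R * dist y x" using lip[of y x] lip[of x y] by (simp add: dist_commute abs_le_iff)
    also have "\<dots> < e" using that assms(1) by (simp add: less_divide_eq mult.commute)
    finally show ?thesis by (simp add: dist_real_def)
  qed
  then show "\<exists>d>0. \<forall>x'\<in>UNIV. dist x' x < d \<longrightarrow> dist (a x') (a x) < e"
    using e assms(1) by (intro exI[of _ "e / R"]) auto
qed

text \<open>A test function touching L * infdist from below at a point off A decreases at rate at least L
  towards a closest point of A, so its gradient has norm at least L.\<close>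
lemma norm_gradient_infdist_ge:
  fixes A :: "'a::euclidean_space set"
  assumes A: "closed A" "A \<noteq> {}" and x: "x \<notin> A" and L: "L > 0"
    and C: "C1_grad phi D" and m: "loc_min (\<lambda>z. L * infdist z A - phi z) x"
  shows "norm (D x) \<ge> L"
proof -
  obtain a where a: "a \<in> A" "infdist x A = dist x a" using infdist_attains_inf[OF A] by metis
  define h where "h = a - x"
  have h: "norm h > 0" using a x by (auto simp: h_def)
  obtain e where e: "e > 0" "\<And>z. dist z x < e \<Longrightarrow> L * infdist x A - phi x \<le> L * infdist z A - phi z"
    using m unfolding loc_min_def by blast
  define chi where "chi = (\<lambda>s. phi (x + s *\<^sub>R h) + L * s * norm h)"
  have "(phi has_derivative (\<lambda>v. D x \<bullet> v)) (at (x + 0 *\<^sub>R h))" using C unfolding C1_grad_def by simp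
  then have "((\<lambda>s. phi (x + s *\<^sub>R h)) has_derivative (\<lambda>s. D x \<bullet> (s *\<^sub>R h))) (at 0)"
    by (rule has_derivative_compose[where f = "\<lambda>s. x + s *\<^sub>R h", rotated])
       (auto intro!: derivative_eq_intros)
  then have d1: "((\<lambda>s. phi (x + s *\<^sub>R h)) has_real_derivative D x \<bullet> h) (at 0)"
    unfolding has_field_derivative_def by (simp add: mult.commute[of _ "D x \<bullet> h"])
  have d: "(chi has_real_derivative (D x \<bullet> h + L * norm h)) (at 0)"
    unfolding chi_def by (auto intro!: derivative_eq_intros d1)
  have "D x \<bullet> h + L * norm h \<le> 0"
  proof (rule ccontr)
    assume "\<not> ?thesis"
    then obtain r where r: "r > 0" "\<And>s. 0 < s \<Longrightarrow> s < r \<Longrightarrow> chi 0 < chi (0 + s)"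
      using DERIV_pos_inc_right[OF d] by auto
    define s where "s = min (r/2) (min 1 (e / (2 * norm h)))"
    have s: "0 < s" "s < r" "s \<le> 1" "s \<le> e / (2 * norm h)" using r(1) e(1) h by (auto simp: s_def)
    have "s * norm h < e" using s(4) h e(1) by (simp add: field_simps)
    then have "dist (x + s *\<^sub>R h) x < e" using s by (simp add: dist_norm)
    from e(2)[OF this] have "phi (x + s *\<^sub>R h) - phi x \<le> L * infdist (x + s *\<^sub>R h) A - L * infdist x A" by simp
    also have "infdist (x + s *\<^sub>R h) A \<le> dist (x + s *\<^sub>R h) a" using a(1) by (rule infdist_le)
    also have "dist (x + s *\<^sub>R h) a = norm ((1 - s) *\<^sub>R h)"
      unfolding dist_norm h_def by (subst norm_minus_cancel[symmetric]) (simp add: algebra_simps)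
    also have "\<dots> = (1 - s) * norm h" using s by simp
    also have "infdist x A = norm h" using a(2) by (simp add: h_def dist_norm norm_minus_commute)
    finally have "phi (x + s *\<^sub>R h) - phi x \<le> - L * s * norm h" using L by (simp add: algebra_simps)
    moreover have "chi 0 < chi s" using r(2)[OF s(1,2)] by simp
    ultimately show False by (simp add: chi_def)
  qed
  then have "L * norm h \<le> - (D x \<bullet> h)" by simp
  also have "\<dots> \<le> norm (D x) * norm h" using Cauchy_Schwarz_ineq2[of "D x" h] by simp
  finally show ?thesis using h by simp
qed

lemma infdist_translate:
  fixes A :: "'a::euclidean_space set"
  assumes A: "closed A" "A \<noteq> {}" and "\<And>x. x \<in> A \<Longrightarrow> x + k \<in> A"
  shows "infdist (x + k) A \<le> infdist x A"
proof -
  obtain a where a: "a \<in> A" "infdist x A = dist x a" using infdist_attains_inf[OF A] by metis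
  have "infdist (x + k) A \<le> dist (x + k) (a + k)" using assms(3)[OF a(1)] by (rule infdist_le)
  also have "\<dots> = dist x a" by (simp add: dist_norm)
  finally show ?thesis using a(2) by simp
qed

section \<open>Bounds on the data, the barrier and Perron's construction for the system\<close>

context weakly_coupled
begin

lemma uniformly_coercive: "\<exists>R>0. \<forall>i x p. norm p \<ge> R \<longrightarrow> F i x p > M"
proof -
  have "\<forall>i. \<exists>R. \<forall>x p. norm p \<ge> R \<longrightarrow> F i x p \<ge> M + 1" using F_coercive by blast
  then obtain R where R: "\<And>i x p. norm p \<ge> R i \<Longrightarrow> F i x p \<ge> M + 1" by metis
  obtain C where C: "C > 0" "\<And>i. R i \<le> C" using uniform_bound by blast
  have "F i x p > M" if "norm p \<ge> C" for i x p
    using R[where i = i and p = p and x = x] C(2)[of i] that by force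
  then show ?thesis using C(1) by blast
qed

lemma f_bounded: "\<exists>B>0. \<forall>i x. \<bar>f i x\<bar> \<le> B"
  using periodic1_family_bounded[where g = f, OF f_cont f_per] .

lemma d_bounded: "\<exists>B>0. \<forall>i j x. \<bar>d x i j\<bar> \<le> B"
proof -
  have "\<exists>B>0. \<forall>p x. \<bar>(case p of (i, j) \<Rightarrow> \<lambda>x. d x i j) x\<bar> \<le> B"
    by (rule periodic1_family_bounded) (auto split: prod.splits simp: d_cont d_per)
  then show ?thesis by auto
qed

lemma coupling_bounded: "\<exists>K>0. \<forall>v i x B. (\<forall>j. \<bar>v j\<bar> \<le> B) \<longrightarrow> \<bar>\<Sum>j\<in>UNIV. d x i j * v j\<bar> \<le> K * B"
proof -
  obtain B where B: "B > 0" "\<And>i j x. \<bar>d x i j\<bar> \<le> B" using d_bounded by blast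
  have "\<bar>\<Sum>j\<in>UNIV. d x i j * v j\<bar> \<le> (real CARD('m) * B) * C" if "\<forall>j. \<bar>v j\<bar> \<le> C" for v i x C
  proof -
    have "\<bar>\<Sum>j\<in>UNIV. d x i j * v j\<bar> \<le> (\<Sum>j\<in>UNIV. \<bar>d x i j * v j\<bar>)" by (rule sum_abs)
    also have "\<dots> \<le> (\<Sum>j\<in>(UNIV::'m set). B * C)"
      unfolding abs_mult using B that by (intro sum_mono mult_mono) (auto intro: less_imp_le)
    finally show ?thesis by simp
  qed
  moreover have "real CARD('m) * B > 0" using B by simp
  ultimately show ?thesis by blast
qed

text \<open>Quasi-monotonicity: raising the other components relaxes the i-th subsolution
  inequality. Perron's method for the system rests on this.\<close>

lemma strhs_mono:
  assumes "\<And>j. j \<noteq> i \<Longrightarrow> u j x \<le> w j x" "u i x = w i x"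
  shows "strhs u i x \<le> strhs w i x"
proof -
  have "(\<Sum>j\<in>UNIV. d x i j * w j x) \<le> (\<Sum>j\<in>UNIV. d x i j * u j x)"
  proof (rule sum_mono)
    fix j
    show "d x i j * w j x \<le> d x i j * u j x"
      using assms d_off[of i j x] by (cases "j = i") (auto intro: mult_left_mono_neg)
  qed
  then show ?thesis by (simp add: strhs_def)
qed

lemma stsub_translate:
  assumes k: "\<And>i. k $ i \<in> \<int>" and s: "stsub (F i) (strhs w i) (w i)"
  shows "stsub (F i) (strhs (\<lambda>j x. w j (x + k)) i) (\<lambda>x. w i (x + k))"
  unfolding stsub_def
proof (intro allI impI)
  fix phi D x assume C: "C1_grad phi D" and m: "loc_max (\<lambda>z. w i (z + k) - phi z) x"
  obtain e where e: "e > 0" "\<And>z. dist z x < e \<Longrightarrow> w i (z + k) - phi z \<le> w i (x + k) - phi x"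
    using m unfolding loc_max_def by blast
  have "loc_max (\<lambda>z. w i z - phi (z + - k)) (x + k)"
    unfolding loc_max_def
  proof (intro exI[of _ e] conjI allI impI)
    fix z assume "dist z (x + k) < e"
    then have "dist (z - k) x < e" by (simp add: dist_norm algebra_simps)
    from e(2)[OF this] show "w i z - phi (z + - k) \<le> w i (x + k) - phi (x + k + - k)" by simp
  qed (use e in auto)
  from stsubD[OF s C1_grad_translate[OF C] this] have "F i (x + k) (D x) \<le> strhs w i (x + k)" by simp
  then show "F i x (D x) \<le> strhs (\<lambda>j x. w j (x + k)) i x"
    using periodic1_int_vector[OF F_per k] periodic1_int_vector[OF f_per k] periodic1_int_vector[OF d_per k]
    by (simp add: strhs_def)
qed

text \<open>The upper barrier for Perron's method. On A the function, f and the row sums vanish and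
  F \<ge> 0; off A the slope L makes F dominate f. With equal components the coupling is a row sum
  times a nonnegative number.\<close>

lemma infdist_A_supersolution:
  assumes "A \<noteq> {}" "L > 0" "\<And>i x p. norm p \<ge> L \<Longrightarrow> F i x p \<ge> f i x"
  shows "stsup (F i) (strhs (\<lambda>j x. L * infdist x A) i) (\<lambda>x. L * infdist x A)"
  unfolding stsup_def
proof (intro allI impI)
  fix phi D x assume C: "C1_grad phi D" and m: "loc_min (\<lambda>z. L * infdist z A - phi z) x"
  have eq: "strhs (\<lambda>j x. L * infdist x A) i x = f i x - (\<Sum>j\<in>UNIV. d x i j) * (L * infdist x A)"
    unfolding strhs_def by (simp only: sum_distrib_right)
  show "F i x (D x) \<ge> strhs (\<lambda>j x. L * infdist x A) i x"
  proof (cases "x \<in> A")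
    case True
    then show ?thesis using F_min[of i x "D x"] unfolding eq by (simp add: in_A_iff F_zero)
  next
    case False
    have "norm (D x) \<ge> L" by (rule norm_gradient_infdist_ge[OF closed_A assms(1) False assms(2) C m])
    then have "F i x (D x) \<ge> f i x" by (rule assms(3))
    moreover have "(\<Sum>j\<in>UNIV. d x i j) * (L * infdist x A) \<ge> 0"
      using d_rowsum assms(2) by (intro mult_nonneg_nonneg infdist_nonneg) auto
    ultimately show ?thesis unfolding eq by linarith
  qed
qed

lemma sup_of_subsolutions:
  assumes S: "\<And>w i. w \<in> S \<Longrightarrow> stsub (F i) (strhs w i) (w i)" "\<And>w i. w \<in> S \<Longrightarrow> continuous_on UNIV (w i)"
    and ub: "\<And>w i x. w \<in> S \<Longrightarrow> w i x \<le> v i x"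
    and approx: "\<And>i x e. e > 0 \<Longrightarrow> \<exists>w\<in>S. w i x > v i x - e"
    and vc: "\<And>i. continuous_on UNIV (v i)"
  shows "stsub (F i) (strhs v i) (v i)"
  unfolding stsub_def
proof (intro allI impI)
  fix phi D x assume C: "C1_grad phi D" and m: "loc_max (\<lambda>z. v i z - phi z) x"
  have "\<forall>n. \<exists>w\<in>S. w i x > v i x - inverse (real (Suc n))" using approx by simp
  then obtain w where w: "\<And>n. w n \<in> S" "\<And>n. w n i x > v i x - inverse (real (Suc n))" by metis
  have lim: "(\<lambda>n. w n i x) \<longlonglongrightarrow> v i x"
  proof (rule tendsto_sandwich)
    show "(\<lambda>n. v i x - inverse (real (Suc n))) \<longlonglongrightarrow> v i x"
      using tendsto_diff[OF tendsto_const LIMSEQ_inverse_real_of_nat, of "v i x"] by simp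
    show "\<forall>\<^sub>F n in sequentially. v i x - inverse (real (Suc n)) \<le> w n i x" using w(2) by (simp add: less_imp_le)
    show "\<forall>\<^sub>F n in sequentially. w n i x \<le> v i x" using ub w(1) by simp
  qed simp
  have up: "\<exists>rho>0. \<forall>\<^sub>F n in sequentially. \<forall>y\<in>ball z rho \<inter> cball x 1. w n i y \<le> v i z + e"
    if e: "e > 0" for z e
  proof -
    obtain rho where rho: "rho > 0" "\<And>y. dist y z < rho \<Longrightarrow> dist (v i y) (v i z) < e"
      using vc[of i] e unfolding continuous_on_iff by (metis UNIV_I)
    have "w n i y \<le> v i z + e" if "y \<in> ball z rho" for n y
      using rho(2)[of y] that ub[OF w(1), of n i y] by (simp add: dist_commute dist_real_def) 
    then show ?thesis using rho(1) by (intro exI[of _ rho]) auto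
  qed
  obtain zs where zs: "zs \<longlonglongrightarrow> x" "(\<lambda>n. w n i (zs n)) \<longlonglongrightarrow> v i x"
    "\<forall>\<^sub>F n in sequentially. loc_max (\<lambda>z. w n i z - (phi z + (norm (z - x))\<^sup>2)) (zs n)"
    using stability_of_maxima[of 1 x "\<lambda>n. w n i" "v i" phi, OF _ continuous_on_subset[OF S(2)[OF w(1)]] up lim m C1_grad_continuous[OF C]]
    by auto
  \<comment> \<open>Only component i of \<open>w n\<close> is known to converge along
    \<open>zs n\<close>. The others are replaced by \<open>v\<close>, which
    \<open>strhs_mono\<close> permits.\<close>
  define g where "g = (\<lambda>n. f i (zs n) - ((\<Sum>j\<in>UNIV - {i}. d (zs n) i j * v j (zs n)) + d (zs n) i i * w n i (zs n)))"
  have ev: "\<forall>\<^sub>F n in sequentially. F i (zs n) (D (zs n) + 2 *\<^sub>R (zs n - x)) \<le> g n"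
    using zs(3)
  proof eventually_elim
    case (elim n)
    from stsubD[OF S(1)[OF w(1)] C1_grad_add[OF C C1_grad_sq_dist] elim]
    have "F i (zs n) (D (zs n) + 2 *\<^sub>R (zs n - x)) \<le> strhs (w n) i (zs n)" .
    also have "\<dots> \<le> strhs (\<lambda>j. if j = i then w n i else v j) i (zs n)"
      using ub[OF w(1)] by (intro strhs_mono) auto
    also have "\<dots> = g n"
      unfolding strhs_def g_def by (subst sum.remove[of UNIV i]) (auto intro!: sum.cong)
    finally show ?case .
  qed
  have seq: "(\<lambda>n. a (zs n)) \<longlonglongrightarrow> a x" if "continuous_on UNIV a" for a :: "real^'n \<Rightarrow> real"
    using continuous_on_tendsto_compose[OF that zs(1)] by simp
  have "g \<longlonglongrightarrow> f i x - ((\<Sum>j\<in>UNIV - {i}. d x i j * v j x) + d x i i * v i x)"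
    unfolding g_def by (intro tendsto_intros seq f_cont d_cont vc zs(2))
  moreover have "f i x - ((\<Sum>j\<in>UNIV - {i}. d x i j * v j x) + d x i i * v i x) = strhs v i x"
    unfolding strhs_def using sum.remove[of UNIV i "\<lambda>j. d x i j * v j x"] by simp
  ultimately have gl: "g \<longlonglongrightarrow> strhs v i x" by simp
  have "continuous_on UNIV D" using C by (simp add: C1_grad_def)
  then have "(\<lambda>n. D (zs n)) \<longlonglongrightarrow> D x" using continuous_on_tendsto_compose[OF _ zs(1), of UNIV D] by simp
  moreover have "(\<lambda>n. 2 *\<^sub>R (zs n - x)) \<longlonglongrightarrow> 2 *\<^sub>R (x - x)" by (intro tendsto_intros zs(1))
  ultimately have "(\<lambda>n. D (zs n) + 2 *\<^sub>R (zs n - x)) \<longlonglongrightarrow> D x + 2 *\<^sub>R (x - x)" by (rule tendsto_add)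
  then have "(\<lambda>n. F i (zs n) (D (zs n) + 2 *\<^sub>R (zs n - x))) \<longlonglongrightarrow> F i x (D x)"
    using tendsto_of_joint_continuity[OF F_cont zs(1)] by simp
  from tendsto_le[OF _ gl this ev] show "F i x (D x) \<le> strhs v i x" by simp
qed

text \<open>Perron's bump: subtracting |z - x0|^2 from the offending test function makes the contact strict,
  so the maximum of v i and the test function raised by del differs from v i only near x0.\<close>
lemma raise_subsolution:
  assumes vc: "\<And>i. continuous_on UNIV (v i)" and sub: "\<And>i. stsub (F i) (strhs v i) (v i)"
    and Psup: "\<And>i. stsup (F i) (strhs (\<lambda>j. P) i) P" and Pc: "continuous_on UNIV P"
    and vP: "\<And>i x. v i x \<le> P x"
    and fail: "\<not> stsup (F i) (strhs v i) (v i)"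
  shows "\<exists>w x0. (\<forall>j. continuous_on UNIV (w j)) \<and> (\<forall>j. stsub (F j) (strhs w j) (w j)) \<and>
     (\<forall>j x. v j x \<le> w j x \<and> w j x \<le> P x) \<and> v i x0 < w i x0"
proof -
  obtain phi D x0 where C: "C1_grad phi D" and m: "loc_min (\<lambda>z. v i z - phi z) x0"
    and lt: "F i x0 (D x0) < strhs v i x0" using fail unfolding stsup_def by force
  obtain e where e: "e > 0" "\<And>z. dist z x0 < e \<Longrightarrow> v i x0 - phi x0 \<le> v i z - phi z"
    using m unfolding loc_min_def by blast
  \<comment> \<open>Room for the bump: if \<open>v i\<close> met \<open>P\<close> at
    \<open>x0\<close>, then \<open>phi\<close> would touch \<open>P\<close> from below there and
    violate its supersolution inequality.\<close>
  have vltP: "v i x0 < P x0"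
  proof (rule ccontr)
    assume "\<not> ?thesis"
    then have eq: "v i x0 = P x0" using vP[of i x0] by simp
    have "loc_min (\<lambda>z. P z - phi z) x0"
      unfolding loc_min_def
    proof (intro exI[of _ e] conjI allI impI)
      fix z assume "dist z x0 < e"
      from e(2)[OF this] vP[of i z] eq show "P x0 - phi x0 \<le> P z - phi z" by linarith
    qed (use e in auto)
    from stsupD[OF Psup C this] have "strhs (\<lambda>j. P) i x0 \<le> F i x0 (D x0)" .
    moreover have "strhs v i x0 \<le> strhs (\<lambda>j. P) i x0" using vP eq by (intro strhs_mono) auto
    ultimately show False using lt by simp
  qed
  define phi1 where "phi1 = (\<lambda>z. phi z + - (norm (z - x0))\<^sup>2 + (v i x0 - phi x0))"
  define D1 where "D1 = (\<lambda>z. D z + - (2 *\<^sub>R (z - x0)) + 0)"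
  have C1: "C1_grad phi1 D1" unfolding phi1_def D1_def
    by (intro C1_grad_add C C1_grad_uminus C1_grad_sq_dist C1_grad_const)
  have phi1c: "continuous_on UNIV phi1" by (rule C1_grad_continuous[OF C1])
  have D1c: "continuous_on UNIV D1" using C1 by (simp add: C1_grad_def)
  have phi1_le: "phi1 z + (norm (z - x0))\<^sup>2 \<le> v i z" if "dist z x0 < e" for z
    using e(2)[OF that] by (simp add: phi1_def)
  \<comment> \<open>The i-th equation's defect after replacing \<open>v i\<close> by
    \<open>phi1\<close>; the last term is the change in the diagonal coupling.\<close>
  define h where "h = (\<lambda>z. F i z (D1 z) - strhs v i z + d z i i * (phi1 z - v i z))"
  have "continuous_on UNIV (\<lambda>z. F i z (D1 z))"
    using continuous_on_compose2[OF F_cont[of i] continuous_on_Pair[OF continuous_on_id D1c]] by simp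
  then have hc: "continuous_on UNIV h" unfolding h_def
    by (intro continuous_intros strhs_cont vc d_cont phi1c)
  have h0: "h x0 < 0" using lt by (simp add: h_def D1_def phi1_def)
  define eta where "eta = - h x0 / 2"
  have eta: "eta > 0" using h0 by (simp add: eta_def)
  define gap where "gap = (P x0 - v i x0) / 2"
  have gap: "gap > 0" using vltP by (simp add: gap_def)
  obtain r1 where r1: "r1 > 0" "\<And>z. dist z x0 < r1 \<Longrightarrow> dist (h z) (h x0) < eta"
    using hc eta unfolding continuous_on_iff by (metis UNIV_I)
  have "continuous_on UNIV (\<lambda>z. P z - phi1 z)" by (intro continuous_intros Pc phi1c)
  then obtain r2 where r2: "r2 > 0" "\<And>z. dist z x0 < r2 \<Longrightarrow> dist (P z - phi1 z) (P x0 - phi1 x0) < gap"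
    using gap unfolding continuous_on_iff by (metis UNIV_I)
  define r where "r = min e (min r1 r2)"
  have r: "r > 0" "r \<le> e" "r \<le> r1" "r \<le> r2" using e(1) r1(1) r2(1) by (auto simp: r_def)
  obtain dB where dB: "dB > 0" "\<And>i j x. \<bar>d x i j\<bar> \<le> dB" using d_bounded by blast
  \<comment> \<open>\<open>gap\<close> keeps the raised function below P, \<open>eta / dB\<close>
    limits the diagonal coupling it costs to \<open>eta\<close>, and r^2 / 8 makes the bump
    disappear beyond distance r / 2, where phi1 \<le> v i - r^2 / 4.\<close>
  define del where "del = min gap (min (eta / dB) (r\<^sup>2 / 8))"
  have del: "del > 0" "del \<le> gap" "del \<le> eta / dB" using gap eta dB r by (auto simp: del_def)
  have del4: "del \<le> r\<^sup>2 / 8" unfolding del_def min_le_iff_disj by blast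
  define wi where "wi = (\<lambda>z. if dist z x0 < r then max (v i z) (phi1 z + del) else v i z)"
  define w where "w = v(i := wi)"
  have wi_far: "wi z = v i z" if "dist z x0 > r / 2" for z
  proof (cases "dist z x0 < r")
    case True
    have "(norm (z - x0))\<^sup>2 \<ge> (r/2)\<^sup>2" using that r by (intro power_mono) (auto simp: dist_norm)
    then have "(norm (z - x0))\<^sup>2 \<ge> r\<^sup>2 / 4" by (simp add: power_divide)
    moreover have "phi1 z + (norm (z - x0))\<^sup>2 \<le> v i z" using True r by (intro phi1_le) auto
    moreover have "r\<^sup>2 > 0" using r by simp
    ultimately have "phi1 z + del \<le> v i z" using del4 by linarith
    then show ?thesis by (simp add: wi_def)
  qed (simp add: wi_def)
  have v_le: "v i z \<le> wi z" for z by (simp add: wi_def)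
  have le_P: "wi z \<le> P z" for z
  proof (cases "dist z x0 < r")
    case True
    then have "dist (P z - phi1 z) (P x0 - phi1 x0) < gap" using r by (intro r2(2)) auto
    moreover have "P x0 - phi1 x0 = 2 * gap" by (simp add: gap_def phi1_def)
    ultimately have "phi1 z + del \<le> P z" using del(2) unfolding dist_real_def by linarith
    then show ?thesis using vP by (simp add: wi_def)
  qed (simp add: wi_def vP)
  have wic: "continuous_on UNIV wi"
  proof -
    have "continuous_on (ball x0 r) (\<lambda>z. max (v i z) (phi1 z + del))"
      by (intro continuous_on_max continuous_intros continuous_on_subset[OF vc] continuous_on_subset[OF phi1c]) auto
    then have "continuous_on (ball x0 r) wi"
      by (rule continuous_on_eq) (simp add: wi_def dist_commute)
    moreover have "continuous_on (- cball x0 (r/2)) (v i)" by (rule continuous_on_subset[OF vc]) simp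
    then have "continuous_on (- cball x0 (r/2)) wi"
      by (rule continuous_on_eq) (simp add: wi_far dist_commute)
    ultimately have "continuous_on (ball x0 r \<union> - cball x0 (r/2)) wi"
      by (intro continuous_on_open_Un) auto
    moreover have "ball x0 r \<union> - cball x0 (r/2) = UNIV" using r by auto
    ultimately show ?thesis by simp
  qed
  have ws: "stsub (F j) (strhs w j) (w j)" for j
  proof (cases "j = i")
    case False
    show ?thesis unfolding stsub_def
    proof (intro allI impI)
      fix chi E x assume E: "C1_grad chi E" and lm: "loc_max (\<lambda>z. w j z - chi z) x"
      have "F j x (E x) \<le> strhs v j x" using stsubD[OF sub E] lm False by (simp add: w_def)
      also have "\<dots> \<le> strhs w j x" using v_le False by (intro strhs_mono) (auto simp: w_def)
      finally show "F j x (E x) \<le> strhs w j x" .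
    qed
  next
    case True
    show ?thesis unfolding True stsub_def
    proof (intro allI impI)
      fix chi E x assume E: "C1_grad chi E" and lm: "loc_max (\<lambda>z. w i z - chi z) x"
      then have lm: "loc_max (\<lambda>z. wi z - chi z) x" by (simp add: w_def)
      show "F i x (E x) \<le> strhs w i x"
      proof (cases "wi x = v i x")
        case True
        have "loc_max (\<lambda>z. v i z - chi z) x"
          by (rule loc_max_mono[OF lm, where c = 0]) (use True v_le in auto)
        from stsubD[OF sub E this] have "F i x (E x) \<le> strhs v i x" .
        also have "\<dots> \<le> strhs w i x" using True v_le by (intro strhs_mono) (auto simp: w_def)
        finally show ?thesis .
      next
        case False
        then have x: "dist x x0 < r" "wi x = phi1 x + del" by (auto simp: wi_def max_def split: if_splits)
        obtain e' where e': "e' > 0" "\<And>z. dist z x < e' \<Longrightarrow> wi z - chi z \<le> wi x - chi x"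
          using lm unfolding loc_max_def by blast
        have "loc_max (\<lambda>z. phi1 z - chi z) x"
          unfolding loc_max_def
        proof (intro exI[of _ "min e' (r - dist x x0)"] conjI allI impI)
          show "min e' (r - dist x x0) > 0" using e' x by simp
          fix z assume z: "dist z x < min e' (r - dist x x0)"
          have "dist z x0 \<le> dist z x + dist x x0" by (rule dist_triangle)
          then have "dist z x0 < r" using z by simp
          then have "phi1 z + del \<le> wi z" by (simp add: wi_def)
          then show "phi1 z - chi z \<le> phi1 x - chi x" using e'(2)[of z] z x(2) by simp
        qed
        from C1_grad_unique_at_max[OF C1 E this] have ED: "E x = D1 x" by simp
        have "dist (h x) (h x0) < eta" using x r by (intro r1(2)) auto
        then have hx: "h x < - eta" unfolding dist_real_def eta_def by linarith
        have "d x i i * del \<le> dB * (eta / dB)"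
          using dB(1) dB(2)[of x i i] del d_diag[where i = i and x = x] by (intro mult_mono) auto
        then have dd: "d x i i * del \<le> eta" using dB(1) by simp
        have "(\<Sum>j\<in>UNIV. d x i j * w j x) = d x i i * wi x + (\<Sum>j\<in>UNIV - {i}. d x i j * v j x)"
          by (subst sum.remove[of UNIV i]) (auto simp: w_def)
        moreover have "(\<Sum>j\<in>UNIV. d x i j * v j x) = d x i i * v i x + (\<Sum>j\<in>UNIV - {i}. d x i j * v j x)"
          by (subst sum.remove[of UNIV i]) auto
        ultimately have "strhs w i x = strhs v i x - d x i i * (phi1 x - v i x) - d x i i * del"
          unfolding strhs_def x(2) by (simp add: algebra_simps)
        then show ?thesis using hx dd unfolding ED h_def by linarith
      qed
    qed
  qed
  have "continuous_on UNIV (w j)" for j using wic vc by (simp add: w_def)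
  moreover have "v j x \<le> w j x \<and> w j x \<le> P x" for j x using v_le le_P vP by (simp add: w_def)
  moreover have "v i x0 < w i x0" using r del by (simp add: w_def wi_def phi1_def)
  ultimately show ?thesis using ws by blast
qed

lemma zero_subsolution: "stsub (F i) (strhs (\<lambda>j x. 0) i) (\<lambda>x. 0)"
  unfolding stsub_def
proof (intro allI impI)
  fix phi D and x :: "real^'n" assume C: "C1_grad phi D" and m: "loc_max (\<lambda>z. 0 - phi z) x"
  have "D x = 0" using C1_grad_unique_at_max[OF C1_grad_const C m] by simp
  then show "F i x (D x) \<le> strhs (\<lambda>j x. 0) i x" by (simp add: strhs_def F_zero f_nonneg)
qed

text \<open>Between 0 and P all subsolutions share one Lipschitz constant, because coercivity bounds
  their slopes. Hence their supremum is continuous and no semicontinuous envelopes are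
  needed.\<close>

lemma stationary_solution_exists:
  assumes "A \<noteq> {}"
  shows "\<exists>v. (\<forall>i. continuous_on UNIV (v i) \<and> periodic1 (v i) \<and> stsub (F i) (strhs v i) (v i) \<and> stsup (F i) (strhs v i) (v i))"
proof -
  obtain fB where fB: "fB > 0" "\<And>i x. \<bar>f i x\<bar> \<le> fB" using f_bounded by blast
  obtain L where L: "L > 0" "\<And>i x p. norm p \<ge> L \<Longrightarrow> F i x p > fB" using uniformly_coercive[of fB] by blast
  define P where "P = (\<lambda>x. L * infdist x A)"
  have Psup: "stsup (F i) (strhs (\<lambda>j. P) i) P" for i
    unfolding P_def
  proof (rule infdist_A_supersolution[OF assms L(1)])
    fix i and x p :: "real^'n" assume "norm p \<ge> L"
    then show "F i x p \<ge> f i x" using L(2)[of p i x] fB(2)[of i x] by linarith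
  qed
  have Pc: "continuous_on UNIV P" unfolding P_def by (intro continuous_intros)
  have Ptr: "P (x + k) = P x" if k: "\<And>i. k $ i \<in> \<int>" for x k
  proof -
    have "infdist (x + k) A \<le> infdist x A"
      by (rule infdist_translate[OF closed_A assms A_translate[OF k]])
    moreover have k': "(- k) $ i \<in> \<int>" for i using k by simp
    have "infdist (x + k + - k) A \<le> infdist (x + k) A"
      by (rule infdist_translate[OF closed_A assms A_translate[OF k']])
    ultimately show ?thesis by (simp add: P_def)
  qed
  have int_axis: "(axis i 1 :: real^'n) $ j \<in> \<int>" for i j by (simp add: axis_def)
  have "periodic1 P" unfolding periodic1_def using Ptr[OF int_axis] by blast
  then obtain M where M: "M > 0" "\<And>x. \<bar>P x\<bar> \<le> M" using periodic1_bounded[OF Pc] by blast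
  have P0: "P x \<ge> 0" for x using L by (simp add: P_def infdist_nonneg)
  \<comment> \<open>Periodicity is left out of the class, since the local bump of
    \<open>raise_subsolution\<close> would destroy it.\<close>
  define S where "S = {w. \<forall>i. continuous_on UNIV (w i) \<and> stsub (F i) (strhs w i) (w i) \<and> (\<forall>x. 0 \<le> w i x \<and> w i x \<le> P x)}"
  have S0: "(\<lambda>i x. 0) \<in> S" unfolding S_def using zero_subsolution P0 by simp
  have SD: "continuous_on UNIV (w i)" "stsub (F i) (strhs w i) (w i)" "0 \<le> w i x" "w i x \<le> P x"
    if "w \<in> S" for w i x using that by (auto simp: S_def)
  define v where "v = (\<lambda>i x. SUP w\<in>S. w i x)"
  have bdd: "bdd_above ((\<lambda>w. w i x) ` S)" for i x using SD(4) by (intro bdd_aboveI[of _ "P x"]) auto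
  have ub: "w i x \<le> v i x" if "w \<in> S" for w i x unfolding v_def by (rule cSUP_upper[OF that bdd])
  have least: "v i x \<le> c" if "\<And>w. w \<in> S \<Longrightarrow> w i x \<le> c" for i x c
    unfolding v_def using S0 that by (intro cSUP_least) auto
  have vP: "v i x \<le> P x" for i x using SD(4) by (intro least)
  have v0: "v i x \<ge> 0" for i x using ub[OF S0] by simp
  obtain K where K: "K > 0" "\<And>v i x B. (\<forall>j. \<bar>v j\<bar> \<le> B) \<Longrightarrow> \<bar>\<Sum>j\<in>UNIV. d x i j * v j\<bar> \<le> K * B"
    using coupling_bounded by blast
  obtain R where R: "R > 0" "\<And>i x p. norm p \<ge> R \<Longrightarrow> F i x p > fB + K * M" using uniformly_coercive[of "fB + K * M"] by blast
  have wlip: "w i y - w i x \<le> R * dist y x" if w: "w \<in> S" for w i x y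
  proof -
    have wM: "\<bar>w j z\<bar> \<le> M" for j z using SD(3,4)[OF w, of j z] M(2)[of z] by linarith
    have "strhs w j z \<le> fB + K * M" for j z
      using K(2)[of "\<lambda>j. w j z" M z j] wM fB(2)[of j z] unfolding strhs_def by simp
    then have "norm p \<ge> R \<Longrightarrow> F i x p > strhs w i x" for x p using R(2)[of p i x] by (meson le_less_trans)
    then show ?thesis by (rule stsub_lipschitz[OF SD(2,1)[OF w] wM R(1)])
  qed
  have vlip: "v i y - v i x \<le> R * dist y x" for i x y
  proof -
    have "v i y \<le> v i x + R * dist y x"
    proof (rule least)
      fix w assume w: "w \<in> S"
      show "w i y \<le> v i x + R * dist y x" using wlip[OF w, of i y x] ub[OF w, of i x] by linarith
    qed
    then show ?thesis by simp
  qed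
  have vc: "continuous_on UNIV (v i)" for i by (rule lipschitz_imp_continuous[OF R(1) vlip])
  have approx: "\<exists>w\<in>S. w i x > v i x - e" if "e > 0" for i x e
  proof (rule ccontr)
    assume "\<not> ?thesis"
    then have "v i x \<le> v i x - e" by (intro least) (auto simp: not_less)
    then show False using that by simp
  qed
  have vs: "stsub (F i) (strhs v i) (v i)" for i
  proof (rule sup_of_subsolutions[where S = S])
    show "\<exists>w\<in>S. v i x - e < w i x" if "e > 0" for i x e using approx[OF that] .
  qed (use SD(1,2) ub vc in auto)
  have vsup: "stsup (F i) (strhs v i) (v i)" for i
  proof (rule ccontr)
    assume "\<not> ?thesis"
    from raise_subsolution[OF vc vs Psup Pc vP this]
    obtain w x0 where w: "\<And>j. continuous_on UNIV (w j)" "\<And>j. stsub (F j) (strhs w j) (w j)"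
      "\<And>j x. v j x \<le> w j x \<and> w j x \<le> P x" "v i x0 < w i x0" by blast
    have "w \<in> S" unfolding S_def using w v0 order_trans by blast
    from ub[OF this, of i x0] w(4) show False by simp
  qed
  \<comment> \<open>Periodicity of \<open>v\<close> is recovered from the invariance of
    \<open>S\<close> under integer translations.\<close>
  have tr: "(\<lambda>i x. w i (x + k)) \<in> S" if w: "w \<in> S" and k: "\<And>i. k $ i \<in> \<int>" for w k
    unfolding S_def mem_Collect_eq
  proof (intro allI conjI)
    show "continuous_on UNIV (\<lambda>x. w i (x + k))" for i
      by (rule continuous_on_compose2[OF SD(1)[OF w, of i]]) (auto intro: continuous_intros)
    show "stsub (F i) (strhs (\<lambda>i x. w i (x + k)) i) (\<lambda>x. w i (x + k))" for i
      by (rule stsub_translate[OF k SD(2)[OF w]])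
    show "0 \<le> w i (x + k)" "w i (x + k) \<le> P x" for i x
      using SD(3,4)[OF w, of i "x + k"] Ptr[OF k, of x] by auto
  qed
  have vtr: "v i x \<le> v i (x + k)" if k: "\<And>i. k $ i \<in> \<int>" for i x k
  proof (rule least)
    fix w assume w: "w \<in> S"
    have "(- k) $ i \<in> \<int>" for i using k by simp
    from ub[OF tr[OF w this], of i "x + k"] show "w i x \<le> v i (x + k)" by simp
  qed
  have "periodic1 (v i)" for i
    unfolding periodic1_def
  proof (intro allI)
    fix x j
    have "(- axis j 1 :: real^'n) $ l \<in> \<int>" for l using int_axis[of j l] by simp
    from vtr[OF this, of i "x + axis j 1"] vtr[OF int_axis, of i x j]
    show "v i (x + axis j 1) = v i x" by simp
  qed
  then show ?thesis using vc vs vsup by blast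
qed

end

section \<open>Uniform estimates for the evolutive system\<close>

lemma loc_max_translate:
  "loc_max (\<lambda>z. G (z + c)) z0 \<longleftrightarrow> loc_max G (z0 + (c::'a::real_normed_vector))"
proof -
  have "dist z (z0 + c) = dist (z - c) z0" for z by (simp add: dist_norm algebra_simps)
  then show ?thesis unfolding loc_max_def
    by (metis (no_types, opaque_lifting) add_diff_cancel diff_add_cancel)
qed

lemma evsub_time_translate:
  assumes s: "evsub F g a" and h: "h \<ge> 0"
  shows "evsub F (\<lambda>z. g (z + (0, h))) (\<lambda>z. a (z + (0, h)))"
  unfolding evsub_def
proof (intro allI impI)
  fix phi D and z :: "'a \<times> real" assume t: "snd z > 0" and C: "C1_grad phi D"
    and m: "loc_max (\<lambda>z. a (z + (0, h)) - phi z) z"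
  obtain x t where z: "z = (x, t)" by (metis prod.collapse)
  have "loc_max (\<lambda>z. a z - phi (z + - (0, h))) (z + (0, h))"
    using m by (subst loc_max_translate[symmetric]) (simp add: add.assoc zero_prod_def[symmetric])
  then have m': "loc_max (\<lambda>z. a z - phi (z + - (0, h))) (x, t + h)" by (simp add: z)
  from evsubD[OF s _ C1_grad_translate[OF C] m'] t h
  show "snd (D z) + F (fst z) (fst (D z)) \<le> g (z + (0, h))" by (simp add: z)
qed

lemma evsup_time_translate:
  assumes "evsup F g a" "h \<ge> 0"
  shows "evsup F (\<lambda>z. g (z + (0, h))) (\<lambda>z. a (z + (0, h)))"
  using evsub_time_translate[OF assms(1)[unfolded evsup_iff_evsub] assms(2)] unfolding evsup_iff_evsub .

lemma evsup_weaken: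
  assumes s: "evsup F g a" and "\<And>z. g' z \<le> g z"
  shows "evsup F g' (\<lambda>z. a z + c)"
  unfolding evsup_def
proof (intro allI impI)
  fix phi D and z :: "'a \<times> real" assume t: "snd z > 0" and C: "C1_grad phi D"
    and m: "loc_min (\<lambda>z. a z + c - phi z) z"
  have "loc_max (\<lambda>z. - (a z - phi z)) z"
    by (rule loc_max_mono[OF m[unfolded loc_min_iff_loc_max], where c = c]) auto
  then have "loc_min (\<lambda>z. a z - phi z) z" by (simp add: loc_min_iff_loc_max)
  then have "g z \<le> snd (D z) + F (fst z) (fst (D z))" using s t C unfolding evsup_def by blast
  then show "g' z \<le> snd (D z) + F (fst z) (fst (D z))" using assms(2)[of z] by linarith
qed

context weakly_coupled
begin

text \<open>The initial datum is left free, so that time translates and stationary solutions are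
  covered too.\<close>

definition evsol :: "('m \<Rightarrow> (real^'n) \<times> real \<Rightarrow> real) \<Rightarrow> bool" where
  "evsol U \<longleftrightarrow> (\<forall>i. continuous_on (UNIV \<times> {0..}) (U i) \<and> (\<forall>t. periodic1 (\<lambda>x. U i (x, t)))
     \<and> evsub (F i) (rhs U i) (U i) \<and> evsup (F i) (rhs U i) (U i))"

lemma evsolD:
  assumes "evsol U"
  shows "continuous_on (UNIV \<times> {0..}) (U i)" "periodic1 (\<lambda>x. U i (x, t))"
    "evsub (F i) (rhs U i) (U i)" "evsup (F i) (rhs U i) (U i)"
  using assms by (auto simp: evsol_def)

lemma evsol_stationary:
  assumes "\<And>i. continuous_on UNIV (v i)" "\<And>i. periodic1 (v i)"
    "\<And>i. stsub (F i) (strhs v i) (v i)" "\<And>i. stsup (F i) (strhs v i) (v i)"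
  shows "evsol (\<lambda>i z. v i (fst z))"
  unfolding evsol_def
proof (intro allI conjI)
  have e: "rhs (\<lambda>i z. v i (fst z)) i = (\<lambda>z. strhs v i (fst z))" for i
    by (rule ext) (rule rhs_of_strhs)
  show "continuous_on (UNIV \<times> {0..}) (\<lambda>z::(real^'n) \<times> real. v i (fst z))" for i
    by (rule continuous_on_compose2[OF assms(1) continuous_on_fst[OF continuous_on_id]]) simp
  show "periodic1 (\<lambda>x. v i (fst (x, t::real)))" for i t using assms(2) by simp
  show "evsub (F i) (rhs (\<lambda>i z. v i (fst z)) i) (\<lambda>z. v i (fst z))" for i
    unfolding e by (rule evsub_of_stsub[OF assms(3)])
  show "evsup (F i) (rhs (\<lambda>i z. v i (fst z)) i) (\<lambda>z. v i (fst z))" for i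
    unfolding e by (rule evsup_of_stsup[OF assms(4)])
qed

lemma evsol_time_translate:
  assumes U: "evsol U" and h: "h \<ge> 0"
  shows "evsol (\<lambda>i z. U i (z + (0, h)))"
  unfolding evsol_def
proof (intro allI conjI)
  have e: "rhs (\<lambda>i z. U i (z + (0, h))) i = (\<lambda>z. rhs U i (z + (0, h)))" for i
    by (rule ext) (simp add: rhs_def)
  show "continuous_on (UNIV \<times> {0..}) (\<lambda>z. U i (z + (0, h)))" for i
    by (rule continuous_on_compose2[OF evsolD(1)[OF U]]) (use h in \<open>auto intro: continuous_intros\<close>)
  show "periodic1 (\<lambda>x. U i ((x, t) + (0, h)))" for i t using evsolD(2)[OF U] by simp
  show "evsub (F i) (rhs (\<lambda>i z. U i (z + (0, h))) i) (\<lambda>z. U i (z + (0, h)))" for i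
    unfolding e by (rule evsub_time_translate[OF evsolD(3)[OF U] h])
  show "evsup (F i) (rhs (\<lambda>i z. U i (z + (0, h))) i) (\<lambda>z. U i (z + (0, h)))" for i
    unfolding e by (rule evsup_time_translate[OF evsolD(4)[OF U] h])
qed

text \<open>Adding C \<ge> 0 to all components of W keeps a supersolution, because the row sums are
  nonnegative.\<close>

lemma evol_contraction:
  assumes U: "evsol U" and W: "evsol W" and C: "C \<ge> 0"
    and init: "\<And>i x. U i (x, 0) \<le> W i (x, 0) + C" and t: "t \<ge> 0"
  shows "U i (x, t) \<le> W i (x, t) + C"
proof (rule evol_comparison[where U = U and W = "\<lambda>i z. W i z + C"])
  show "continuous_on (UNIV \<times> {0..}) (\<lambda>z. W i z + C)" for i by (intro continuous_intros evsolD(1)[OF W])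
  show "periodic1 (\<lambda>x. W i (x, t) + C)" for i t using evsolD(2)[OF W, of i t] by (simp add: periodic1_def)
  show "evsup (F i) (rhs (\<lambda>i z. W i z + C) i) (\<lambda>z. W i z + C)" for i
  proof (rule evsup_weaken[OF evsolD(4)[OF W]])
    fix z
    have "rhs (\<lambda>i z. W i z + C) i z = rhs W i z - (\<Sum>j\<in>UNIV. d (fst z) i j) * C"
      by (simp add: rhs_def algebra_simps sum.distrib sum_distrib_left)
    also have "\<dots> \<le> rhs W i z" using mult_nonneg_nonneg[OF d_rowsum C] by simp
    finally show "rhs (\<lambda>i z. W i z + C) i z \<le> rhs W i z" .
  qed
qed (use evsolD[OF U] init t in auto)

text \<open>A stationary solution is a bounded solution of (E), and U stays within its initial
  distance from it.\<close>

lemma evsol_bounded: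
  assumes U: "evsol U" and A: "A \<noteq> {}"
  shows "\<exists>M>0. \<forall>i x t. t \<ge> 0 \<longrightarrow> \<bar>U i (x, t)\<bar> \<le> M"
proof -
  obtain v where v: "\<And>i. continuous_on UNIV (v i)" "\<And>i. periodic1 (v i)"
    "\<And>i. stsub (F i) (strhs v i) (v i)" "\<And>i. stsup (F i) (strhs v i) (v i)"
    using stationary_solution_exists[OF A] by blast
  note V = evsol_stationary[where v = v, OF v]
  obtain B where B: "B > 0" "\<And>i x. \<bar>v i x\<bar> \<le> B" using periodic1_family_bounded[where g = v, OF v(1,2)] by auto
  have c0: "continuous_on UNIV (\<lambda>x. U i (x, 0))" for i
    by (rule continuous_on_compose2[OF evsolD(1)[OF U, of i]]) (auto intro: continuous_intros)
  obtain B' where B': "B' > 0" "\<And>i x. \<bar>U i (x, 0)\<bar> \<le> B'"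
    using periodic1_family_bounded[where g = "\<lambda>i x. U i (x, 0)", OF c0 evsolD(2)[OF U]] by auto
  have i1: "U i (x, 0) \<le> v i (fst (x, 0::real)) + (B + B')" for i x using B(2)[of i x] B'(2)[of i x] by simp
  have i2: "v i (fst (x, 0::real)) \<le> U i (x, 0) + (B + B')" for i x using B(2)[of i x] B'(2)[of i x] by simp
  have BB: "B + B' \<ge> 0" using B(1) B'(1) by simp
  have "\<bar>U i (x, t)\<bar> \<le> 2 * B + B'" if "t \<ge> 0" for i x t
    using evol_contraction[OF U V BB i1 that, of i x] evol_contraction[OF V U BB i2 that, of i x] B(2)[of i x] by simp
  moreover have "2 * B + B' > 0" using B(1) B'(1) by simp
  ultimately show ?thesis by blast
qed

text \<open>U and its translate by h both solve (E), so contraction carries the increment between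
  times 0 and h to all later times. Near t = 0 it is small by uniform continuity on a compact
  set.\<close>

lemma evsol_time_modulus:
  assumes U: "evsol U" and e: "e > 0"
  shows "\<exists>r>0. \<forall>i x t h. 0 \<le> t \<longrightarrow> 0 \<le> h \<longrightarrow> h < r \<longrightarrow> \<bar>U i (x, t + h) - U i (x, t)\<bar> \<le> e"
proof -
  let ?K = "cbox (0::real^'n) 1 \<times> {0..1::real}"
  have "continuous_on ?K (U i)" for i by (rule continuous_on_subset[OF evsolD(1)[OF U]]) auto
  moreover have "compact ?K" by (intro compact_Times) auto
  ultimately obtain r where r: "r > 0" "\<And>i z z'. z \<in> ?K \<Longrightarrow> z' \<in> ?K \<Longrightarrow> dist z' z < r \<Longrightarrow> \<bar>U i z' - U i z\<bar> < e"
    using uniform_modulus[where U = U and K = ?K, OF _ _ e] by auto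
  have init: "\<bar>U i (x, h) - U i (x, 0)\<bar> \<le> e" if h: "0 \<le> h" "h < min r 1" for i x h
  proof -
    obtain k where k: "\<And>i. k $ i \<in> \<int>" "x + k \<in> cbox 0 1" using int_translate_into_cube[of x] by metis
    have "\<bar>U i (x + k, h) - U i (x + k, 0)\<bar> < e"
      using k(2) h by (intro r(2)) (auto simp: dist_real_def)
    then show ?thesis
      using periodic1_int_vector[OF evsolD(2)[OF U, of i h] k(1), of x] periodic1_int_vector[OF evsolD(2)[OF U, of i 0] k(1), of x]
      by simp
  qed
  have "\<bar>U i (x, t + h) - U i (x, t)\<bar> \<le> e" if t: "0 \<le> t" and h: "0 \<le> h" "h < min r 1" for i x t h
  proof -
    note V = evsol_time_translate[OF U h(1)]
    have i1: "U i ((x, 0) + (0, h)) \<le> U i (x, 0) + e" and i2: "U i (x, 0) \<le> U i ((x, 0) + (0, h)) + e" for i x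
      using init[OF h, of i x] by auto
    show ?thesis
      using evol_contraction[OF V U less_imp_le[OF e] i1 t, of i x] evol_contraction[OF U V less_imp_le[OF e] i2 t, of i x]
      by auto
  qed
  moreover have "min r 1 > 0" using r(1) by simp
  ultimately show ?thesis by blast
qed

text \<open>For each fixed kap, the penalty kap (s - t)^2 bounds the time derivatives of the test
  functions below, so that coercivity gives a modulus of continuity in x, uniformly in t.\<close>
lemma evsol_space_modulus:
  assumes U: "evsol U" and A: "A \<noteq> {}" and e: "e > 0"
  shows "\<exists>r>0. \<forall>i x y t. 1 \<le> t \<longrightarrow> dist y x < r \<longrightarrow> \<bar>U i (y, t) - U i (x, t)\<bar> \<le> e"
proof -
  obtain M where M: "M > 0" "\<And>i x t. t \<ge> 0 \<Longrightarrow> \<bar>U i (x, t)\<bar> \<le> M" using evsol_bounded[OF U A] by blast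
  have e2: "e/2 > 0" using e by simp
  obtain r0 where r0: "r0 > 0" "\<And>i x t h. 0 \<le> t \<Longrightarrow> 0 \<le> h \<Longrightarrow> h < r0 \<Longrightarrow> \<bar>U i (x, t + h) - U i (x, t)\<bar> \<le> e/2"
    using evsol_time_modulus[OF U e2] by blast
  \<comment> \<open>The bound 1 keeps the window of times around t \<ge> 1 nonnegative;
    \<open>r0\<close> lets times inside the window be exchanged at cost e / 2.\<close>
  define rho where "rho = min r0 1"
  have rho: "rho > 0" "rho \<le> r0" "rho \<le> 1" using r0(1) by (auto simp: rho_def)
  \<comment> \<open>At the ends of the time window the penalty 2 M + 1 exceeds the oscillation of U,
    so the maximum is interior in time.\<close>
  define kap where "kap = (2 * M + 1) / rho\<^sup>2"
  have kap: "kap > 0" "kap * rho\<^sup>2 = 2 * M + 1" using M(1) rho by (auto simp: kap_def)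
  obtain fB where fB: "fB > 0" "\<And>i x. \<bar>f i x\<bar> \<le> fB" using f_bounded by blast
  obtain K where K: "K > 0" "\<And>v i x B. (\<forall>j. \<bar>v j\<bar> \<le> B) \<Longrightarrow> \<bar>\<Sum>j\<in>UNIV. d x i j * v j\<bar> \<le> K * B"
    using coupling_bounded by blast
  \<comment> \<open>The bound consists of \<open>fB + K * M\<close> for the right-hand side and 2
    kap for the time derivative 2 kap (s0 - t), as |s0 - t| < rho \<le> 1.\<close>
  obtain R where R: "R > 0" "\<And>i x p. norm p \<ge> R \<Longrightarrow> F i x p > fB + K * M + 2 * kap"
    using uniformly_coercive[of "fB + K * M + 2 * kap"] by blast
  have key: "U i (y, t) \<le> U i (x, t) + e/2 + R * dist y x" if t: "t \<ge> 1" for i x y t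
  proof -
    define psi where "psi = (\<lambda>z. U i z - R * dist (fst z) x - kap * (snd z - t)\<^sup>2)"
    define Q where "Q = cball x (2 * M / R) \<times> {t - rho .. t + rho}"
    have Qp: "snd z \<ge> 0" if "z \<in> Q" for z using that t rho by (auto simp: Q_def)
    have psic: "continuous_on Q psi" unfolding psi_def
      by (intro continuous_intros continuous_on_subset[OF evsolD(1)[OF U]]) (use Qp in \<open>auto simp: mem_Times_iff\<close>)
    have xt: "(x, t) \<in> Q" using M R rho by (simp add: Q_def)
    have "compact Q" unfolding Q_def by (intro compact_Times) auto
    then obtain z0 where z0: "z0 \<in> Q" "\<And>z. z \<in> Q \<Longrightarrow> psi z \<le> psi z0"
      using continuous_attains_sup[OF _ _ psic] xt by blast
    obtain y0 s0 where yz: "z0 = (y0, s0)" by (metis prod.collapse)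
    have s0: "\<bar>s0 - t\<bar> \<le> rho" "s0 \<ge> 0" using z0(1) Qp by (auto simp: Q_def yz abs_le_iff)
    have psixt: "psi (x, t) = U i (x, t)" by (simp add: psi_def)
    have glob: "psi (y, s) \<le> psi z0" if s: "\<bar>s - t\<bar> \<le> rho" for y s
    proof (cases "y \<in> cball x (2 * M / R)")
      case True
      then have "(y, s) \<in> Q" using s by (auto simp: Q_def abs_le_iff)
      then show ?thesis by (rule z0(2))
    next
      case False
      then have "dist y x > 2 * M / R" by (simp add: dist_commute)
      then have "R * dist y x > 2 * M" using R by (simp add: divide_less_eq mult.commute)
      moreover have "kap * (s - t)\<^sup>2 \<ge> 0" using kap by simp
      moreover have "s \<ge> 0" using s t rho by linarith
      ultimately have "psi (y, s) \<le> U i (x, t)"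
        using M(2)[of s i y] M(2)[of t i x] t unfolding psi_def fst_conv snd_conv by linarith
      also have "\<dots> \<le> psi z0" using z0(2)[OF xt] psixt by simp
      finally show ?thesis .
    qed
    have strict: "\<bar>s0 - t\<bar> < rho"
    proof (rule ccontr)
      assume "\<not> ?thesis"
      then have "\<bar>s0 - t\<bar> = rho" using s0 by simp
      then have "(s0 - t)\<^sup>2 = rho\<^sup>2" by (metis power2_abs)
      then have "psi z0 \<le> U i (y0, s0) - (2 * M + 1)" using kap R by (simp add: psi_def yz)
      also have "\<dots> < U i (x, t)" using M(2)[OF s0(2), of i y0] M(2)[of t i x] t by linarith
      finally show False using z0(2)[OF xt] psixt by simp
    qed
    have s0p: "s0 > 0" using strict t rho by linarith
    have "y0 = x"
    proof (rule ccontr)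
      assume ne: "y0 \<noteq> x"
      define r where "r = norm (y0 - x)"
      have r: "r > 0" using ne by (simp add: r_def)
      let ?phi = "\<lambda>z::(real^'n) \<times> real. R / (2 * r) * (norm (fst z - x))\<^sup>2 + kap * (snd z - t)\<^sup>2"
      let ?p = "(R / (2 * r)) *\<^sub>R (2 *\<^sub>R (y0 - x))"
      have C: "C1_grad ?phi (\<lambda>z. ((R / (2 * r)) *\<^sub>R (2 *\<^sub>R (fst z - x)), 2 * kap * (snd z - t)))"
        by (intro C1_grad_split C1_grad_cmult C1_grad_sq_dist sq_deriv continuous_intros)
      have le: "U i z - ?phi z \<le> U i z0 - ?phi z0" if z: "\<bar>snd z - t\<bar> \<le> rho" for z
      proof -
        have "0 \<le> R / (2 * r) * (norm (fst z - x) - r)\<^sup>2" using R r by simp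
        also have "\<dots> = R / (2 * r) * (norm (fst z - x))\<^sup>2 - R * norm (fst z - x) + R * r / 2"
          using r by (simp add: power2_eq_square field_simps)
        finally have "U i z - ?phi z \<le> psi z + R * r / 2" by (simp add: psi_def dist_norm)
        also have "\<dots> \<le> psi z0 + R * r / 2" using glob[OF z, of "fst z"] by simp
        also have "\<dots> = U i z0 - ?phi z0"
          using r by (simp add: psi_def yz dist_norm r_def[symmetric] power2_eq_square field_simps)
        finally show ?thesis .
      qed
      have "loc_max (\<lambda>z. U i z - ?phi z) (y0, s0)"
        unfolding loc_max_def
      proof (intro exI[of _ "rho - \<bar>s0 - t\<bar>"] conjI allI impI)
        show "rho - \<bar>s0 - t\<bar> > 0" using strict by simp
        fix z :: "(real^'n) \<times> real" assume "dist z (y0, s0) < rho - \<bar>s0 - t\<bar>"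
        then have "dist (snd z) s0 < rho - \<bar>s0 - t\<bar>" using dist_snd_le[of z "(y0, s0)"] by simp
        then have "\<bar>snd z - t\<bar> \<le> rho" unfolding dist_real_def by linarith
        from le[OF this] show "U i z - ?phi z \<le> U i (y0, s0) - ?phi (y0, s0)" by (simp add: yz)
      qed
      from evsubD[OF evsolD(3)[OF U] s0p C this]
      have 1: "2 * kap * (s0 - t) + F i y0 ?p \<le> rhs U i (y0, s0)" by simp
      have "\<bar>\<Sum>j\<in>UNIV. d y0 i j * U j (y0, s0)\<bar> \<le> K * M" using M(2)[OF s0(2)] by (intro K(2)) auto
      then have 2: "rhs U i (y0, s0) \<le> fB + K * M" using fB(2)[of i y0] unfolding rhs_def by simp
      have "kap * (t - s0) \<le> kap * 1" using strict rho kap by (intro mult_left_mono) auto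
      then have 3: "- (2 * kap * (s0 - t)) \<le> 2 * kap" by (simp add: algebra_simps)
      have "norm ?p = R" using R r by (simp add: r_def[symmetric])
      then have "F i y0 ?p > fB + K * M + 2 * kap" using R(2)[of ?p i y0] by simp
      then show False using 1 2 3 by linarith
    qed
    \<comment> \<open>The maximum sits over x, but at some time \<open>s0\<close>; the time modulus
      replaces \<open>s0\<close> by \<open>t\<close>.\<close>
    have "psi (y, t) \<le> psi z0" using rho by (intro glob) simp
    also have "\<dots> \<le> U i (x, s0)" using kap by (simp add: psi_def yz \<open>y0 = x\<close>)
    also have "\<dots> \<le> U i (x, t) + e/2"
    proof (cases "s0 \<ge> t")
      case True
      then have "\<bar>U i (x, t + (s0 - t)) - U i (x, t)\<bar> \<le> e/2" using strict rho t by (intro r0(2)) auto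
      then show ?thesis by (simp only: add_diff_cancel_left' diff_add_cancel add.commute[of t] abs_le_iff) linarith
    next
      case False
      then have "\<bar>U i (x, s0 + (t - s0)) - U i (x, s0)\<bar> \<le> e/2" using strict rho s0 by (intro r0(2)) auto
      then show ?thesis by (simp only: add.commute[of s0] diff_add_cancel abs_le_iff) linarith
    qed
    finally show ?thesis by (simp add: psi_def)
  qed
  have "\<bar>U i (y, t) - U i (x, t)\<bar> \<le> e" if t: "1 \<le> t" and yx: "dist y x < e / (2 * R)" for i x y t
  proof -
    have "R * dist y x \<le> e/2" using yx R by (simp add: field_simps)
    then show ?thesis using key[OF t, of i y x] key[OF t, of i x y] by (simp add: dist_commute abs_le_iff)
  qed
  moreover have "e / (2 * R) > 0" using e R by simp
  ultimately show ?thesis by blast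
qed

end

section \<open>Half limits as time tends to infinity\<close>

text \<open>The limit superior at infinity of an eventually bounded function, kept real-valued; the
  limit inferior is written \<open>- lsup (\<lambda>t. - g t)\<close>.\<close>

definition lsup :: "(real \<Rightarrow> real) \<Rightarrow> real" where
  "lsup g = Inf {c. \<forall>\<^sub>F t in at_top. g t \<le> c}"

lemma
  assumes b: "\<forall>\<^sub>F t in at_top. \<bar>g t\<bar> \<le> M" and e: "e > 0"
  shows lsup_eventually: "\<forall>\<^sub>F t in at_top. g t \<le> lsup g + e"
    and lsup_frequently: "\<exists>t\<ge>T. g t > lsup g - e"
proof -
  let ?S = "{c. \<forall>\<^sub>F t in at_top. g t \<le> c}"
  have M: "M \<in> ?S" using b by (auto elim!: eventually_mono)
  have low: "c \<ge> - M" if "c \<in> ?S" for c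
  proof -
    have "\<forall>\<^sub>F t in at_top. g t \<le> c \<and> \<bar>g t\<bar> \<le> M" using that b by (auto intro: eventually_conj)
    then obtain t where "g t \<le> c" "\<bar>g t\<bar> \<le> M"
      using eventually_happens[of _ "at_top::real filter"] by auto
    then show ?thesis by linarith
  qed
  have bdd: "bdd_below ?S" using low by (rule bdd_belowI)
  obtain c where c: "c \<in> ?S" "c < lsup g + e"
    using cInf_lessD[of ?S "lsup g + e"] M e unfolding lsup_def by auto
  then show "\<forall>\<^sub>F t in at_top. g t \<le> lsup g + e" by (auto elim!: eventually_mono)
  show "\<exists>t\<ge>T. g t > lsup g - e"
  proof (rule ccontr)
    assume "\<not> ?thesis"
    then have "\<forall>\<^sub>F t in at_top. g t \<le> lsup g - e"
      unfolding eventually_at_top_linorder by (auto simp: not_less)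
    then have "lsup g - e \<in> ?S" by simp
    then have "lsup g \<le> lsup g - e" unfolding lsup_def using bdd by (rule cInf_lower)
    then show False using e by simp
  qed
qed

text \<open>Translates of U by times \<open>t n\<close> that nearly attain the limit superior at x
  converge there, and all of them lie asymptotically below V; stability of maxima applies to a test
  function independent of t. Convexity and coercivity are absent so that the reflected equation is
  covered.\<close>

lemma upper_limit_subsolution:
  fixes F :: "'a::euclidean_space \<Rightarrow> 'a \<Rightarrow> real" and d :: "'a \<Rightarrow> 'm::finite \<Rightarrow> real"
  assumes Fc: "continuous_on UNIV (\<lambda>(x, p). F x p)" and fc: "continuous_on UNIV f"
    and dc: "\<And>j. continuous_on UNIV (\<lambda>x. d x j)" and d_off: "\<And>x j. j \<noteq> i \<Longrightarrow> d x j \<le> 0"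
    and Uc: "continuous_on (UNIV \<times> {0..}) (U i)"
    and sub: "evsub F (\<lambda>z. f (fst z) - (\<Sum>j\<in>UNIV. d (fst z) j * U j z)) (U i)"
    and upper: "\<And>j x e. e > 0 \<Longrightarrow> \<exists>r>0. \<exists>T. \<forall>y t. dist y x < r \<longrightarrow> t \<ge> T \<longrightarrow> U j (y, t) \<le> V j x + e"
    and freq: "\<And>x e T. e > 0 \<Longrightarrow> \<exists>t\<ge>T. U i (x, t) > V i x - e"
  shows "stsub F (\<lambda>x. f x - (\<Sum>j\<in>UNIV. d x j * V j x)) (V i)"
  unfolding stsub_def
proof (intro allI impI)
  fix phi D x assume C: "C1_grad phi D" and m: "loc_max (\<lambda>z. V i z - phi z) x"
  have "\<forall>n. \<exists>t\<ge>real (Suc n). U i (x, t) > V i x - inverse (real (Suc n))" using freq by simp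
  then obtain t where t: "\<And>n. t n \<ge> real (Suc n)" "\<And>n. U i (x, t n) > V i x - inverse (real (Suc n))" by metis
  have t1: "t n \<ge> 1" for n using t(1)[of n] by simp
  have t_ev: "\<forall>\<^sub>F n in sequentially. t n \<ge> T" for T
  proof -
    obtain N :: nat where N: "real N \<ge> T" using real_arch_simple by blast
    have "t n \<ge> T" if "n \<ge> N" for n using t(1)[of n] N that by linarith
    then show ?thesis unfolding eventually_sequentially by blast
  qed
  \<comment> \<open>As t n \<ge> 1, the translates are defined on the unit ball around (x, 0),
    negative times included.\<close>
  define a where "a = (\<lambda>n z. U i (z + (0, t n)))"
  define z0 where "z0 = (x, 0::real)"
  have ac: "continuous_on (cball z0 1) (a n)" for n
    unfolding a_def
  proof (rule continuous_on_compose2[OF Uc])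
    show "continuous_on (cball z0 1) (\<lambda>z. z + (0, t n))" by (intro continuous_intros)
    show "(\<lambda>z. z + (0, t n)) ` cball z0 1 \<subseteq> UNIV \<times> {0..}"
    proof
      fix w assume "w \<in> (\<lambda>z. z + (0, t n)) ` cball z0 1"
      then obtain z where z: "dist z0 z \<le> 1" "w = z + (0, t n)" by auto
      have "dist (snd z0) (snd z) \<le> 1" using z(1) dist_snd_le[of z0 z] by linarith
      then have "snd w \<ge> 0" using t1[of n] by (simp add: z z0_def dist_real_def)
      then show "w \<in> UNIV \<times> {0..}" by (simp add: mem_Times_iff)
    qed
  qed
  have up: "\<exists>rho>0. \<forall>\<^sub>F n in sequentially. \<forall>y\<in>ball z rho \<inter> cball z0 1. a n y \<le> V i (fst z) + e"
    if e: "e > 0" for z e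
  proof -
    obtain r T where r: "r > 0" "\<And>y t. dist y (fst z) < r \<Longrightarrow> t \<ge> T \<Longrightarrow> U i (y, t) \<le> V i (fst z) + e"
      using upper[OF e, of "fst z" i] by blast
    have "\<forall>\<^sub>F n in sequentially. \<forall>y\<in>ball z r \<inter> cball z0 1. a n y \<le> V i (fst z) + e"
      using t_ev[of "T + 1"]
    proof eventually_elim
      case (elim n)
      show ?case
      proof
        fix y assume y: "y \<in> ball z r \<inter> cball z0 1"
        have "dist (fst y) (fst z) < r" using y dist_fst_le[of y z] by (auto simp: dist_commute)
        moreover have "dist (snd y) (snd z0) \<le> 1" using y dist_snd_le[of y z0] by (auto simp: dist_commute)
        then have "snd y + t n \<ge> T" using elim by (simp add: z0_def dist_real_def)
        ultimately have "U i (fst y, snd y + t n) \<le> V i (fst z) + e" by (rule r(2))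
        then show "a n y \<le> V i (fst z) + e" by (simp add: a_def plus_prod_def)
      qed
    qed
    then show ?thesis using r(1) by blast
  qed
  have lim: "(\<lambda>n. a n z0) \<longlonglongrightarrow> V i (fst z0)"
  proof (rule tendstoI)
    fix e :: real assume e: "e > 0"
    have e2: "e/2 > 0" using e by simp
    obtain r T where r: "r > 0" "\<And>y t. dist y x < r \<Longrightarrow> t \<ge> T \<Longrightarrow> U i (y, t) \<le> V i x + e/2"
      using upper[OF e2, of x i] by blast
    have "\<forall>\<^sub>F n in sequentially. inverse (real (Suc n)) < e"
      using order_tendstoD(2)[OF LIMSEQ_inverse_real_of_nat e] .
    with t_ev[of T] show "\<forall>\<^sub>F n in sequentially. dist (a n z0) (V i (fst z0)) < e"
    proof eventually_elim
      case (elim n)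
      have "U i (x, t n) \<le> V i x + e/2" using r(1) elim(1) by (intro r(2)) auto
      then show ?case using t(2)[of n] elim(2) e by (simp add: a_def z0_def dist_real_def abs_less_iff)
    qed
  qed
  have phic: "continuous_on UNIV (\<lambda>z::'a \<times> real. phi (fst z))"
    by (rule C1_grad_continuous[OF C1_grad_fst[OF C]])
  have mx: "loc_max (\<lambda>z::'a \<times> real. V i (fst z) - phi (fst z)) z0"
  proof -
    obtain e where e: "e > 0" "\<And>z. dist z x < e \<Longrightarrow> V i z - phi z \<le> V i x - phi x"
      using m unfolding loc_max_def by blast
    show ?thesis unfolding loc_max_def
    proof (intro exI[of _ e] conjI allI impI)
      fix z :: "'a \<times> real" assume "dist z z0 < e"
      then have "dist (fst z) x < e" using dist_fst_le[of z z0] by (simp add: z0_def)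
      from e(2)[OF this] show "V i (fst z) - phi (fst z) \<le> V i (fst z0) - phi (fst z0)" by (simp add: z0_def)
    qed (use e in auto)
  qed
  obtain zs where zs: "zs \<longlonglongrightarrow> z0" "(\<lambda>n. a n (zs n)) \<longlonglongrightarrow> V i (fst z0)"
    "\<forall>\<^sub>F n in sequentially. loc_max (\<lambda>z. a n z - (phi (fst z) + (norm (z - z0))\<^sup>2)) (zs n)"
    using stability_of_maxima[where a = a and A = "\<lambda>z. V i (fst z)", OF zero_less_one ac up lim mx phic] by blast
  define y where "y = (\<lambda>n. fst (zs n))"
  define s where "s = (\<lambda>n. snd (zs n))"
  have yl: "y \<longlonglongrightarrow> x" using tendsto_fst[OF zs(1)] by (simp add: y_def z0_def)
  have sl: "s \<longlonglongrightarrow> 0" using tendsto_snd[OF zs(1)] by (simp add: s_def z0_def)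
  define P where "P = (\<lambda>n. D (y n) + 2 *\<^sub>R (y n - x))"
  have s_ev: "\<forall>\<^sub>F n in sequentially. s n > -1" using order_tendstoD(1)[OF sl, of "-1"] by simp
  have ineq: "\<forall>\<^sub>F n in sequentially. 2 * s n + F (y n) (P n) \<le> f (y n) - (\<Sum>j\<in>UNIV. d (y n) j * U j (y n, s n + t n))"
    using zs(3) s_ev
  proof eventually_elim
    case (elim n)
    have e: "z + (0, t n) - (x, t n) = z - (x, 0)" for z :: "'a \<times> real" by (cases z) simp
    have "loc_max (\<lambda>z. (\<lambda>z. U i z - (phi (fst z) + (norm (z - (x, t n)))\<^sup>2)) (z + (0, t n))) (zs n)"
      using elim(1) by (simp add: a_def z0_def e)
    then have "loc_max (\<lambda>z. U i z - (phi (fst z) + (norm (z - (x, t n)))\<^sup>2)) (zs n + (0, t n))"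
      by (rule loc_max_translate[THEN iffD1])
    moreover have "zs n + (0, t n) = (y n, s n + t n)" by (simp add: y_def s_def plus_prod_def)
    ultimately have lm: "loc_max (\<lambda>z. U i z - (phi (fst z) + (norm (z - (x, t n)))\<^sup>2)) (y n, s n + t n)" by simp
    have pos: "s n + t n > 0" using elim(2) t1[of n] by linarith
    from evsubD[OF sub pos C1_grad_add[OF C1_grad_fst[OF C] C1_grad_sq_dist] lm]
    show ?case by (simp add: P_def)
  qed
  have seq: "(\<lambda>n. g (y n)) \<longlonglongrightarrow> g x" if "continuous_on UNIV g" for g :: "'a \<Rightarrow> 'b::topological_space"
    using continuous_on_tendsto_compose[OF that yl] by simp
  have "continuous_on UNIV D" using C by (simp add: C1_grad_def)
  then have "P \<longlonglongrightarrow> D x + 2 *\<^sub>R (x - x)" unfolding P_def by (intro tendsto_intros seq yl)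
  then have Fl: "(\<lambda>n. 2 * s n + F (y n) (P n)) \<longlonglongrightarrow> 2 * 0 + F x (D x)"
    by (intro tendsto_intros sl tendsto_of_joint_continuity[OF Fc yl]) simp
  have Ul: "(\<lambda>n. U i (y n, s n + t n)) \<longlonglongrightarrow> V i x"
    using zs(2) by (simp add: a_def y_def s_def z0_def plus_prod_def)
  \<comment> \<open>Along the sequence only \<open>U i\<close> converges; the other components are
    merely at most \<open>V j x + e\<close> eventually. The signs of the off-diagonal entries make
    this enough, and \<open>S\<close> is the total weight of the error \<open>e\<close>.\<close>
  define S where "S = - (\<Sum>j\<in>UNIV - {i}. d x j)"
  have S0: "S \<ge> 0" unfolding S_def using d_off by (auto intro: sum_nonpos)
  have main: "F x (D x) \<le> f x - (\<Sum>j\<in>UNIV. d x j * V j x) + e * S" if e: "e > 0" for e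
  proof -
    have "\<forall>j. \<exists>r>0. \<exists>T. \<forall>y t. dist y x < r \<longrightarrow> t \<ge> T \<longrightarrow> U j (y, t) \<le> V j x + e" using upper[OF e] by blast
    then obtain r where r: "\<And>j. r j > 0" "\<forall>j. \<exists>T. \<forall>y t. dist y x < r j \<longrightarrow> t \<ge> T \<longrightarrow> U j (y, t) \<le> V j x + e"
      by metis
    then obtain T where T: "\<And>j y t. dist y x < r j \<Longrightarrow> t \<ge> T j \<Longrightarrow> U j (y, t) \<le> V j x + e" by metis
    have "\<forall>\<^sub>F n in sequentially. U j (y n, s n + t n) \<le> V j x + e" for j
      using tendstoD[OF yl r(1)[of j]] t_ev[of "T j + 1"] s_ev
    proof eventually_elim
      case (elim n)
      show ?case using elim by (intro T) auto
    qed
    then have "\<forall>\<^sub>F n in sequentially. \<forall>j. U j (y n, s n + t n) \<le> V j x + e"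
      by (simp add: eventually_all_finite)
    with ineq have "\<forall>\<^sub>F n in sequentially. 2 * s n + F (y n) (P n)
        \<le> f (y n) - (d (y n) i * U i (y n, s n + t n) + (\<Sum>j\<in>UNIV - {i}. d (y n) j * (V j x + e)))"
    proof eventually_elim
      case (elim n)
      have "(\<Sum>j\<in>UNIV - {i}. d (y n) j * (V j x + e)) \<le> (\<Sum>j\<in>UNIV - {i}. d (y n) j * U j (y n, s n + t n))"
        using elim(2) d_off by (intro sum_mono mult_left_mono_neg) auto
      then show ?case using elim(1) sum.remove[of UNIV i "\<lambda>j. d (y n) j * U j (y n, s n + t n)"] by simp
    qed
    moreover have "(\<lambda>n. f (y n) - (d (y n) i * U i (y n, s n + t n) + (\<Sum>j\<in>UNIV - {i}. d (y n) j * (V j x + e))))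
        \<longlonglongrightarrow> f x - (d x i * V i x + (\<Sum>j\<in>UNIV - {i}. d x j * (V j x + e)))"
      by (intro tendsto_intros seq fc dc Ul)
    ultimately have "2 * 0 + F x (D x) \<le> f x - (d x i * V i x + (\<Sum>j\<in>UNIV - {i}. d x j * (V j x + e)))"
      using tendsto_le[OF _ _ Fl] by simp
    also have "(\<Sum>j\<in>UNIV - {i}. d x j * (V j x + e)) = (\<Sum>j\<in>UNIV - {i}. d x j * V j x) - e * S"
      by (simp add: S_def algebra_simps sum.distrib sum_distrib_left)
    finally show ?thesis using sum.remove[of UNIV i "\<lambda>j. d x j * V j x"] by simp
  qed
  show "F x (D x) \<le> f x - (\<Sum>j\<in>UNIV. d x j * V j x)"
  proof (rule field_le_epsilon)
    fix e :: real assume e: "e > 0"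
    have "e / (1 + S) > 0" using e S0 by simp
    from main[OF this] have "F x (D x) \<le> f x - (\<Sum>j\<in>UNIV. d x j * V j x) + e / (1 + S) * S" .
    moreover have "e / (1 + S) * S \<le> e" using e S0 by (simp add: field_simps)
    ultimately show "F x (D x) \<le> f x - (\<Sum>j\<in>UNIV. d x j * V j x) + e" by linarith
  qed
qed

section \<open>Continuity and local uniformity of the half limits\<close>

lemma lsup_modulus:
  assumes "\<forall>\<^sub>F t in at_top. \<bar>g t\<bar> \<le> M" "\<forall>\<^sub>F t in at_top. \<bar>h t\<bar> \<le> M" "\<forall>\<^sub>F t in at_top. g t \<le> h t + e"
  shows "lsup g \<le> lsup h + e"
proof (rule field_le_epsilon)
  fix e' :: real assume "e' > 0"
  then have e': "e'/2 > 0" by simp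
  have "\<forall>\<^sub>F t in at_top. h t \<le> lsup h + e'/2 \<and> g t \<le> h t + e"
    using lsup_eventually[OF assms(2) e'] assms(3) by (rule eventually_conj)
  then obtain T where T: "\<And>t. t \<ge> T \<Longrightarrow> h t \<le> lsup h + e'/2 \<and> g t \<le> h t + e"
    unfolding eventually_at_top_linorder by blast
  obtain t where "t \<ge> T" "g t > lsup g - e'/2" using lsup_frequently[OF assms(1) e'] by blast
  then show "lsup g \<le> lsup h + e + e'" using T[of t] by linarith
qed

lemma half_limit_continuous:
  fixes G :: "real^'n \<Rightarrow> real \<Rightarrow> real"
  assumes b: "\<And>x. \<forall>\<^sub>F t in at_top. \<bar>G x t\<bar> \<le> M"
    and mod: "\<And>e. e > 0 \<Longrightarrow> \<exists>r>0. \<forall>x y t. 1 \<le> t \<longrightarrow> dist y x < r \<longrightarrow> \<bar>G y t - G x t\<bar> \<le> e"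
  shows "continuous_on UNIV (\<lambda>x. lsup (G x))"
  unfolding continuous_on_iff
proof (intro ballI allI impI)
  fix x and e :: real assume e: "e > 0"
  then have "e/2 > 0" by simp
  then obtain r where r: "r > 0" "\<And>x y t. 1 \<le> t \<Longrightarrow> dist y x < r \<Longrightarrow> \<bar>G y t - G x t\<bar> \<le> e/2" using mod by blast
  have "lsup (G y) \<le> lsup (G z) + e/2" if "dist y z < r" for y z
  proof (rule lsup_modulus[OF b b])
    have "G y t \<le> G z t + e/2" if "t \<ge> 1" for t using r(2)[OF that \<open>dist y z < r\<close>] by linarith
    then show "\<forall>\<^sub>F t in at_top. G y t \<le> G z t + e/2" unfolding eventually_at_top_linorder by blast
  qed
  then have le: "lsup (G y) \<le> lsup (G z) + e/2" if "dist y z < r" for y z using that .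
  have "dist (lsup (G y)) (lsup (G x)) < e" if "dist y x < r" for y
    using le[OF that] le[of x y] that e unfolding dist_real_def dist_commute[of x y] by linarith
  then show "\<exists>d>0. \<forall>y\<in>UNIV. dist y x < d \<longrightarrow> dist (lsup (G y)) (lsup (G x)) < e" using r(1) by blast
qed

lemma half_limit_upper:
  fixes G :: "real^'n \<Rightarrow> real \<Rightarrow> real"
  assumes b: "\<And>x. \<forall>\<^sub>F t in at_top. \<bar>G x t\<bar> \<le> M"
    and mod: "\<And>e. e > 0 \<Longrightarrow> \<exists>r>0. \<forall>x y t. 1 \<le> t \<longrightarrow> dist y x < r \<longrightarrow> \<bar>G y t - G x t\<bar> \<le> e"
    and e: "e > 0"
  shows "\<exists>r>0. \<exists>T. \<forall>y t. dist y x < r \<longrightarrow> t \<ge> T \<longrightarrow> G y t \<le> lsup (G x) + e"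
proof -
  have e2: "e/2 > 0" using e by simp
  obtain r where r: "r > 0" "\<And>x y t. 1 \<le> t \<Longrightarrow> dist y x < r \<Longrightarrow> \<bar>G y t - G x t\<bar> \<le> e/2" using mod[OF e2] by blast
  obtain T where T: "\<And>t. t \<ge> T \<Longrightarrow> G x t \<le> lsup (G x) + e/2"
    using lsup_eventually[OF b[of x] e2] unfolding eventually_at_top_linorder by blast
  have "G y t \<le> lsup (G x) + e" if "dist y x < r" "t \<ge> max T 1" for y t
  proof -
    have "\<bar>G y t - G x t\<bar> \<le> e/2" "G x t \<le> lsup (G x) + e/2" using r(2)[of t y x] T[of t] that by auto
    then show ?thesis by linarith
  qed
  then show ?thesis using r(1) by blast
qed

context weakly_coupled
begin

lemma half_limits_solve:
  assumes U: "evsol U" and A: "A \<noteq> {}"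
    and V_def: "V = (\<lambda>i x. lsup (\<lambda>t. U i (x, t)))" and W_def: "W = (\<lambda>i x. - lsup (\<lambda>t. - U i (x, t)))"
  shows "continuous_on UNIV (V i)" "periodic1 (V i)" "stsub (F i) (strhs V i) (V i)"
    and "continuous_on UNIV (W i)" "periodic1 (W i)" "stsup (F i) (strhs W i) (W i)"
    and "e > 0 \<Longrightarrow> \<exists>r>0. \<exists>T. \<forall>y t. dist y x < r \<longrightarrow> t \<ge> T \<longrightarrow> U i (y, t) \<le> V i x + e \<and> W i x - e \<le> U i (y, t)"
proof -
  obtain M where M: "M > 0" "\<And>i x t. t \<ge> 0 \<Longrightarrow> \<bar>U i (x, t)\<bar> \<le> M" using evsol_bounded[OF U A] by blast
  have b: "\<forall>\<^sub>F t in at_top. \<bar>U i (x, t)\<bar> \<le> M" "\<forall>\<^sub>F t in at_top. \<bar>- U i (x, t)\<bar> \<le> M" for i x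
    unfolding eventually_at_top_linorder using M(2) by auto
  have mod: "\<exists>r>0. \<forall>x y t. 1 \<le> t \<longrightarrow> dist y x < r \<longrightarrow> \<bar>U i (y, t) - U i (x, t)\<bar> \<le> e"
    "\<exists>r>0. \<forall>x y t. 1 \<le> t \<longrightarrow> dist y x < r \<longrightarrow> \<bar>- U i (y, t) - - U i (x, t)\<bar> \<le> e" if e: "e > 0" for e i
  proof -
    obtain r where r: "r > 0" "\<And>i x y t. 1 \<le> t \<Longrightarrow> dist y x < r \<Longrightarrow> \<bar>U i (y, t) - U i (x, t)\<bar> \<le> e"
      using evsol_space_modulus[OF U A e] by blast
    then show "\<exists>r>0. \<forall>x y t. 1 \<le> t \<longrightarrow> dist y x < r \<longrightarrow> \<bar>U i (y, t) - U i (x, t)\<bar> \<le> e" by blast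
    have "\<bar>- U i (y, t) - - U i (x, t)\<bar> \<le> e" if "1 \<le> t" "dist y x < r" for x y t using r(2)[OF that, of i] by simp
    then show "\<exists>r>0. \<forall>x y t. 1 \<le> t \<longrightarrow> dist y x < r \<longrightarrow> \<bar>- U i (y, t) - - U i (x, t)\<bar> \<le> e" using r(1) by blast
  qed
  show "continuous_on UNIV (V i)"
    unfolding V_def by (rule half_limit_continuous[OF b(1) mod(1)])
  have Wc: "continuous_on UNIV (\<lambda>x. lsup (\<lambda>t. - U i (x, t)))" for i
    by (rule half_limit_continuous[OF b(2) mod(2)])
  then show "continuous_on UNIV (W i)" unfolding W_def by (intro continuous_intros)
  show "periodic1 (V i)" "periodic1 (W i)"
    using evsolD(2)[OF U] unfolding V_def W_def periodic1_def by simp_all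
  have up: "\<exists>r>0. \<exists>T. \<forall>y t. dist y x < r \<longrightarrow> t \<ge> T \<longrightarrow> U j (y, t) \<le> V j x + e" 
    "\<exists>r>0. \<exists>T. \<forall>y t. dist y x < r \<longrightarrow> t \<ge> T \<longrightarrow> - U j (y, t) \<le> - W j x + e" if "e > 0" for j x e
    using half_limit_upper[where G = "\<lambda>x t. U j (x, t)", OF b(1) mod(1) that, of x]
      half_limit_upper[where G = "\<lambda>x t. - U j (x, t)", OF b(2) mod(2) that, of x] unfolding V_def W_def by simp_all
  show "stsub (F i) (strhs V i) (V i)"
    unfolding strhs_def
  proof (rule upper_limit_subsolution[where U = U and V = V and i = i and d = "\<lambda>x. d x i", OF F_cont f_cont d_cont _ _ _ up(1)])
    show "evsub (F i) (\<lambda>z. f i (fst z) - (\<Sum>j\<in>UNIV. d (fst z) i j * U j z)) (U i)"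
      using evsolD(3)[OF U, of i] unfolding rhs_def .
    show "\<exists>t\<ge>T. V i x - e < U i (x, t)" if "e > 0" for x e T
      unfolding V_def by (rule lsup_frequently[OF b(1) that])
  qed (use d_off evsolD(1)[OF U] in auto)
  have Fneg: "continuous_on UNIV (\<lambda>(x, p). - F i x (- p))" for i
  proof -
    have "continuous_on UNIV (\<lambda>z. (\<lambda>(x, p). F i x p) (fst z, - snd z))"
      by (rule continuous_on_compose2[OF F_cont continuous_on_Pair[OF continuous_on_fst[OF continuous_on_id]
            continuous_on_minus[OF continuous_on_snd[OF continuous_on_id]]]]) simp
    then show ?thesis by (simp add: case_prod_unfold continuous_on_minus)
  qed
  \<comment> \<open>-W is the upper half limit of -U, which solves the reflected equation.\<close>
  have "stsub (\<lambda>x p. - F i x (- p)) (\<lambda>x. - f i x - (\<Sum>j\<in>UNIV. d x i j * - W j x)) (\<lambda>x. - W i x)"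
  proof (rule upper_limit_subsolution[where U = "\<lambda>j z. - U j z" and V = "\<lambda>j x. - W j x" and i = i and d = "\<lambda>x. d x i", OF Fneg _ d_cont _ _ _ up(2)])
    show "evsub (\<lambda>x p. - F i x (- p)) (\<lambda>z. - f i (fst z) - (\<Sum>j\<in>UNIV. d (fst z) i j * - U j z)) (\<lambda>z. - U i z)"
      using evsolD(4)[OF U, of i] unfolding rhs_def evsup_iff_evsub by (simp add: sum_negf)
    show "\<exists>t\<ge>T. - W i x - e < - U i (x, t)" if "e > 0" for x e T
      unfolding W_def minus_minus by (rule lsup_frequently[OF b(2) that])
    show "continuous_on UNIV (\<lambda>x. - f i x)" by (intro continuous_intros f_cont)
    show "continuous_on (UNIV \<times> {0..}) (\<lambda>z. - U i z)" by (intro continuous_intros evsolD(1)[OF U])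
  qed (use d_off in auto)
  then show "stsup (F i) (strhs W i) (W i)"
    unfolding stsup_iff_stsub strhs_def by (simp add: sum_negf)
  show "\<exists>r>0. \<exists>T. \<forall>y t. dist y x < r \<longrightarrow> t \<ge> T \<longrightarrow> U i (y, t) \<le> V i x + e \<and> W i x - e \<le> U i (y, t)" if e: "e > 0"
  proof -
    obtain r1 T1 where 1: "r1 > 0" "\<And>y t. dist y x < r1 \<Longrightarrow> t \<ge> T1 \<Longrightarrow> U i (y, t) \<le> V i x + e" using up(1)[OF e] by blast
    obtain r2 T2 where 2: "r2 > 0" "\<And>y t. dist y x < r2 \<Longrightarrow> t \<ge> T2 \<Longrightarrow> - U i (y, t) \<le> - W i x + e" using up(2)[OF e] by blast
    have "U i (y, t) \<le> V i x + e \<and> W i x - e \<le> U i (y, t)" if "dist y x < min r1 r2" "t \<ge> max T1 T2" for y t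
      using 1(2)[of y t] 2(2)[of y t] that by simp
    moreover have "min r1 r2 > 0" using 1 2 by simp
    ultimately show ?thesis by blast
  qed
qed

end

section \<open>Convergence on the set A\<close>

text \<open>\<open>n i\<close> is the length of a shortest path from i to k in the graph of nonzero
  entries, and j is its first step. No nonzero entry leads out of the set of indices without such a
  path, so irreducibility makes it empty.\<close>

lemma irreducible_rank:
  fixes D :: "'m::finite \<Rightarrow> 'm \<Rightarrow> real"
  assumes irr: "irreducible_mat D"
  shows "\<exists>n::'m \<Rightarrow> nat. n k = 0 \<and> (\<forall>i. i \<noteq> k \<longrightarrow> (\<exists>j. j \<noteq> i \<and> D i j \<noteq> 0 \<and> n i = Suc (n j)))"
proof -
  define R where "R = {(i, j). D i j \<noteq> 0}"
  have reach: "\<exists>m. (i, k) \<in> R ^^ m" for i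
  proof -
    define I where "I = {i. \<not> (\<exists>m. (i, k) \<in> R ^^ m)}"
    have "k \<notin> I" unfolding I_def by (simp, rule exI[of _ 0]) simp
    have "I = {}"
    proof (rule ccontr)
      assume "I \<noteq> {}"
      then obtain i j where ij: "i \<in> I" "j \<notin> I" "D i j \<noteq> 0"
        using irr \<open>k \<notin> I\<close> unfolding irreducible_mat_def by blast
      then obtain m where "(j, k) \<in> R ^^ m" by (auto simp: I_def)
      then have "(i, k) \<in> R ^^ Suc m" using ij(3) by (auto simp: R_def relpow_commute[symmetric] intro: relpow_Suc_I2)
      then show False using ij(1) unfolding I_def by blast
    qed
    then show ?thesis unfolding I_def by blast
  qed
  define n where "n = (\<lambda>i. LEAST m. (i, k) \<in> R ^^ m)"
  have n: "(i, k) \<in> R ^^ n i" for i unfolding n_def using reach by (rule LeastI_ex)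
  have n_le: "n i \<le> m" if "(i, k) \<in> R ^^ m" for i m unfolding n_def using that by (rule Least_le)
  have "n k = 0" using n_le[of k 0] by simp
  moreover have "\<exists>j. j \<noteq> i \<and> D i j \<noteq> 0 \<and> n i = Suc (n j)" if i: "i \<noteq> k" for i
  proof -
    have "n i \<noteq> 0" using n[of i] i by (cases "n i") auto
    then obtain m where m: "n i = Suc m" using not0_implies_Suc by blast
    have "(i, k) \<in> R ^^ Suc m" using n[of i] m by simp
    then obtain j where j: "(i, j) \<in> R" "(j, k) \<in> R ^^ m" by (rule relpow_Suc_E2)
    have "n j \<le> m" using n_le[OF j(2)] .
    moreover have "n i \<le> Suc (n j)" by (rule n_le) (rule relpow_Suc_I2[OF j(1) n])
    ultimately have "n i = Suc (n j)" using m by simp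
    then show ?thesis using j(1) by (intro exI[of _ j]) (auto simp: R_def)
  qed
  ultimately show ?thesis by blast
qed

context weakly_coupled
begin

text \<open>Freezing x at \<open>x0\<close> by the penalty n |x - x0|^2 may produce unbounded
  gradients; F \<ge> 0 lets the Hamiltonian be dropped before the limit.\<close>

lemma pointwise_ode_subsolution:
  assumes U: "evsol U" and q: "\<And>t. (q has_real_derivative q' t) (at t)" and qc: "continuous_on UNIV q'"
    and t0: "t0 > 0" and e: "e > 0"
    and max: "\<And>t. \<bar>t - t0\<bar> < e \<Longrightarrow> U i (x0, t) - q t \<le> U i (x0, t0) - q t0"
  shows "q' t0 \<le> rhs U i (x0, t0)"
proof -
  define z0 where "z0 = (x0, t0)"
  define p where "p = (\<lambda>z::(real^'n) \<times> real. (norm (fst z - x0))\<^sup>2)"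
  define phi where "phi = (\<lambda>z::(real^'n) \<times> real. q (snd z))"
  have r: "t0/2 > 0" using t0 by simp
  have sp: "snd z \<ge> 0" if "z \<in> cball z0 (t0/2)" for z
  proof -
    have "dist (snd z) t0 \<le> t0/2" using that dist_snd_le[of z z0] by (auto simp: z0_def dist_commute)
    then show ?thesis using t0 unfolding dist_real_def by linarith
  qed
  have cc: "continuous_on (cball z0 (t0/2)) (U i)"
    by (rule continuous_on_subset[OF evsolD(1)[OF U]]) (use sp in \<open>auto simp: mem_Times_iff\<close>)
  have pc: "continuous_on UNIV p" unfolding p_def by (intro continuous_intros)
  have p0: "p z \<ge> 0" "p z0 = 0" for z by (simp_all add: p_def z0_def)
  have phic: "continuous_on UNIV phi"
    unfolding phi_def by (rule C1_grad_continuous[OF C1_grad_snd[OF C1_grad_real[OF q qc]]])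
  have mx: "U i z - phi z \<le> U i z0 - phi z0" if "dist z z0 < e" "p z = 0" for z
  proof -
    have "fst z = x0" using that(2) by (simp add: p_def)
    then have z: "z = (x0, snd z)" by (metis prod.collapse)
    have "\<bar>snd z - t0\<bar> < e" using that(1) dist_snd_le[of z z0] by (simp add: z0_def dist_real_def)
    from max[OF this] show ?thesis unfolding phi_def z0_def by (subst z) simp
  qed
  obtain zs where zs: "zs \<longlonglongrightarrow> z0"
    "\<forall>\<^sub>F n in sequentially. loc_max (\<lambda>z. U i z - real n * p z - (phi z + (norm (z - z0))\<^sup>2)) (zs n)"
    using penalised_maxima[OF r cc pc p0 phic e mx] by blast
  have sl: "(\<lambda>n. snd (zs n)) \<longlonglongrightarrow> t0" using tendsto_snd[OF zs(1)] by (simp add: z0_def)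
  have pos: "\<forall>\<^sub>F n in sequentially. snd (zs n) > 0" by (rule order_tendstoD(1)[OF sl t0])
  have ev: "\<forall>\<^sub>F n in sequentially. q' (snd (zs n)) + 2 * (snd (zs n) - t0) \<le> rhs U i (zs n)"
    using zs(2) pos
  proof eventually_elim
    case (elim n)
    let ?f = "\<lambda>z::(real^'n) \<times> real. (real n * (norm (fst z - x0))\<^sup>2 + q (snd z)) + (norm (z - z0))\<^sup>2"
    have C: "C1_grad ?f (\<lambda>z. (real n *\<^sub>R (2 *\<^sub>R (fst z - x0)), q' (snd z)) + 2 *\<^sub>R (z - z0))"
      by (intro C1_grad_add[OF C1_grad_split] C1_grad_sq_dist C1_grad_cmult q qc)
    have "loc_max (\<lambda>z. U i z - ?f z) (fst (zs n), snd (zs n))"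
      by (rule loc_max_mono[where g = "\<lambda>z. U i z - real n * p z - (phi z + (norm (z - z0))\<^sup>2)" and c = 0])
         (use elim(1) in \<open>auto simp: p_def phi_def\<close>)
    from evsubD[OF evsolD(3)[OF U] elim(2) C this]
    show ?case using F_min[of i "fst (zs n)" "real n *\<^sub>R (2 *\<^sub>R (fst (zs n) - x0)) + 2 *\<^sub>R (fst (zs n) - x0)"]
      by (simp add: F_zero z0_def fst_diff snd_diff)
  qed
  have rc: "continuous_on (UNIV \<times> {0..}) (rhs U i)" by (rule rhs_cont[OF evsolD(1)[OF U]])
  have "(\<lambda>n. rhs U i (zs n)) \<longlonglongrightarrow> rhs U i z0"
    by (rule continuous_on_tendsto_compose[OF rc zs(1)])
       (use t0 pos in \<open>auto simp: z0_def mem_Times_iff elim!: eventually_mono\<close>)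
  moreover have "(\<lambda>n. q' (snd (zs n)) + 2 * (snd (zs n) - t0)) \<longlonglongrightarrow> q' t0 + 2 * (t0 - t0)"
    using continuous_on_tendsto_compose[OF qc sl] by (intro tendsto_intros sl) auto
  ultimately show ?thesis using tendsto_le[OF _ _ _ ev] by (simp add: z0_def)
qed

text \<open>Comparison for the linear system y' + D(x0) y \<le> 0 that holds on A in the viscosity
  sense. As in \<open>evol_comparison\<close>, an exponential provides strictness and keeps the
  maximum off the right end, here T + 1.\<close>

lemma barrier_on_A:
  assumes U: "evsol U" and x0: "x0 \<in> A" and a: "0 \<le> a" "a \<le> T"
    and b: "\<And>i t. (b i has_real_derivative b' i t) (at t)" and bc: "\<And>i. continuous_on UNIV (b' i)"
    and super: "\<And>i t. a \<le> t \<Longrightarrow> b' i t + (\<Sum>j\<in>UNIV. d x0 i j * b j t) \<ge> 0"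
    and init: "\<And>i. U i (x0, a) \<le> b i a"
  shows "U i (x0, T) \<le> b i T"
proof (rule ccontr)
  assume neg: "\<not> ?thesis"
  define i1 where "i1 = i"
  \<comment> \<open>Half the excess: with q T = eta the other half remains at time T.\<close>
  define eta where "eta = (U i1 (x0, T) - b i1 T) / 2"
  have eta: "eta > 0" using neg by (simp add: eta_def i1_def)
  have Yc: "continuous_on {a..T+1} (\<lambda>t. U i (x0, t))" for i
    by (rule continuous_on_compose2[OF evsolD(1)[OF U, of i]]) (use a in \<open>auto intro: continuous_intros\<close>)
  have bcont: "continuous_on S (b i)" for i S
    using b by (meson DERIV_continuous continuous_at_imp_continuous_on)
  have "\<exists>B. \<forall>t\<in>{a..T+1}. \<bar>U i (x0, t) - b i t\<bar> \<le> B" for i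
    using compact_imp_bounded[OF compact_continuous_image[OF continuous_on_diff[OF Yc[of i] bcont[of _ i]] compact_Icc]]
    unfolding bounded_iff by auto
  then obtain B0 where B0: "\<And>i t. t \<in> {a..T+1} \<Longrightarrow> \<bar>U i (x0, t) - b i t\<bar> \<le> B0 i" by metis
  obtain B where B: "B > 0" "\<And>i. B0 i \<le> B" using uniform_bound by blast
  \<comment> \<open>Gives q (T + 1) \<ge> eta (1 + c) = eta + B > B, which excludes a maximum at T +
    1.\<close>
  define c where "c = B / eta"
  have c: "c > 0" using B eta by (simp add: c_def)
  define q where "q = (\<lambda>t. eta * exp (c * (t - T)))"
  define q' where "q' = (\<lambda>t. eta * (exp (c * (t - T)) * c))"
  have qd: "(q has_real_derivative q' t) (at t)" for t
    unfolding q_def q'_def by (auto intro!: derivative_eq_intros)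
  have qc: "continuous_on UNIV q'" unfolding q'_def by (intro continuous_intros)
  have qp: "q t > 0" "q' t > 0" for t using eta c by (auto simp: q_def q'_def)
  have qcont: "continuous_on S q" for S
    using qd by (meson DERIV_continuous continuous_at_imp_continuous_on)
  have qT1: "q (T + 1) > B"
  proof -
    have "eta * (1 + c) \<le> q (T + 1)" unfolding q_def using eta exp_ge_add_one_self[of c] by (intro mult_left_mono) auto
    moreover have "eta * (1 + c) = eta + B" using eta by (simp add: c_def distrib_left)
    ultimately show ?thesis using eta by linarith
  qed
  define Psi where "Psi = (\<lambda>i t. U i (x0, t) - b i t - q t)"
  have "continuous_on {a..T+1} (Psi i)" for i unfolding Psi_def by (intro continuous_intros Yc bcont qcont)
  then have "\<exists>t\<in>{a..T+1}. \<forall>s\<in>{a..T+1}. Psi i s \<le> Psi i t" for i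
    using a by (intro continuous_attains_sup) auto
  then obtain Z where Z: "\<And>i. Z i \<in> {a..T+1}" "\<And>i s. s \<in> {a..T+1} \<Longrightarrow> Psi i s \<le> Psi i (Z i)" by metis
  obtain k where k: "\<And>j. Psi j (Z j) \<le> Psi k (Z k)" using finite_argmax[of "\<lambda>j. Psi j (Z j)"] by blast
  define t0 where "t0 = Z k"
  have t0: "a \<le> t0" "t0 \<le> T + 1" using Z(1)[of k] by (auto simp: t0_def)
  have mx: "Psi j s \<le> Psi k t0" if "a \<le> s" "s \<le> T + 1" for j s
    using Z(2)[of s j] k[of j] that by (simp add: t0_def)
  have "Psi i1 T = eta" by (simp add: Psi_def q_def eta_def field_simps)
  then have val: "Psi k t0 \<ge> eta" using mx[of T i1] a by simp
  have "t0 \<noteq> a" using val eta init[of k] qp(1)[of a] by (auto simp: Psi_def)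
  moreover have "t0 \<noteq> T + 1"
    using val eta qT1 B0[of "T + 1" k] B(2)[of k] a by (auto simp: Psi_def)
  ultimately have int: "a < t0" "t0 < T + 1" using t0 by auto
  have "b' k t0 + q' t0 \<le> rhs U k (x0, t0)"
  proof (rule pointwise_ode_subsolution[OF U, where q = "\<lambda>t. b k t + q t" and q' = "\<lambda>t. b' k t + q' t" and e = "min (t0 - a) (T + 1 - t0)"])
    show "((\<lambda>t. b k t + q t) has_real_derivative b' k t + q' t) (at t)" for t by (intro DERIV_add b qd)
    show "continuous_on UNIV (\<lambda>t. b' k t + q' t)" by (intro continuous_intros bc qc)
    show "U k (x0, t) - (b k t + q t) \<le> U k (x0, t0) - (b k t0 + q t0)" if "\<bar>t - t0\<bar> < min (t0 - a) (T + 1 - t0)" for t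
    proof -
      have "Psi k t \<le> Psi k t0" using that by (intro mx) linarith+
      then show ?thesis by (simp add: Psi_def)
    qed
  qed (use int a in auto)
  also have "\<dots> = - (\<Sum>j\<in>UNIV. d x0 k j * U j (x0, t0))" using x0 by (simp add: rhs_def in_A_iff)
  finally have 1: "b' k t0 + q' t0 \<le> - (\<Sum>j\<in>UNIV. d x0 k j * U j (x0, t0))" .
  have "U j (x0, t0) - b j t0 \<le> U k (x0, t0) - b k t0" for j
    using mx[of t0 j] t0 by (simp add: Psi_def)
  moreover have "U k (x0, t0) - b k t0 \<ge> 0" using val eta qp(1)[of t0] by (simp add: Psi_def)
  ultimately have "(\<Sum>j\<in>UNIV. d x0 k j * (U j (x0, t0) - b j t0)) \<ge> 0"
    using coupling_nonneg_at_max[of "\<lambda>j. U j (x0, t0) - b j t0" k x0] by simp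
  then have "(\<Sum>j\<in>UNIV. d x0 k j * U j (x0, t0)) \<ge> (\<Sum>j\<in>UNIV. d x0 k j * b j t0)"
    by (simp add: right_diff_distrib sum_subtractf)
  then show False using 1 super[OF t0(1), of k] qp(2)[of t0] by linarith
qed

text \<open>Irreducibility propagates a defect m - U k to all components within unit time. The barrier is
  m - z exp (- L (t - a)) (g (t - a))^(n i), where n i is the distance from i to k in the graph of
  the coupling matrix.\<close>
lemma defect_propagates:
  assumes x0: "x0 \<in> A"
  shows "\<exists>c>0. \<forall>U a m. evsol U \<longrightarrow> 0 \<le> a \<longrightarrow> (\<forall>i. U i (x0, a) \<le> m) \<longrightarrow>
    (\<forall>i. U i (x0, a + 1) \<le> m - c * (m - U k (x0, a)))"
proof -
  obtain n :: "'m \<Rightarrow> nat" where n: "n k = 0" "\<And>i. i \<noteq> k \<Longrightarrow> \<exists>j. j \<noteq> i \<and> d x0 i j \<noteq> 0 \<and> n i = Suc (n j)"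
    using irreducible_rank[OF d_irred[of x0], of k] by blast
  then obtain s where s: "\<And>i. i \<noteq> k \<Longrightarrow> s i \<noteq> i \<and> d x0 i (s i) \<noteq> 0 \<and> n i = Suc (n (s i))" by metis
  have sneg: "d x0 i (s i) < 0" if "i \<noteq> k" for i
    using s[OF that] d_off[of i "s i" x0] by (metis less_le)
  obtain C1 where C1: "C1 > 0" "\<And>i. real (n i) / - d x0 i (s i) \<le> C1"
    using uniform_bound[of "\<lambda>i. real (n i) / - d x0 i (s i)"] by blast
  \<comment> \<open>Slow enough that the growth n i * g of the barrier in component i is fed by the
    entry at the next vertex \<open>s i\<close>, see \<open>gn\<close>.\<close>
  define g where "g = 1 / C1"
  have g: "g > 0" using C1 by (simp add: g_def)
  have gn: "real (n i) * g \<le> - d x0 i (s i)" if "i \<noteq> k" for i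
    using C1(2)[of i] C1(1) sneg[OF that] by (simp add: g_def field_simps)
  \<comment> \<open>The factor exp(- L (t - a)) absorbs the diagonal entry of the matrix.\<close>
  obtain L where L: "L > 0" "\<And>i j x. \<bar>d x i j\<bar> \<le> L" using d_bounded by blast
  obtain C2 where C2: "C2 > 0" "\<And>i. 1 / (exp (- L) * g ^ n i) \<le> C2"
    using uniform_bound[of "\<lambda>i. 1 / (exp (- L) * g ^ n i)"] by blast
  \<comment> \<open>A lower bound, over all i, of exp(- L) * g ^ n i, the factor of z in the barrier
    at time a + 1.\<close>
  define c where "c = 1 / C2"
  have c: "c > 0" "c \<le> exp (- L) * g ^ n i" for i
  proof -
    show "c > 0" using C2 by (simp add: c_def)
    have "exp (- L) * g ^ n i > 0" using g by simp
    then show "c \<le> exp (- L) * g ^ n i" using C2(2)[of i] C2(1) by (simp add: c_def field_simps)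
  qed
  have row0: "(\<Sum>j\<in>UNIV. d x0 i j) = 0" for i using x0 by (simp add: in_A_iff)
  have "U i (x0, a + 1) \<le> m - c * (m - U k (x0, a))"
    if U: "evsol U" and a: "0 \<le> a" and m: "\<And>i. U i (x0, a) \<le> m" for U a m i
  proof -
    define z where "z = m - U k (x0, a)"
    have z: "z \<ge> 0" using m by (simp add: z_def)
    define be where "be = (\<lambda>i t. z * (exp (- L * (t - a)) * (g * (t - a)) ^ n i))"
    define be' where "be' = (\<lambda>i t. z * (exp (- L * (t - a)) * (real (n i) * (g * (t - a)) ^ (n i - 1) * g)
       + exp (- L * (t - a)) * (- L) * (g * (t - a)) ^ n i))"
    have bed: "(be i has_real_derivative be' i t) (at t)" for i t
      unfolding be_def be'_def by (auto intro!: derivative_eq_intros simp: algebra_simps)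
    have be0: "be j t \<ge> 0" if "t \<ge> a" for j t using z g that by (simp add: be_def)
    \<comment> \<open>Differentiating the power lowers its exponent to n (s i), so this term is paid
      by the entry at (i, s i). The diagonal entry is dominated by L, and the remaining entries have
      the right sign. For i = k the power is constant.\<close>
    have key: "be' i t + (\<Sum>j\<in>UNIV. d x0 i j * be j t) \<le> 0" if t: "t \<ge> a" for i t
    proof -
      let ?E = "z * exp (- L * (t - a))"
      have E: "?E \<ge> 0" using z by simp
      have diag: "d x0 i i * be i t \<le> L * be i t" using be0[OF t] L(2)[of x0 i i] by (intro mult_right_mono) linarith+
      have off: "d x0 i j * be j t \<le> 0" if "j \<noteq> i" for j
        using d_off[of i j x0] be0[OF t, of j] that by (simp add: mult_nonpos_nonneg)
      have b': "be' i t = ?E * (real (n i) * (g * (t - a)) ^ (n i - 1) * g) - L * be i t"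
        by (simp add: be'_def be_def algebra_simps)
      show ?thesis
      proof (cases "i = k")
        case True
        have "(\<Sum>j\<in>UNIV. d x0 i j * be j t) \<le> d x0 i i * be i t"
          using sum.remove[of UNIV i "\<lambda>j. d x0 i j * be j t"] sum_nonpos[of "UNIV - {i}" "\<lambda>j. d x0 i j * be j t"] off by simp
        then show ?thesis using diag b' n(1) True by simp
      next
        case False
        note si = s[OF False]
        have "(\<Sum>j\<in>UNIV. d x0 i j * be j t) = d x0 i i * be i t + (d x0 i (s i) * be (s i) t + (\<Sum>j\<in>UNIV - {i} - {s i}. d x0 i j * be j t))"
          using si by (simp add: sum.remove[of UNIV i] sum.remove[of "UNIV - {i}" "s i"])
        moreover have "(\<Sum>j\<in>UNIV - {i} - {s i}. d x0 i j * be j t) \<le> 0" using off by (intro sum_nonpos) auto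
        moreover have "?E * (real (n i) * (g * (t - a)) ^ (n i - 1) * g) \<le> - d x0 i (s i) * be (s i) t"
        proof -
          have "?E * (real (n i) * (g * (t - a)) ^ (n i - 1) * g) = (real (n i) * g) * (?E * (g * (t - a)) ^ n (s i))"
            using si by simp
          also have "\<dots> \<le> - d x0 i (s i) * (?E * (g * (t - a)) ^ n (s i))"
            using E g t by (intro mult_right_mono gn False) auto
          finally show ?thesis by (simp add: be_def mult.assoc)
        qed
        ultimately show ?thesis using diag b' by linarith
      qed
    qed
    have "U i (x0, a + 1) \<le> m - be i (a + 1)"
    proof (rule barrier_on_A[OF U x0 a, where b = "\<lambda>i t. m - be i t" and b' = "\<lambda>i t. - be' i t"])
      show "((\<lambda>t. m - be i t) has_real_derivative - be' i t) (at t)" for i t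
        using DERIV_diff[OF DERIV_const bed] by simp
      show "continuous_on UNIV (\<lambda>t. - be' i t)" for i unfolding be'_def by (intro continuous_intros)
      show "- be' i t + (\<Sum>j\<in>UNIV. d x0 i j * (m - be j t)) \<ge> 0" if "a \<le> t" for i t
      proof -
        have "(\<Sum>j\<in>UNIV. d x0 i j * (m - be j t)) = (\<Sum>j\<in>UNIV. d x0 i j) * m - (\<Sum>j\<in>UNIV. d x0 i j * be j t)"
          by (simp add: right_diff_distrib sum_subtractf sum_distrib_right)
        then show ?thesis using key[OF that, of i] row0 by simp
      qed
      \<comment> \<open>At t = a the power is 0 ^ n i: it equals 1 for i = k, giving equality with
        \<open>U k (x0, a)\<close>, and 0 for every other component, where the bound
        \<open>m\<close> is enough.\<close>
      show "U i (x0, a) \<le> m - be i a" for i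
      proof (cases "i = k")
        case True
        then show ?thesis by (simp add: be_def n(1) z_def)
      next
        case False
        then have "n i \<noteq> 0" using s[of i] by simp
        then show ?thesis using m[of i] by (simp add: be_def zero_power)
      qed
    qed simp
    moreover have "be i (a + 1) \<ge> c * z"
    proof -
      have "be i (a + 1) = (exp (- L) * g ^ n i) * z" by (simp add: be_def)
      also have "\<dots> \<ge> c * z" using c(2)[of i] z by (rule mult_right_mono)
      finally show ?thesis .
    qed
    ultimately show ?thesis unfolding z_def by linarith
  qed
  then show ?thesis using c(1) by blast
qed

text \<open>A defect m t - U k (x0, t) lowers \<open>m\<close> by c times its size within unit time,
  with c independent of t. Since m (t + 1) stays above the limit l, the defect tends to 0.\<close>

lemma converges_on_A:
  assumes U: "evsol U" and x0: "x0 \<in> A"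
  shows "\<exists>l. \<forall>k. ((\<lambda>t. U k (x0, t)) \<longlongrightarrow> l) at_top"
proof -
  obtain M where M: "M > 0" "\<And>i x t. t \<ge> 0 \<Longrightarrow> \<bar>U i (x, t)\<bar> \<le> M" using evsol_bounded[OF U] x0 by blast
  define m where "m = (\<lambda>t. Max (range (\<lambda>i. U i (x0, t))))"
  have m_ge: "U i (x0, t) \<le> m t" for i t unfolding m_def by (intro Max_ge) auto
  have m_le: "m t \<le> c" if "\<And>i. U i (x0, t) \<le> c" for t c unfolding m_def using that by (intro Max.boundedI) auto
  have row0: "(\<Sum>j\<in>UNIV. d x0 i j) = 0" for i using x0 by (simp add: in_A_iff)
  \<comment> \<open>The constant m s is a barrier because the row sums vanish at
    \<open>x0\<close>.\<close>
  have mono: "m t \<le> m s" if "0 \<le> s" "s \<le> t" for s t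
  proof (rule m_le)
    fix i
    show "U i (x0, t) \<le> m s"
      by (rule barrier_on_A[OF U x0 that, where b = "\<lambda>i t. m s" and b' = "\<lambda>i t. 0"])
         (auto simp: sum_distrib_right[symmetric] row0 m_ge)
  qed
  define l where "l = (INF t\<in>{0..}. m t)"
  have bdd: "bdd_below (m ` {0..})"
  proof (rule bdd_belowI2)
    fix t :: real assume "t \<in> {0..}"
    then show "- M \<le> m t" using M(2)[of t undefined x0] m_ge[of undefined t] by auto
  qed
  have l_le: "l \<le> m t" if "t \<ge> 0" for t unfolding l_def using bdd that by (intro cINF_lower) auto
  have "((\<lambda>t. U k (x0, t)) \<longlongrightarrow> l) at_top" for k
  proof (rule tendstoI)
    fix e :: real assume e: "e > 0"
    obtain c where c: "c > 0" "\<And>U a m i. evsol U \<Longrightarrow> 0 \<le> a \<Longrightarrow> (\<And>i. U i (x0, a) \<le> m) \<Longrightarrow>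
        U i (x0, a + 1) \<le> m - c * (m - U k (x0, a))"
      using defect_propagates[OF x0, of k] by blast
    \<comment> \<open>e/2 controls m t - l, and c * (e/2) turns the drop of \<open>m\<close> into a
      defect below e/2.\<close>
    define e' where "e' = min (e/2) (c * (e/2))"
    have e': "e' > 0" "e' \<le> e/2" "e' \<le> c * (e/2)" using e c by (auto simp: e'_def)
    have "\<exists>t\<in>{0..}. m t < l + e'"
      using cInf_lessD[of "m ` {0..}" "l + e'"] e'(1) unfolding l_def by auto
    then obtain T where T: "T \<ge> 0" "m T < l + e'" by auto
    have "dist (U k (x0, t)) l < e" if t: "t \<ge> T" for t
    proof -
      have t0: "t \<ge> 0" using t T by simp
      have mt: "m t < l + e'" using mono[OF T(1) t] T(2) by simp
      have "m (t + 1) \<le> m t - c * (m t - U k (x0, t))" by (rule m_le) (rule c(2)[OF U t0 m_ge])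
      then have "c * (m t - U k (x0, t)) < e'" using l_le[of "t + 1"] t0 mt by simp
      then have "c * (m t - U k (x0, t)) < c * (e/2)" using e' by simp
      then have "m t - U k (x0, t) < e/2" using c(1) by simp
      then show ?thesis using m_ge[of k t] l_le[OF t0] mt e' unfolding dist_real_def by linarith
    qed
    then show "\<forall>\<^sub>F t in at_top. dist (U k (x0, t)) l < e" unfolding eventually_at_top_linorder by blast
  qed
  then show ?thesis by blast
qed

section \<open>Convergence on the torus\<close>

lemma evsol_converges:
  assumes U: "evsol U" and A: "A \<noteq> {}"
  obtains v where "\<And>i. continuous_on UNIV (v i)" "\<And>i. periodic1 (v i)"
    "\<And>i. stsub (F i) (strhs v i) (v i)" "\<And>i. stsup (F i) (strhs v i) (v i)"
    "\<And>x i j. x \<in> A \<Longrightarrow> v i x = v j x"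
    "\<And>e. e > 0 \<Longrightarrow> \<exists>T\<ge>0. \<forall>i x t. t \<ge> T \<longrightarrow> \<bar>U i (x, t) - v i x\<bar> \<le> e"
proof -
  define V where "V = (\<lambda>i x. lsup (\<lambda>t. U i (x, t)))"
  define W where "W = (\<lambda>i x. - lsup (\<lambda>t. - U i (x, t)))"
  note hl = half_limits_solve[OF U A V_def W_def]
  have onA: "V i x = l \<and> W i x = l" if l: "\<And>k. ((\<lambda>t. U k (x, t)) \<longlongrightarrow> l) at_top" for x l i
  proof -
    obtain M where M: "M > 0" "\<And>i x t. t \<ge> 0 \<Longrightarrow> \<bar>U i (x, t)\<bar> \<le> M" using evsol_bounded[OF U A] by blast
    have lim: "lsup g = c" if g: "(g \<longlongrightarrow> c) at_top" and b: "\<forall>\<^sub>F t in at_top. \<bar>g t\<bar> \<le> M" for g c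
    proof -
      have "\<bar>lsup g - c\<bar> \<le> e" if e: "e > 0" for e
      proof -
        have e2: "e/2 > 0" using e by simp
        have "\<forall>\<^sub>F t in at_top. dist (g t) c < e/2 \<and> g t \<le> lsup g + e/2"
          using tendstoD[OF g e2] lsup_eventually[OF b e2] by (rule eventually_conj)
        then obtain T where T: "\<And>t. t \<ge> T \<Longrightarrow> dist (g t) c < e/2 \<and> g t \<le> lsup g + e/2"
          unfolding eventually_at_top_linorder by blast
        obtain t where t: "t \<ge> T" "g t > lsup g - e/2" using lsup_frequently[OF b e2] by blast
        then show ?thesis using T[OF t(1)] unfolding dist_real_def by linarith
      qed
      then have "\<bar>lsup g - c\<bar> \<le> 0" by (metis add_0 field_le_epsilon)
      then show ?thesis by simp
    qed
    have b: "\<forall>\<^sub>F t in at_top. \<bar>U i (x, t)\<bar> \<le> M" "\<forall>\<^sub>F t in at_top. \<bar>- U i (x, t)\<bar> \<le> M"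
      unfolding eventually_at_top_linorder using M(2) by auto
    show ?thesis using lim[OF l b(1)] lim[OF tendsto_minus[OF l] b(2)] by (simp add: V_def W_def)
  qed
  have VWA: "V i x = V j x \<and> W i x = V i x" if "x \<in> A" for i j x
    using converges_on_A[OF U that] onA[of x] by metis
  \<comment> \<open>The nontrivial inequality between upper and lower limit: V is a subsolution, W a
    supersolution, and they agree on A.\<close>
  have "V i x \<le> W i x" for i x
    by (rule stat_comparison[OF hl(1) hl(4) hl(2) hl(5) hl(3) hl(6)]) (metis VWA order_refl)
  moreover have "W i x \<le> V i x" for i x
  proof (rule field_le_epsilon)
    fix e :: real assume "e > 0"
    then have "e/2 > 0" by simp
    then obtain r T where "r > 0" "\<And>y t. dist y x < r \<Longrightarrow> t \<ge> T \<Longrightarrow> U i (y, t) \<le> V i x + e/2 \<and> W i x - e/2 \<le> U i (y, t)"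
      using hl(7)[of "e/2" x i] by blast
    from this(2)[of x T] this(1) show "W i x \<le> V i x + e" by simp
  qed
  ultimately have WV: "W = V" by (intro ext antisym)
  \<comment> \<open>Once V = W, the one-sided bounds of \<open>hl(7)\<close> give uniform
    convergence near each point; finitely many such neighbourhoods cover the unit cube.\<close>
  have unif: "\<exists>T\<ge>0. \<forall>i x t. t \<ge> T \<longrightarrow> \<bar>U i (x, t) - V i x\<bar> \<le> e" if e: "e > 0" for e
  proof -
    have e2: "e/2 > 0" using e by simp
    have "\<exists>T\<ge>0. \<forall>x t. t \<ge> T \<longrightarrow> \<bar>U i (x, t) - V i x\<bar> \<le> e" for i
    proof -
      have "\<exists>r>0. \<exists>T. \<forall>y t. dist y x < r \<longrightarrow> t \<ge> T \<longrightarrow> \<bar>U i (y, t) - V i y\<bar> \<le> e" for x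
      proof -
        obtain r T where r: "r > 0" "\<And>y t. dist y x < r \<Longrightarrow> t \<ge> T \<Longrightarrow> U i (y, t) \<le> V i x + e/2 \<and> V i x - e/2 \<le> U i (y, t)"
          using hl(7)[OF e2, of x i] unfolding WV by blast
        obtain r' where r': "r' > 0" "\<And>y. dist y x < r' \<Longrightarrow> dist (V i y) (V i x) < e/2"
          using hl(1)[of i] e2 unfolding continuous_on_iff by (metis UNIV_I)
        have "\<bar>U i (y, t) - V i y\<bar> \<le> e" if "dist y x < min r r'" "t \<ge> T" for y t
        proof -
          have "dist (V i y) (V i x) < e/2" "U i (y, t) \<le> V i x + e/2" "V i x - e/2 \<le> U i (y, t)"
            using r(2)[of y t] r'(2)[of y] that by auto
          then show ?thesis unfolding dist_real_def by linarith
        qed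
        moreover have "min r r' > 0" using r(1) r'(1) by simp
        ultimately show ?thesis by blast
      qed
      then obtain r where r: "\<And>x. r x > 0" "\<And>x. \<exists>T. \<forall>y t. dist y x < r x \<longrightarrow> t \<ge> T \<longrightarrow> \<bar>U i (y, t) - V i y\<bar> \<le> e"
        by metis
      then obtain T where T: "\<And>x y t. dist y x < r x \<Longrightarrow> t \<ge> T x \<Longrightarrow> \<bar>U i (y, t) - V i y\<bar> \<le> e" by metis
      let ?K = "cbox (0::real^'n) 1"
      have cov: "?K \<subseteq> (\<Union>x\<in>?K. ball x (r x))"
      proof
        fix x :: "real^'n" assume "x \<in> ?K"
        then show "x \<in> (\<Union>x\<in>?K. ball x (r x))" using r(1) centre_in_ball by blast
      qed
      obtain C where C: "finite C" "?K \<subseteq> (\<Union>x\<in>C. ball x (r x))"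
        by (rule compactE_image[OF compact_cbox open_ball cov])
      define T0 where "T0 = Max (insert 0 (T ` C))"
      have T0: "T0 \<ge> 0" "\<And>x. x \<in> C \<Longrightarrow> T x \<le> T0" using C(1) by (auto simp: T0_def)
      have "\<bar>U i (x, t) - V i x\<bar> \<le> e" if t: "t \<ge> T0" for x t
      proof -
        obtain k where k: "\<And>i. k $ i \<in> \<int>" "x + k \<in> cbox 0 1" using int_translate_into_cube[of x] by metis
        then obtain y where y: "y \<in> C" "x + k \<in> ball y (r y)" using C(2) by blast
        have "\<bar>U i (x + k, t) - V i (x + k)\<bar> \<le> e"
          using y t T0(2)[OF y(1)] by (intro T[where x = y]) (auto simp: dist_commute)
        then show ?thesis
          using periodic1_int_vector[OF evsolD(2)[OF U, of i t] k(1), of x] periodic1_int_vector[OF hl(2)[of i] k(1), of x]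
          by simp
      qed
      then show ?thesis using T0(1) by blast
    qed
    then obtain T where T: "\<And>i. T i \<ge> 0" "\<And>i x t. t \<ge> T i \<Longrightarrow> \<bar>U i (x, t) - V i x\<bar> \<le> e" by metis
    obtain C where "C > 0" "\<And>i. T i \<le> C" using uniform_bound by blast
    then show ?thesis using T(2) by (meson less_imp_le order_trans)
  qed
  show ?thesis
    by (rule that[of V]) (use hl(1,2,3) hl(6)[unfolded WV] VWA unif in blast)+
qed

end

section \<open>Return to the original notions of solution\<close>

theorem theorem5p4:
  fixes F :: "'m::finite \<Rightarrow> real^'n \<Rightarrow> real^'n \<Rightarrow> real"
    and f :: "'m \<Rightarrow> real^'n \<Rightarrow> real"
    and d :: "real^'n \<Rightarrow> 'm \<Rightarrow> 'm \<Rightarrow> real"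
    and u0 :: "'m \<Rightarrow> real^'n \<Rightarrow> real"
  assumes H0_F: "\<And>i. continuous_on UNIV (\<lambda>(x,p). F i x p)"
    and H0_f: "\<And>i. continuous_on UNIV (f i)"
    and H0_Fper: "\<And>i p. periodic1 (\<lambda>x. F i x p)"
    and H0_fper: "\<And>i. periodic1 (f i)"
    and H1_convex: "\<And>i x. convex_on UNIV (F i x)"
    and H1_coercive: "\<And>i. \<forall>M. \<exists>R. \<forall>x p. norm p \<ge> R \<longrightarrow> F i x p \<ge> M"
    and H1_zero: "\<And>i x. F i x 0 = 0"
    and H1_min: "\<And>i x p. F i x p \<ge> F i x 0"
    and H2: "\<And>i x. f i x \<ge> 0"
    and H3_cont: "\<And>i j. continuous_on UNIV (\<lambda>x. d x i j)"
    and H3_per: "\<And>i j. periodic1 (\<lambda>x. d x i j)"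
    and H3_diag: "\<And>i x. d x i i \<ge> 0"
    and H3_off: "\<And>i j x. i \<noteq> j \<Longrightarrow> d x i j \<le> 0"
    and H3_rowsum: "\<And>i x. (\<Sum>j\<in>UNIV. d x i j) \<ge> 0"
    and irred: "\<And>x. irreducible_mat (d x)"
    and A_nonempty: "{x. (\<Sum>i\<in>UNIV. f i x) = 0 \<and> (\<forall>i. (\<Sum>j\<in>UNIV. d x i j) = 0)} \<noteq> {}"
    and u0_cont: "\<And>i. continuous_on UNIV (u0 i)"
    and u0_per: "\<And>i. periodic1 (u0 i)"
  shows "\<exists>uinf. stat_visc_sol F f d uinf \<and>
     (\<forall>u. evol_visc_sol F f d u0 u \<longrightarrow>
        ((\<lambda>t. SUP x. norm ((\<chi> i. u i x t - uinf i x) :: real^'m)) \<longlongrightarrow> 0) at_top) \<and>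
     (\<forall>x\<in>{x. (\<Sum>i\<in>UNIV. f i x) = 0 \<and> (\<forall>i. (\<Sum>j\<in>UNIV. d x i j) = 0)}.
        \<forall>i j. uinf i x = uinf j x)"
proof -
  interpret weakly_coupled F f d
    by unfold_locales (fact assms)+
  have A: "A \<noteq> {}" using A_nonempty by (simp add: A_def)
  have stat: "stat_visc_sol F f d v"
    if "\<And>i. continuous_on UNIV (v i)" "\<And>i. periodic1 (v i)"
      "\<And>i. stsub (F i) (strhs v i) (v i)" "\<And>i. stsup (F i) (strhs v i) (v i)" for v
    unfolding stat_visc_sol_def
  proof (intro conjI allI impI)
    fix i and phi :: "real^'n \<Rightarrow> real" and Dphi x0 assume C: "C1_grad phi Dphi"
    show "F i x0 (Dphi x0) - f i x0 + (\<Sum>j\<in>UNIV. d x0 i j * v j x0) \<le> 0"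
      if "loc_max (\<lambda>y. v i y - phi y) x0"
      using stsubD[OF \<open>stsub (F i) (strhs v i) (v i)\<close> C that] by (simp add: strhs_def)
    show "F i x0 (Dphi x0) - f i x0 + (\<Sum>j\<in>UNIV. d x0 i j * v j x0) \<ge> 0"
      if "loc_min (\<lambda>y. v i y - phi y) x0"
      using stsupD[OF \<open>stsup (F i) (strhs v i) (v i)\<close> C that] by (simp add: strhs_def)
  qed (use that in auto)
  have evs: "evsol (\<lambda>i (x, t). u i x t)" if u: "evol_visc_sol F f d u0 u" for u
    unfolding evsol_def
  proof (intro allI conjI)
    fix i
    show "continuous_on (UNIV \<times> {0..}) (\<lambda>(x, t). u i x t)" using u unfolding evol_visc_sol_def by blast
    show "periodic1 (\<lambda>x. case (x, t) of (x, t) \<Rightarrow> u i x t)" for t using u unfolding evol_visc_sol_def by simp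
    show "evsub (F i) (rhs (\<lambda>i (x, t). u i x t) i) (\<lambda>(x, t). u i x t)"
      unfolding evsub_def
    proof (intro allI impI)
      fix phi D and z :: "(real^'n) \<times> real"
      assume z: "snd z > 0" and C: "C1_grad phi D" and m: "loc_max (\<lambda>z. (case z of (x, t) \<Rightarrow> u i x t) - phi z) z"
      obtain x0 t0 where zz: "z = (x0, t0)" by (metis prod.collapse)
      have "loc_max (\<lambda>(y, s). u i y s - phi (y, s)) (x0, t0)" using m by (simp add: zz case_prod_unfold)
      then have "snd (D (x0, t0)) + F i x0 (fst (D (x0, t0))) - f i x0 + (\<Sum>j\<in>UNIV. d x0 i j * u j x0 t0) \<le> 0"
        using u z C unfolding evol_visc_sol_def zz by simp
      then show "snd (D z) + F i (fst z) (fst (D z)) \<le> rhs (\<lambda>i (x, t). u i x t) i z"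
        by (simp add: zz rhs_def)
    qed
    show "evsup (F i) (rhs (\<lambda>i (x, t). u i x t) i) (\<lambda>(x, t). u i x t)"
      unfolding evsup_def
    proof (intro allI impI)
      fix phi D and z :: "(real^'n) \<times> real"
      assume z: "snd z > 0" and C: "C1_grad phi D" and m: "loc_min (\<lambda>z. (case z of (x, t) \<Rightarrow> u i x t) - phi z) z"
      obtain x0 t0 where zz: "z = (x0, t0)" by (metis prod.collapse)
      have "loc_min (\<lambda>(y, s). u i y s - phi (y, s)) (x0, t0)" using m by (simp add: zz case_prod_unfold)
      then have "snd (D (x0, t0)) + F i x0 (fst (D (x0, t0))) - f i x0 + (\<Sum>j\<in>UNIV. d x0 i j * u j x0 t0) \<ge> 0"
        using u z C unfolding evol_visc_sol_def zz by simp
      then show "snd (D z) + F i (fst z) (fst (D z)) \<ge> rhs (\<lambda>i (x, t). u i x t) i z"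
        by (simp add: zz rhs_def)
    qed
  qed
  txt \<open>Solvability of (E) is not assumed: if (E) had no solution, W would be a stationary solution.\<close>
  obtain W where W: "evsol W" "\<And>u i x t. evol_visc_sol F f d u0 u \<Longrightarrow> t \<ge> 0 \<Longrightarrow> u i x t = W i (x, t)"
  proof (cases "\<exists>u. evol_visc_sol F f d u0 u")
    case True
    then obtain w where w: "evol_visc_sol F f d u0 w" by blast
    \<comment> \<open>The limit is chosen before u, so one function must represent every solution:
      contraction with C = 0 gives uniqueness.\<close>
    have "u i x t \<le> v i x t" if u: "evol_visc_sol F f d u0 u" and v: "evol_visc_sol F f d u0 v" and t: "t \<ge> 0" for u v i x t
    proof -
      have "(\<lambda>(x, t). u i x t) (x, 0) \<le> (\<lambda>(x, t). v i x t) (x, 0) + 0" for i x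
        using u v unfolding evol_visc_sol_def by simp
      from evol_contraction[OF evs[OF u] evs[OF v] order_refl this t, of i x] show ?thesis by simp
    qed
    then have "u i x t = w i x t" if "evol_visc_sol F f d u0 u" "t \<ge> 0" for u i x t
      using that w by (intro antisym)
    then show ?thesis using that[OF evs[OF w]] by simp
  next
    case False
    obtain v where "\<And>i. continuous_on UNIV (v i)" "\<And>i. periodic1 (v i)"
      "\<And>i. stsub (F i) (strhs v i) (v i)" "\<And>i. stsup (F i) (strhs v i) (v i)"
      using stationary_solution_exists[OF A] by blast
    from evsol_stationary[where v = v, OF this] show ?thesis using that False by blast
  qed
  obtain v where v: "\<And>i. continuous_on UNIV (v i)" "\<And>i. periodic1 (v i)"
    "\<And>i. stsub (F i) (strhs v i) (v i)" "\<And>i. stsup (F i) (strhs v i) (v i)"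
    "\<And>x i j. x \<in> A \<Longrightarrow> v i x = v j x"
    "\<And>e. e > 0 \<Longrightarrow> \<exists>T\<ge>0. \<forall>i x t. t \<ge> T \<longrightarrow> \<bar>W i (x, t) - v i x\<bar> \<le> e"
    using evsol_converges[OF W(1) A] by blast
  have "((\<lambda>t. SUP x. norm ((\<chi> i. u i x t - v i x) :: real^'m)) \<longlongrightarrow> 0) at_top"
    if u: "evol_visc_sol F f d u0 u" for u
  proof (rule tendstoI)
    fix e :: real assume e: "e > 0"
    \<comment> \<open>The Euclidean norm is at most the sum of the CARD('m) components, hence at
      most e / 2.\<close>
    define e' where "e' = e / (2 * real CARD('m))"
    have e': "e' > 0" "real CARD('m) * e' < e" using e by (auto simp: e'_def)
    obtain T where T: "T \<ge> 0" "\<And>i x t. t \<ge> T \<Longrightarrow> \<bar>W i (x, t) - v i x\<bar> \<le> e'" using v(6)[OF e'(1)] by blast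
    have "dist (SUP x. norm ((\<chi> i. u i x t - v i x) :: real^'m)) 0 < e" if t: "t \<ge> T" for t
    proof -
      have le: "norm ((\<chi> i. u i x t - v i x) :: real^'m) \<le> real CARD('m) * e'" for x
      proof -
        have "norm ((\<chi> i. u i x t - v i x) :: real^'m) \<le> (\<Sum>i\<in>UNIV. \<bar>((\<chi> i. u i x t - v i x) :: real^'m) $ i\<bar>)"
          by (rule norm_le_l1_cart)
        also have "\<dots> \<le> (\<Sum>i\<in>(UNIV::'m set). e')"
          using T(2)[OF t] W(2)[OF u] t T(1) by (intro sum_mono) simp
        finally show ?thesis by simp
      qed
      have "(SUP x. norm ((\<chi> i. u i x t - v i x) :: real^'m)) \<le> real CARD('m) * e'"
        using le by (intro cSUP_least) auto
      moreover have "0 \<le> norm ((\<chi> i. u i 0 t - v i 0) :: real^'m)" by simp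
      moreover have "norm ((\<chi> i. u i 0 t - v i 0) :: real^'m) \<le> (SUP x. norm ((\<chi> i. u i x t - v i x) :: real^'m))"
        using le by (intro cSUP_upper bdd_aboveI2) auto
      ultimately show ?thesis using e'(2) unfolding dist_real_def by linarith
    qed
    then show "\<forall>\<^sub>F t in at_top. dist (SUP x. norm ((\<chi> i. u i x t - v i x) :: real^'m)) 0 < e"
      unfolding eventually_at_top_linorder by blast
  qed
  then show ?thesis using stat[OF v(1-4)] v(5) unfolding A_def by blast
qed

end
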